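(* Let $X\subset\mathbb{P}^4$ be a cubic threefold over $\mathbb{R}$ such that $X_{\mathbb{C}}$ has singularities of type $2\mathsf{A}_2+4\mathsf{A}_1$ or $2\mathsf{A}_3+4\mathsf{A}_1$. Then $X$ is rational over $\mathbb{R}$.
   Context: $X_{\mathbb{C}}$ denotes the base change of $X$ to $\mathbb{C}$. "$X_{\mathbb{C}}$ has singularities of type $2\mathsf{A}_n+4\mathsf{A}_1$" means that its singular locus consists of exactly six points, two of type $\mathsf{A}_n$ and four of type $\mathsf{A}_1$, where an $\mathsf{A}_n$-point is locally analytically isomorphic to $x^2+y^2+z^2+w^{n+1}=0$. *)

theory Defs
  imports
    "HOL-Analysis.Analysis"
    "HOL-Library.Poly_Mapping"
    "HOL-Library.Numeral_Type"
    "HOL-Computational_Algebra.Factorial_Ring"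
begin

section \<open>Polynomials in finitely many variables\<close>

text \<open>Variables are the elements of a finite type \<open>'n\<close>; a polynomial is a finitely supported map from
  exponent vectors to coefficients, multiplied by convolution.\<close>

type_synonym ('n, 'a) mpoly = "('n \<Rightarrow>\<^sub>0 nat) \<Rightarrow>\<^sub>0 'a"

definition Const :: "'a::zero \<Rightarrow> ('n, 'a) mpoly"
  where "Const c = Poly_Mapping.single 0 c"

definition Var :: "'n \<Rightarrow> ('n, 'a::zero_neq_one) mpoly"
  where "Var i = Poly_Mapping.single (Poly_Mapping.single i 1) 1"

definition homogeneous :: "nat \<Rightarrow> ('n::finite, 'a::zero) mpoly \<Rightarrow> bool"
  where "homogeneous d P \<longleftrightarrow>
    (\<forall>m\<in>Poly_Mapping.keys P. (\<Sum>i\<in>UNIV. Poly_Mapping.lookup m i) = d)"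

definition eval_via :: "('a::zero \<Rightarrow> 'b::comm_semiring_1) \<Rightarrow> ('n::finite \<Rightarrow> 'b) \<Rightarrow> ('n, 'a) mpoly \<Rightarrow> 'b"
  where "eval_via h g P =
    (\<Sum>m\<in>Poly_Mapping.keys P. h (Poly_Mapping.lookup P m) * (\<Prod>i\<in>UNIV. g i ^ Poly_Mapping.lookup m i))"

definition eval :: "('n::finite, 'a::comm_semiring_1) mpoly \<Rightarrow> 'a ^ 'n \<Rightarrow> 'a"
  where "eval P x = eval_via (\<lambda>c. c) (\<lambda>i. x $ i) P"

definition subst :: "('n \<Rightarrow> ('m, 'a) mpoly) \<Rightarrow> ('n::finite, 'a::comm_semiring_1) mpoly \<Rightarrow> ('m, 'a) mpoly"
  where "subst G P = eval_via Const G P"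

definition partial :: "'n \<Rightarrow> ('n, 'a::comm_semiring_1) mpoly \<Rightarrow> ('n, 'a) mpoly"
  where "partial i P =
    (\<Sum>m\<in>Poly_Mapping.keys P. Poly_Mapping.single (m - Poly_Mapping.single i 1)
       (of_nat (Poly_Mapping.lookup m i) * Poly_Mapping.lookup P m))"

text \<open>An equation of \<open>X\<^sub>\<complex>\<close>, given an equation of \<open>X\<close>.\<close>

definition complexify :: "('n, real) mpoly \<Rightarrow> ('n, complex) mpoly"
  where "complexify P = Poly_Mapping.map complex_of_real P"


section \<open>Singular points of a projective hypersurface\<close>

text \<open>A point of projective space is the set of all its homogeneous coordinate vectors.\<close>

definition proj_point :: "'a::field ^ 'n \<Rightarrow> ('a ^ 'n) set"
  where "proj_point x = {c *s x | c. c \<noteq> 0}"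

definition singular_locus :: "('n::finite, 'a::field) mpoly \<Rightarrow> ('a ^ 'n) set set"
  where "singular_locus F =
    {proj_point x | x. x \<noteq> 0 \<and> eval F x = 0 \<and> (\<forall>i. eval (partial i F) x = 0)}"

definition holo_on :: "(complex ^ 'n) set \<Rightarrow> (complex ^ 'n::finite \<Rightarrow> complex) \<Rightarrow> bool"
  where "holo_on U f \<longleftrightarrow>
    (\<forall>x\<in>U. \<exists>D. (f has_derivative D) (at x) \<and> (\<forall>c v. D (c *s v) = c * D v))"

definition holo_map_on :: "(complex ^ 'n) set \<Rightarrow> (complex ^ 'n::finite \<Rightarrow> complex ^ 'm::finite) \<Rightarrow> bool"
  where "holo_map_on U f \<longleftrightarrow> (\<forall>j. holo_on U (\<lambda>x. f x $ j))"

definition A_equation :: "nat \<Rightarrow> complex ^ 4 \<Rightarrow> complex"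
  where "A_equation n y = (y $ 0)\<^sup>2 + (y $ 1)\<^sup>2 + (y $ 2)\<^sup>2 + (y $ 3) ^ (n + 1)"

text \<open>The standard affine chart \<open>x\<^sub>i \<noteq> 0\<close> of projective 4-space is the affine hyperplane \<open>x $ i = 1\<close>.
  The maps \<open>\<phi>\<close> and \<open>\<psi>\<close> are mutually inverse biholomorphisms between a neighbourhood \<open>U\<close> of the
  origin in \<open>\<complex>\<^sup>4\<close> and the neighbourhood \<open>{x \<in> V. x $ i = 1}\<close> of the given point in that chart
  (\<open>V\<close> being open in \<open>\<complex>\<^sup>5\<close>, so that \<open>\<psi>\<close> is holomorphic on an ambient open set). The unit \<open>u\<close>
  expresses that the two local equations generate the same ideal, so that the isomorphism is one of
  analytic germs and not only of their underlying point sets.\<close>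

definition A_point :: "nat \<Rightarrow> (5, complex) mpoly \<Rightarrow> (complex ^ 5) set \<Rightarrow> bool"
  where "A_point n F P \<longleftrightarrow>
    (\<exists>i U V \<phi> \<psi> u.
       open U \<and> 0 \<in> U \<and> open V \<and>
       holo_map_on U \<phi> \<and> holo_map_on V \<psi> \<and>
       (\<forall>y\<in>U. \<phi> y \<in> V \<and> \<phi> y $ i = 1 \<and> \<psi> (\<phi> y) = y) \<and>
       (\<forall>x\<in>V. x $ i = 1 \<longrightarrow> \<psi> x \<in> U \<and> \<phi> (\<psi> x) = x) \<and>
       \<phi> 0 \<in> P \<and>
       holo_on U u \<and> (\<forall>y\<in>U. u y \<noteq> 0) \<and>
       (\<forall>y\<in>U. eval F (\<phi> y) = u y * A_equation n y))"

definition singularities_2An_4A1 :: "nat \<Rightarrow> (5, complex) mpoly \<Rightarrow> bool"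
  where "singularities_2An_4A1 n F \<longleftrightarrow>
    (\<exists>S T. singular_locus F = S \<union> T \<and> S \<inter> T = {} \<and> card S = 2 \<and> card T = 4 \<and>
       (\<forall>P\<in>S. A_point n F P) \<and> (\<forall>P\<in>T. A_point 1 F P))"


section \<open>Birational maps and rationality\<close>

text \<open>Below, \<open>F\<close> and \<open>F'\<close> are either zero or irreducible homogeneous polynomials, so that \<open>V(F)\<close> is
  either the whole projective space or an integral hypersurface. The coefficient type is the ground
  field, over which all maps are defined. A rational map on \<open>V(F)\<close> is given by homogeneous
  polynomials of a common degree, not all vanishing on \<open>V(F)\<close>; vanishing on \<open>V(F)\<close> is divisibility
  by \<open>F\<close> (for \<open>F = 0\<close>, being zero).\<close>

definition rational_map ::
    "('n::finite, 'k::field) mpoly \<Rightarrow> ('m::finite, 'k) mpoly \<Rightarrow> ('m \<Rightarrow> ('n, 'k) mpoly) \<Rightarrow> bool"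
  where "rational_map F F' G \<longleftrightarrow>
    (\<exists>d. \<forall>j. homogeneous d (G j)) \<and> (\<exists>j. \<not> F dvd G j) \<and> F dvd subst G F'"

text \<open>\<open>H \<circ> G\<close> is the identity of \<open>V(F)\<close> as a rational map: modulo \<open>F\<close>, its components are the
  coordinates multiplied by a common nonzero factor.\<close>

definition left_inverse_map ::
    "('n::finite, 'k::field) mpoly \<Rightarrow> ('m::finite \<Rightarrow> ('n, 'k) mpoly) \<Rightarrow> ('n \<Rightarrow> ('m, 'k) mpoly) \<Rightarrow> bool"
  where "left_inverse_map F G H \<longleftrightarrow>
    (\<exists>a. \<not> F dvd a \<and> (\<forall>i. F dvd (subst G (H i) - a * Var i)))"

definition birational ::
    "('n::finite, 'k::field) mpoly \<Rightarrow> ('m::finite, 'k) mpoly \<Rightarrow> bool"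
  where "birational F F' \<longleftrightarrow>
    (\<exists>G H. rational_map F F' G \<and> rational_map F' F H \<and>
       left_inverse_map F G H \<and> left_inverse_map F' H G)"

text \<open>The zero polynomial in four variables stands for projective 3-space.\<close>

definition rational_threefold :: "(5, 'k::field) mpoly \<Rightarrow> bool"
  where "rational_threefold F \<longleftrightarrow> irreducible F \<and> birational F (0 :: (4, 'k) mpoly)"

end

theory Submission
  imports Defs "HOL-Computational_Algebra.Polynomial"
begin

text \<open>
  Write \<open>B\<close> for the symmetric trilinear form with \<open>B x x x = F x\<close>, so that
  \<open>x\<close> spans a singular point iff \<open>B x x = 0\<close>. If \<open>F\<close> were
  reducible, the infinitely many common zeros of a linear and a quadratic factor would be singular, so
  finiteness of the singular locus gives irreducibility. If there is a real singular point, projection from it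
  is birational. Otherwise the two points of type \<open>A\<^sub>n\<close> form a conjugate pair
  \<open>p\<close>, \<open>p'\<close>, since at exactly these two points the Hessian \<open>B p\<close>
  is degenerate.

  Projection from the line through \<open>p\<close> and \<open>p'\<close> brings \<open>F\<close> into
  the form \<open>\<bar>a\<bar>\<^sup>2 l + 2 Re (a g') + C\<close> with a complex coordinate
  \<open>a\<close> and forms \<open>l\<close>, \<open>g\<close>, \<open>C\<close> of degrees 1, 2, 3
  in three real variables (\<open>g'\<close> is the conjugate of \<open>g\<close>), so that \<open>l F =
  \<bar>l a + g\<bar>\<^sup>2 - D\<close> with the quartic \<open>D = \<bar>g\<bar>\<^sup>2 - l
  C\<close>. The four points of type \<open>A\<^sub>1\<close> lie over four nodes of \<open>D\<close>,
  two conjugate pairs, no three of them collinear and none on the line \<open>l = 0\<close>. Hence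
  \<open>D\<close> is a quadratic form in two real conics spanning the pencil through these nodes.
  Degeneracy of \<open>B p\<close> makes \<open>g\<close> a square on \<open>l = 0\<close>; if the
  quadratic form split over the reals into two different factors, these would be proportional on \<open>l =
  0\<close>, and a conic of the pencil would contain that line; a square would give infinitely many singular
  points. So the form is positive definite, \<open>D = \<bar>q\<bar>\<^sup>2\<close> for a complex
  quadratic form \<open>q\<close>, and \<open>\<bar>l a + g\<bar>\<^sup>2 =
  \<bar>q\<bar>\<^sup>2\<close> is parametrized as in Hilbert's Theorem 90.
\<close>

section \<open>Evaluation and homogeneous forms\<close>

text \<open>The local type enters only through the rank of the Hessian: \<open>B p\<close> has a
  kernel vector independent of \<open>p\<close> at an A_n point with n >= 2, and none at an A_1
  point. This treats n = 2 and n = 3 together.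

  The recurring obstacle is degenerate position: collinear nodes, a node on l = 0, a cone, a double
  conic. Each is excluded by writing down too many singular points, either a curve of them or one
  more point than the six.

  After scaling, the nodes of the quartic are (\<plusminus> i, 0, 1) and (\<plusminus> i, 1, 0) in
  real coordinates r, s, t, so the pencil is spanned by s t and r^2 + s^2 + t^2.

  The equation |u|^2 = |q|^2 with u = l a + g is solved by u = q conj(w) / w, where w = q + conj(u);
  the ratio Re w : Im w supplies the remaining parameter of projective 3-space.\<close>

abbreviation "lookup \<equiv> Poly_Mapping.lookup"
abbreviation "keys \<equiv> Poly_Mapping.keys"
abbreviation "single \<equiv> Poly_Mapping.single"

section \<open>Evaluation is a ring homomorphism\<close>

lemma eval_via_superset:
  assumes "finite A" "keys P \<subseteq> A" "h 0 = 0"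
  shows "eval_via h g P = (\<Sum>m\<in>A. h (lookup P m) * (\<Prod>i\<in>UNIV. g i ^ lookup m i))"
  unfolding eval_via_def
  by (rule sum.mono_neutral_left) (use assms in \<open>auto simp: in_keys_iff\<close>)

lemma eval_via_0 [simp]: "eval_via h g 0 = 0"
  by (simp add: eval_via_def)

lemma eval_via_add:
  assumes "h 0 = 0" "\<And>a b. h (a + b) = h a + h b"
  shows "eval_via h g (P + Q) = eval_via h g P + eval_via h g Q"
proof -
  let ?A = "keys P \<union> keys Q"
  have "finite ?A" by simp
  moreover have "keys (P + Q) \<subseteq> ?A" by (rule keys_add)
  ultimately show ?thesis
    using assms by (simp add: eval_via_superset[of ?A] lookup_add sum.distrib[symmetric] algebra_simps)
qed

lemma eval_via_sum:
  assumes "h 0 = 0" "\<And>a b. h (a + b) = h a + h b"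
  shows "eval_via h g (\<Sum>k\<in>A. P k) = (\<Sum>k\<in>A. eval_via h g (P k))"
  by (induction A rule: infinite_finite_induct) (simp_all add: eval_via_add[OF assms])

lemma eval_via_single:
  assumes "h 0 = 0"
  shows "eval_via h g (single m c) = h c * (\<Prod>i\<in>UNIV. g i ^ lookup m i)"
  using eval_via_superset[of "{m}" "single m c" h g] assms by simp

lemma poly_mapping_sum_single:
  "P = (\<Sum>m\<in>keys P. single m (lookup P m))"
  by (rule poly_mapping_eqI)
     (auto simp: lookup_sum lookup_single when_def in_keys_iff if_distrib sum.delta cong: if_cong)

lemma eval_via_mult:
  assumes "h 0 = 0" "\<And>a b. h (a + b) = h a + h b" "\<And>a b. h (a * b) = h a * h b"
  shows "eval_via h g (P * Q) = eval_via h g P * eval_via h g Q"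
proof -
  have "P * Q = (\<Sum>m\<in>keys P. single m (lookup P m)) *
      (\<Sum>m\<in>keys Q. single m (lookup Q m))"
    using poly_mapping_sum_single[of P] poly_mapping_sum_single[of Q] by simp
  also have "\<dots> = (\<Sum>m\<in>keys P. \<Sum>n\<in>keys Q.
      single (m + n) (lookup P m * lookup Q n))"
    by (simp add: sum_product mult_single)
  finally show ?thesis
    using assms by (simp add: eval_via_sum eval_via_single eval_via_def[of h g P] eval_via_def[of h g Q]
      sum_product lookup_add power_add prod.distrib mult_ac)
qed

lemma eval_0 [simp]: "eval 0 x = 0"
  by (simp add: eval_def)

lemma eval_add [simp]: "eval (P + Q) x = eval P x + eval Q x"
  by (simp add: eval_def eval_via_add)

lemma eval_mult [simp]: "eval (P * Q) x = eval P x * eval Q x"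
  by (simp add: eval_def eval_via_mult)

lemma eval_sum: "eval (\<Sum>k\<in>A. P k) x = (\<Sum>k\<in>A. eval (P k) x)"
  by (simp add: eval_def eval_via_sum)

lemma eval_Const [simp]: "eval (Const c) x = c"
  by (simp add: eval_def Const_def eval_via_single)

lemma prod_power_single:
  fixes f :: "'n::finite \<Rightarrow> 'a::comm_semiring_1"
  shows "(\<Prod>i\<in>UNIV. f i ^ lookup (single j (1::nat)) i) = f j"
proof -
  have "(\<Prod>i\<in>UNIV. f i ^ lookup (single j (1::nat)) i) =
    (\<Prod>i\<in>UNIV. if i = j then f i else 1)"
    by (rule prod.cong) (auto simp: lookup_single when_def)
  then show ?thesis by simp
qed

lemma eval_Var [simp]: "eval (Var i) x = x $ i"
  using prod_power_single[of "\<lambda>i. x $ i" i] by (simp add: eval_def Var_def eval_via_single)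

lemma eval_uminus [simp]: "eval (- P) x = - eval P x" for P :: "('n::finite, 'a::comm_ring_1) mpoly"
  using eval_add[of P "-P" x] by (simp add: eq_neg_iff_add_eq_0 add.commute)

lemma eval_diff [simp]: "eval (P - Q) x = eval P x - eval Q x" for P :: "('n::finite, 'a::comm_ring_1) mpoly"
  using eval_add[of P "-Q" x] by simp

lemma eval_1 [simp]: "eval 1 x = 1"
  using eval_Const[of 1 x] by (simp add: Const_def)

lemma eval_power [simp]: "eval (P ^ n) x = eval P x ^ n"
  by (induction n) simp_all

lemma eval_prod: "eval (\<Prod>k\<in>A. P k) x = (\<Prod>k\<in>A. eval (P k) x)"
  by (induction A rule: infinite_finite_induct) simp_all

lemma eval_subst: "eval (subst G P) x = eval P (\<chi> i. eval (G i) x)"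
  unfolding subst_def eval_via_def eval_sum by (simp add: eval_prod eval_def[of P] eval_via_def)

lemma eval_complexify: "eval (complexify P) x = eval_via of_real (($) x) P"
proof -
  have "keys (complexify P) = keys P"
    by (auto simp: complexify_def in_keys_iff map.rep_eq when_def)
  moreover have "lookup (complexify P) m = of_real (lookup P m)" for m
    by (auto simp: complexify_def map.rep_eq when_def)
  ultimately show ?thesis
    by (simp add: eval_def eval_via_def)
qed

lemma eval_complexify_of_real: "eval (complexify P) (\<chi> i. of_real (x $ i)) = of_real (eval P x)"
  by (simp add: eval_complexify) (simp add: eval_via_def eval_def)

lemma eval_complexify_mult: "eval (complexify (P * Q)) x = eval (complexify P) x * eval (complexify Q) x"
  by (simp add: eval_complexify eval_via_mult)

section \<open>Real polynomials are determined by their values\<close>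

text \<open>Induction on the variable set: grouping the sum by the exponent of the new variable
  \<open>j\<close> gives a polynomial in one variable, whose coefficients must vanish. Injectivity
  concerns the exponents restricted to \<open>V\<close>, since removing a variable leaves the
  exponent functions themselves unchanged.\<close>

lemma monomials_independent:
  fixes f :: "('n \<Rightarrow> nat) \<Rightarrow> real"
  assumes "finite V" "finite K" "inj_on (\<lambda>m. restrict m V) K"
    and "\<And>x. (\<Sum>m\<in>K. f m * (\<Prod>i\<in>V. x i ^ m i)) = 0"
  shows "\<forall>m\<in>K. f m = 0"
  using assms
proof (induction V arbitrary: K rule: finite_induct)
  case empty
  show ?case
  proof
    fix m assume "m \<in> K"
    with empty have "K = {m}" by (auto simp: inj_on_def)
    with empty.prems(3) show "f m = 0" by simp
  qed
next
  case (insert j V)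
  define N where "N = (\<Sum>m\<in>K. m j)"
  have mN: "m j \<le> N" if "m \<in> K" for m
    unfolding N_def by (rule member_le_sum) (use that insert.prems in auto)
  let ?K = "\<lambda>k. {m\<in>K. m j = k}"
  have coeff: "(\<Sum>m\<in>?K k. f m * (\<Prod>i\<in>V. x i ^ m i)) = 0" if "k \<le> N" for k x
  proof -
    have "(\<Sum>k\<le>N. (\<Sum>m\<in>?K k. f m * (\<Prod>i\<in>V. x i ^ m i)) * z ^ k) = 0" for z
    proof -
      have "(\<Sum>k\<le>N. (\<Sum>m\<in>?K k. f m * (\<Prod>i\<in>V. x i ^ m i)) * z ^ k) =
          (\<Sum>k\<le>N. \<Sum>m\<in>?K k. f m * (\<Prod>i\<in>V. x i ^ m i) * z ^ m j)"
        by (simp add: sum_distrib_right)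
      also have "\<dots> = (\<Sum>m\<in>K. f m * (\<Prod>i\<in>V. x i ^ m i) * z ^ m j)"
        by (rule sum.group) (use insert.prems mN in auto)
      also have "\<dots> = (\<Sum>m\<in>K. f m * (\<Prod>i\<in>insert j V. (x(j := z)) i ^ m i))"
      proof (rule sum.cong[OF refl])
        fix m
        have "(\<Prod>i\<in>V. x i ^ m i) = (\<Prod>i\<in>V. (x(j := z)) i ^ m i)"
          by (rule prod.cong) (use insert.hyps in auto)
        then show "f m * (\<Prod>i\<in>V. x i ^ m i) * z ^ m j = f m * (\<Prod>i\<in>insert j V. (x(j := z)) i ^ m i)"
          using insert.hyps by (simp add: mult_ac)
      qed
      also have "\<dots> = 0" by (rule insert.prems)
      finally show ?thesis .
    qed
    then show ?thesis
      using polyfun_eq_0[of "\<lambda>k. \<Sum>m\<in>?K k. f m * (\<Prod>i\<in>V. x i ^ m i)" N] that by blast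
  qed
  show ?case
  proof
    fix m assume m: "m \<in> K"
    have inj: "inj_on (\<lambda>m. restrict m V) (?K (m j))"
    proof (rule inj_onI)
      fix a b assume a: "a \<in> ?K (m j)" and b: "b \<in> ?K (m j)" and ab: "restrict a V = restrict b V"
      have "a i = b i" if "i \<in> V" for i using ab that by (metis restrict_apply')
      then have "restrict a (insert j V) = restrict b (insert j V)" using a b by (auto simp: restrict_def)
      with a b show "a = b" using inj_onD[OF insert.prems(2), of a b] by auto
    qed
    have "\<forall>m'\<in>?K (m j). f m' = 0"
      by (rule insert.IH[OF _ inj coeff[OF mN[OF m]]]) (use insert.prems in simp)
    with m show "f m = 0" by blast
  qed
qed

lemma eval_eq_0_iff:
  fixes P :: "('n::finite, real) mpoly"
  shows "(\<forall>x. eval P x = 0) \<longleftrightarrow> P = 0"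
proof
  assume *: "\<forall>x. eval P x = 0"
  define K where "K = lookup ` keys P"
  define f where "f = (\<lambda>m. lookup P (Abs_poly_mapping m))"
  have inj: "inj_on lookup (keys P)"
    by (rule inj_onI) (simp add: lookup_inject)
  have "\<forall>m\<in>K. f m = 0"
  proof (rule monomials_independent[where V = UNIV])
    fix x :: "'n \<Rightarrow> real"
    have "(\<Sum>m\<in>K. f m * (\<Prod>i\<in>UNIV. x i ^ m i)) = eval P (\<chi> i. x i)"
      unfolding K_def sum.reindex[OF inj] by (simp add: f_def eval_def eval_via_def)
    with * show "(\<Sum>m\<in>K. f m * (\<Prod>i\<in>UNIV. x i ^ m i)) = 0" by simp
  next
    show "inj_on (\<lambda>m. restrict m UNIV) K" by (simp add: restrict_UNIV)
  qed (auto simp: K_def)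
  then have "lookup P m = 0" for m
    by (cases "m \<in> keys P") (auto simp: K_def f_def in_keys_iff)
  then show "P = 0" by (intro poly_mapping_eqI) simp
qed simp

text \<open>The reals being infinite, polynomial identities can be checked on values; this lets the
  argument compute with functions on real space.\<close>

lemma poly_eqI_eval:
  fixes P Q :: "('n::finite, real) mpoly"
  assumes "\<And>x. eval P x = eval Q x"
  shows "P = Q"
  using eval_eq_0_iff[of "P - Q"] assms by simp

section \<open>Homogeneous polynomials and the functions they define\<close>

definition mdeg :: "('n::finite \<Rightarrow>\<^sub>0 nat) \<Rightarrow> nat"
  where "mdeg m = (\<Sum>i\<in>UNIV. lookup m i)"

lemma mdeg_add: "mdeg (m + n) = mdeg m + mdeg n"
  by (simp add: mdeg_def lookup_add sum.distrib)

lemma homogeneous_iff: "homogeneous d P \<longleftrightarrow> (\<forall>m\<in>keys P. mdeg m = d)"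
  by (simp add: homogeneous_def mdeg_def)

lemma homogeneous_0 [simp]: "homogeneous d 0"
  by (simp add: homogeneous_def)

lemma homogeneous_add: "homogeneous d P \<Longrightarrow> homogeneous d Q \<Longrightarrow> homogeneous d (P + Q)"
  unfolding homogeneous_def using keys_add[of P Q] by blast

lemma homogeneous_mult:
  assumes "homogeneous d P" "homogeneous e Q"
  shows "homogeneous (d + e) (P * Q)"
  unfolding homogeneous_iff
proof
  fix m assume "m \<in> keys (P * Q)"
  then obtain a b where "m = a + b" "a \<in> keys P" "b \<in> keys Q"
    using keys_mult[of P Q] by blast
  with assms show "mdeg m = d + e" by (simp add: homogeneous_iff mdeg_add)
qed

lemma homogeneous_Const [simp]: "homogeneous 0 (Const c)"
  by (simp add: homogeneous_def Const_def)

lemma homogeneous_Var: "homogeneous 1 (Var i :: ('n::finite, 'a::zero_neq_one) mpoly)"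
proof -
  have "(\<Sum>j\<in>UNIV. lookup (single i (1::nat)) j) =
      (\<Sum>j\<in>UNIV. if j = i then 1 else 0)"
    by (rule sum.cong) (auto simp: lookup_single when_def)
  then show ?thesis by (simp add: homogeneous_def Var_def)
qed

text \<open>Homogeneous polynomials are handled as functions, so that rational maps can be given by
  formulas. The zero function is a form of every degree.\<close>

definition form :: "nat \<Rightarrow> (real ^ 'n::finite \<Rightarrow> real) \<Rightarrow> bool"
  where "form d f \<longleftrightarrow> (\<exists>P. homogeneous d P \<and> (\<forall>x. eval P x = f x))"

lemma form_coord: "form 1 (\<lambda>x. x $ i)"
  unfolding form_def by (rule exI[of _ "Var i"]) (use homogeneous_Var in auto)

lemma form_const: "form 0 (\<lambda>x. c)"
  unfolding form_def by (rule exI[of _ "Const c"]) simp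

lemma form_zero: "form d (\<lambda>x. 0)"
  unfolding form_def by (rule exI[of _ 0]) simp

lemma form_add: "form d f \<Longrightarrow> form d g \<Longrightarrow> form d (\<lambda>x. f x + g x)"
  unfolding form_def by (metis eval_add homogeneous_add)

lemma form_mult: "form d f \<Longrightarrow> form e g \<Longrightarrow> d + e = k \<Longrightarrow> form k (\<lambda>x. f x * g x)"
  unfolding form_def by (metis eval_mult homogeneous_mult)

lemma form_cmult: "form d f \<Longrightarrow> form d (\<lambda>x. c * f x)"
  using form_mult[OF form_const, of d f d] by simp

lemma form_uminus: "form d f \<Longrightarrow> form d (\<lambda>x. - f x)"
  using form_cmult[of d f "-1"] by simp

lemma form_diff: "form d f \<Longrightarrow> form d g \<Longrightarrow> form d (\<lambda>x. f x - g x)"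
  using form_add[of d f, OF _ form_uminus] by simp

lemma form_power: "form d f \<Longrightarrow> d * n = k \<Longrightarrow> form k (\<lambda>x. f x ^ n)"
proof (induction n arbitrary: k)
  case 0 then show ?case using form_const[of 1] by simp
next
  case (Suc n) then show ?case using form_mult[of d f "d * n" "\<lambda>x. f x ^ n" k] by simp
qed

lemma form_sum: "(\<And>i. i \<in> A \<Longrightarrow> form d (f i)) \<Longrightarrow> form d (\<lambda>x. \<Sum>i\<in>A. f i x)"
  by (induction A rule: infinite_finite_induct) (auto intro: form_zero form_add)

lemma form_linear: "form 1 (\<lambda>x. (A *v x) $ i)"
  unfolding matrix_vector_mult_def
  by (simp only: vec_lambda_beta) (intro form_sum form_cmult form_coord)

lemma form_prod: "finite S \<Longrightarrow> (\<And>i. i \<in> S \<Longrightarrow> form (d i) (f i)) \<Longrightarrow> form (\<Sum>i\<in>S. d i) (\<lambda>x. \<Prod>i\<in>S. f i x)"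
proof (induction S rule: finite_induct)
  case empty then show ?case using form_const[of 1] by simp
next
  case (insert i S) then show ?case by (auto intro!: form_mult)
qed

lemma form_compose:
  assumes "form d f" "\<And>i. form e (\<lambda>x. g x $ i)"
  shows "form (d * e) (\<lambda>x. f (g x))"
proof -
  obtain P where P: "homogeneous d P" "\<And>x. eval P x = f x" using assms(1) unfolding form_def by blast
  have "f (g x) = (\<Sum>m\<in>keys P. lookup P m *
      (\<Prod>i\<in>UNIV. g x $ i ^ lookup m i))" for x
    unfolding P(2)[symmetric] by (simp only: eval_def eval_via_def)
  moreover have "form (d * e) (\<lambda>x. \<Sum>m\<in>keys P. lookup P m *
      (\<Prod>i\<in>UNIV. g x $ i ^ lookup m i))"
  proof (intro form_sum form_cmult)
    fix m assume "m \<in> keys P"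
    then have "(\<Sum>i\<in>UNIV. e * lookup m i) = d * e"
      using P(1) by (simp add: homogeneous_def mult.commute flip: sum_distrib_left)
    then show "form (d * e) (\<lambda>x. \<Prod>i\<in>UNIV. g x $ i ^ lookup m i)"
      using form_prod[of UNIV "\<lambda>i. e * lookup m i" "\<lambda>i x. g x $ i ^ lookup m i"]
        form_power[OF assms(2) refl] by simp
  qed
  ultimately show ?thesis by simp
qed

lemma form_compose_linear: "form d f \<Longrightarrow> form d (\<lambda>x. f (A *v x))"
  using form_compose[OF _ form_linear, of d f A] by simp

lemma form_scale:
  assumes "form d f"
  shows "f (c *s x) = c ^ d * f x"
proof -
  obtain P where P: "homogeneous d P" "\<And>x. eval P x = f x" using assms unfolding form_def by blast
  have "(\<Prod>i\<in>UNIV. (c * x $ i) ^ lookup m i) = c ^ d * (\<Prod>i\<in>UNIV. x $ i ^ lookup m i)"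
    if "m \<in> keys P" for m
    using P(1) that by (simp add: power_mult_distrib prod.distrib homogeneous_def flip: power_sum)
  then show ?thesis
    unfolding P(2)[symmetric] by (simp add: eval_def eval_via_def sum_distrib_left mult_ac)
qed

text \<open>A point \<open>h y\<close> with \<open>b y \<noteq> 0\<close> lies on the hypersurface but not on the zero locus of \<open>a\<close>, so no
  factoriality argument is needed to see that the polynomials in question are not divisible by \<open>F\<close>.\<close>

definition birational_forms :: "(real ^ 5 \<Rightarrow> real) \<Rightarrow> bool"
  where "birational_forms f \<longleftrightarrow>
    (\<exists>d e k l m g h a b K. 0 < d \<and> (\<forall>j::4. form d (\<lambda>x. g x $ j)) \<and> (\<forall>i::5. form e (\<lambda>y. h y $ i)) \<and>
       form k a \<and> form l b \<and> (\<forall>i. form m (\<lambda>x. K x $ i)) \<and>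
       (\<forall>x. h (g x) = a x *s x + f x *s K x) \<and> (\<forall>y. g (h y) = b y *s y) \<and> (\<forall>y. f (h y) = 0) \<and>
       (\<exists>y. y \<noteq> 0 \<and> b y \<noteq> 0))"

lemma birational_if_forms:
  fixes F :: "(5, real) mpoly"
  assumes "birational_forms (eval F)"
  shows "birational F (0 :: (4, real) mpoly)"
proof -
  obtain d e k l m g h a b K where d: "0 < d"
    and g: "\<And>j::4. form d (\<lambda>x. g x $ j)" and h: "\<And>i::5. form e (\<lambda>y. h y $ i)"
    and a: "form k a" and b: "form l b" and K: "\<And>i. form m (\<lambda>x. K x $ i)"
    and hg: "\<And>x. h (g x) = a x *s x + eval F x *s K x" and gh: "\<And>y. g (h y) = b y *s y"
    and Fh: "\<And>y. eval F (h y) = 0" and y: "\<exists>y. y \<noteq> 0 \<and> b y \<noteq> 0"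
    using assms unfolding birational_forms_def by metis
  obtain y where y: "y \<noteq> 0" "b y \<noteq> 0" using y by blast
  have "\<forall>j. \<exists>P. homogeneous d P \<and> (\<forall>x. eval P x = g x $ j)" using g unfolding form_def by blast
  then obtain G where G: "\<And>j. homogeneous d (G j)" "\<And>j x. eval (G j) x = g x $ j" by metis
  have "\<forall>j. \<exists>P. homogeneous e P \<and> (\<forall>x. eval P x = h x $ j)" using h unfolding form_def by blast
  then obtain H where H: "\<And>j. homogeneous e (H j)" "\<And>j x. eval (H j) x = h x $ j" by metis
  obtain a' where a': "\<And>x. eval a' x = a x" using a unfolding form_def by blast
  obtain b' where b': "\<And>x. eval b' x = b x" using b unfolding form_def by blast
  have "\<forall>i. \<exists>P. \<forall>x. eval P x = K x $ i" using K unfolding form_def by blast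
  then obtain K' where K': "\<And>i x. eval (K' i) x = K x $ i" by metis
  \<comment> \<open>Positivity of the degree makes \<open>g\<close> vanish at the origin; as
    \<open>g (h y)\<close> is the nonzero vector \<open>b y *s y\<close>, the vector
    \<open>h y\<close> is nonzero.\<close>
  have g0: "g 0 = 0"
  proof (rule vec_eq_iff[THEN iffD2], rule allI)
    fix j show "g 0 $ j = 0 $ j" using form_scale[OF g, of 0 0 j] d by (simp add: zero_power)
  qed
  have hy: "h y \<noteq> 0" using gh[of y] g0 y by (metis vector_mul_eq_0)
  have not_dvd: "\<not> F dvd P" if "eval P (h y) \<noteq> 0" for P
    using that Fh[of y] by (auto simp: dvd_def)
  \<comment> \<open>Both sides are \<open>h (g (h y))\<close>, computed once by \<open>hg\<close>
    and once by \<open>gh\<close>. Since \<open>b y\<close> and \<open>h y\<close> are nonzero, so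
    is \<open>a (h y)\<close>.\<close>
  have "a (h y) *s h y = b y ^ e *s h y"
  proof -
    have "a (h y) *s h y = h (b y *s y)" using hg[of "h y"] Fh[of y] gh[of y] by simp
    also have "\<dots> = b y ^ e *s h y" using form_scale[OF h] by (simp add: vec_eq_iff)
    finally show ?thesis .
  qed
  then have ahy: "a (h y) \<noteq> 0" using hy y(2) by (metis power_not_zero vector_mul_eq_0)
  obtain j where j: "y $ j \<noteq> 0" using y(1) by (auto simp: vec_eq_iff)
  obtain i where i: "h y $ i \<noteq> 0" using hy by (auto simp: vec_eq_iff)
  have G': "(\<chi> j. eval (G j) x) = g x" for x by (simp add: G vec_eq_iff)
  have H': "(\<chi> j. eval (H j) x) = h x" for x by (simp add: H vec_eq_iff)
  have s0: "subst G (0 :: (4, real) mpoly) = 0" by (rule poly_eqI_eval) (simp add: eval_subst)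
  have "rational_map F (0 :: (4, real) mpoly) G"
    unfolding rational_map_def
  proof (intro conjI exI allI)
    show "homogeneous d (G j)" for j by (rule G)
    show "\<not> F dvd G j" by (rule not_dvd) (use y(2) j in \<open>simp add: G gh\<close>)
  qed (simp add: s0)
  moreover have "rational_map (0 :: (4, real) mpoly) F H"
    unfolding rational_map_def
  proof (intro conjI exI allI)
    show "homogeneous e (H i)" for i by (rule H)
    show "\<not> 0 dvd H i" using H(2)[of i y] i by auto
    show "0 dvd subst H F"
      by (simp, rule poly_eqI_eval) (simp add: eval_subst H' Fh)
  qed
  moreover have "left_inverse_map F G H"
    unfolding left_inverse_map_def
  proof (intro exI conjI allI)
    show "\<not> F dvd a'" by (rule not_dvd) (use ahy in \<open>simp add: a'\<close>)
    have "subst G (H i) - a' * Var i = F * K' i" for i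
      by (rule poly_eqI_eval) (simp add: eval_subst G' H hg a' K')
    then show "F dvd subst G (H i) - a' * Var i" for i by simp
  qed
  moreover have "left_inverse_map (0 :: (4, real) mpoly) H G"
    unfolding left_inverse_map_def
  proof (intro exI conjI allI)
    show "\<not> 0 dvd b'" using b'[of y] y(2) by auto
    have "subst H (G j) - b' * Var j = 0" for j
      by (rule poly_eqI_eval) (simp add: eval_subst H' G gh b')
    then show "0 dvd subst H (G j) - b' * Var j" for j by simp
  qed
  ultimately show ?thesis unfolding birational_def by blast
qed

lemma birational_forms_linear:
  assumes "birational_forms (\<lambda>x. f (M *v x))" and N: "M ** N = mat 1"
  shows "birational_forms f"
proof -
  obtain d e k l m g h a b K where d: "0 < d"
    and g: "\<And>j::4. form d (\<lambda>x. g x $ j)" and h: "\<And>i::5. form e (\<lambda>y. h y $ i)"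
    and a: "form k a" and b: "form l b" and K: "\<And>i. form m (\<lambda>x. K x $ i)"
    and hg: "\<And>x. h (g x) = a x *s x + f (M *v x) *s K x" and gh: "\<And>y. g (h y) = b y *s y"
    and Fh: "\<And>y. f (M *v h y) = 0" and y: "\<exists>y. y \<noteq> 0 \<and> b y \<noteq> 0"
    using assms(1) unfolding birational_forms_def by metis
  have N': "N ** M = mat 1" using N matrix_left_right_inverse by blast
  have MN: "M *v (N *v x) = x" "N *v (M *v x) = x" for x
    by (simp_all add: matrix_vector_mul_assoc N N')
  have lin: "form n (\<lambda>x. (M *v L x) $ i)" if "\<And>i. form n (\<lambda>x. L x $ i)" for L :: "real ^ 'n \<Rightarrow> real ^ 5" and n i
    unfolding matrix_vector_mult_def using that by (auto intro!: form_sum form_cmult)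
  show ?thesis
    unfolding birational_forms_def
  proof (rule exI[of _ d], rule exI[of _ e], rule exI[of _ k], rule exI[of _ l], rule exI[of _ m],
      rule exI[of _ "\<lambda>x. g (N *v x)"], rule exI[of _ "\<lambda>y. M *v h y"],
      rule exI[of _ "\<lambda>x. a (N *v x)"], rule exI[of _ b], rule exI[of _ "\<lambda>x. M *v K (N *v x)"],
      intro conjI allI)
    show "form d (\<lambda>x. g (N *v x) $ j)" for j by (rule form_compose_linear[OF g])
    show "form e (\<lambda>y. (M *v h y) $ i)" for i by (rule lin[OF h])
    show "form k (\<lambda>x. a (N *v x))" by (rule form_compose_linear[OF a])
    show "form m (\<lambda>x. (M *v K (N *v x)) $ i)" for i
      by (rule lin) (rule form_compose_linear[OF K])
    show "M *v h (g (N *v x)) = a (N *v x) *s x + f x *s (M *v K (N *v x))" for x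
      by (simp add: hg MN matrix_vector_right_distrib vector_scalar_commute)
    show "g (N *v (M *v h y)) = b y *s y" for y by (simp add: MN gh)
  qed (use d b y Fh in auto)
qed

section \<open>The symmetric trilinear form of a cubic\<close>

text \<open>One real coefficient tensor serves vectors over any real field, so the polarizations of
  the cubic and of its complexification share their coefficients.\<close>

definition tri :: "(5 \<Rightarrow> 5 \<Rightarrow> 5 \<Rightarrow> real) \<Rightarrow> 'a::real_field ^ 5 \<Rightarrow> 'a ^ 5 \<Rightarrow> 'a ^ 5 \<Rightarrow> 'a"
  where "tri c x y z = (\<Sum>i\<in>UNIV. \<Sum>j\<in>UNIV. \<Sum>k\<in>UNIV. of_real (c i j k) * x $ i * y $ j * z $ k)"

lemma tri_swap12: "tri (\<lambda>i j k. c j i k) x y z = tri c y x z"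
  unfolding tri_def by (subst sum.swap) (simp add: mult_ac)

lemma tri_swap23: "tri (\<lambda>i j k. c i k j) x y z = tri c x z y"
  unfolding tri_def by (rule sum.cong[OF refl], subst sum.swap) (simp add: mult_ac)

lemma tri_add1: "tri c (x + x') y z = tri c x y z + tri c x' y z"
  by (simp add: tri_def algebra_simps sum.distrib)

lemma tri_scale1: "tri c (a *s x) y z = a * tri c x y z"
  by (simp add: tri_def sum_distrib_left mult_ac)

lemma tri_coeff_add: "tri (\<lambda>i j k. c i j k + d i j k) x y z = tri c x y z + tri d x y z"
  by (simp add: tri_def algebra_simps sum.distrib)

lemma tri_coeff_cmult: "tri (\<lambda>i j k. r * c i j k) x y z = of_real r * tri c x y z"
  by (simp add: tri_def sum_distrib_left mult_ac)

definition symmetrization :: "(5 \<Rightarrow> 5 \<Rightarrow> 5 \<Rightarrow> real) \<Rightarrow> 5 \<Rightarrow> 5 \<Rightarrow> 5 \<Rightarrow> real"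
  where "symmetrization c = (\<lambda>i j k. 1 / 6 * (c i j k + (c i k j + (c j i k + (c j k i + (c k i j + c k j i))))))"

lemma tri_symmetrization: "tri (symmetrization c) x x x = tri c x x x"
proof -
  have a: "tri (\<lambda>i j k. c i k j) x x x = tri c x x x" by (rule tri_swap23)
  have b: "tri (\<lambda>i j k. c j i k) x x x = tri c x x x" by (rule tri_swap12)
  have d: "tri (\<lambda>i j k. c j k i) x x x = tri c x x x"
    using tri_swap12[of "\<lambda>i j k. c i k j" x x x] a by (rule trans)
  have e: "tri (\<lambda>i j k. c k i j) x x x = tri c x x x"
    using tri_swap23[of "\<lambda>i j k. c j i k" x x x] b by (rule trans)
  have f: "tri (\<lambda>i j k. c k j i) x x x = tri c x x x"
    using tri_swap12[of "\<lambda>i j k. c k i j" x x x] e by (rule trans)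
  show ?thesis
    unfolding symmetrization_def tri_coeff_cmult tri_coeff_add a b d e f by simp
qed

lemma mdeg_SucE:
  assumes "mdeg m = Suc d"
  obtains i m' where "m = single i 1 + m'" "mdeg m' = d"
proof -
  obtain i where i: "lookup m i \<noteq> 0"
    using assms unfolding mdeg_def by (metis nat.distinct(1) sum.neutral)
  define m' where "m' = m - single i 1"
  have m: "m = single i 1 + m'"
    by (rule poly_mapping_eqI) (use i in \<open>auto simp: m'_def lookup_add lookup_minus lookup_single when_def\<close>)
  moreover have "mdeg (single i (1::nat)) = 1"
    using homogeneous_Var[of i] by (simp add: homogeneous_iff Var_def)
  ultimately have "mdeg m' = d" using assms by (simp add: mdeg_add)
  with m that show ?thesis by blast
qed

lemma mdeg_0E: "mdeg m = 0 \<Longrightarrow> m = 0"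
  by (rule poly_mapping_eqI) (simp add: mdeg_def)

lemma mdeg_1E:
  assumes "mdeg m = 1"
  obtains i where "m = single i 1"
  using mdeg_SucE[of m 0] mdeg_0E assms by (metis One_nat_def add.right_neutral)

lemma mdeg_2E:
  assumes "mdeg m = 2"
  obtains i j where "m = single i 1 + single j 1"
  using mdeg_SucE[of m 1] mdeg_1E assms by (metis Suc_1)

lemma mdeg_3E:
  assumes "mdeg m = 3"
  obtains i j k where "m = single i 1 + (single j 1 + single k 1)"
  using mdeg_SucE[of m 2] mdeg_2E assms by (metis eval_nat_numeral(3))

lemma prod_power_lookup_add:
  fixes f :: "'n::finite \<Rightarrow> 'a::comm_semiring_1"
  shows "(\<Prod>i\<in>UNIV. f i ^ lookup (m + n) i) =
    (\<Prod>i\<in>UNIV. f i ^ lookup m i) * (\<Prod>i\<in>UNIV. f i ^ lookup n i)"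
  by (simp add: lookup_add power_add prod.distrib)

lemma tri_of_terms:
  assumes "finite K"
  shows "tri (\<lambda>i j k. \<Sum>m\<in>K. if i = p m \<and> j = q m \<and> k = r m then f m else 0) x y z =
    (\<Sum>m\<in>K. of_real (f m) * (x $ p m * (y $ q m * z $ r m)))"
proof -
  have single_term: "(\<Sum>i\<in>UNIV. \<Sum>j\<in>UNIV. \<Sum>k\<in>UNIV.
      of_real (if i = a \<and> j = b \<and> k = d then u else 0) * x $ i * y $ j * z $ k) =
      of_real u * (x $ a * (y $ b * z $ d))" for a b d u
  proof -
    have "(\<Sum>k\<in>UNIV. of_real (if i = a \<and> j = b \<and> k = d then u else 0) * x $ i * y $ j * z $ k) =
        (if j = b then if i = a then of_real u * (x $ a * (y $ b * z $ d)) else 0 else 0)" for i j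
    proof -
      have "(\<Sum>k\<in>UNIV. of_real (if i = a \<and> j = b \<and> k = d then u else 0) * x $ i * y $ j * z $ k) =
          (\<Sum>k\<in>UNIV. if k = d then if j = b then if i = a then of_real u * (x $ a * (y $ b * z $ d)) else 0 else 0 else 0)"
        by (rule sum.cong) auto
      then show ?thesis by simp
    qed
    then show ?thesis by simp
  qed
  have "tri (\<lambda>i j k. \<Sum>m\<in>K. if i = p m \<and> j = q m \<and> k = r m then f m else 0) x y z =
      (\<Sum>m\<in>K. \<Sum>i\<in>UNIV. \<Sum>j\<in>UNIV. \<Sum>k\<in>UNIV.
        of_real (if i = p m \<and> j = q m \<and> k = r m then f m else 0) * x $ i * y $ j * z $ k)"
    unfolding tri_def of_real_sum sum_distrib_right
    by (subst sum.swap, subst (3) sum.swap, subst (4) sum.swap, rule refl)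
  then show ?thesis by (simp only: single_term)
qed

text \<open>Each monomial of degree three is written as a product of three variables in some chosen
  order; the tensor supported on these ordered triples is then averaged over all
  permutations.\<close>

lemma cubic_tri:
  fixes F :: "(5, real) mpoly"
  assumes "homogeneous 3 F"
  obtains c where "\<And>i j k. c i j k = c j i k" "\<And>i j k. c i j k = c i k j"
    "\<And>x. eval F x = tri c x x x" "\<And>x. eval (complexify F) x = tri c x x x"
proof -
  let ?K = "keys F"
  have "\<forall>m\<in>?K. \<exists>i j k. m = single i 1 + (single j 1 + single k 1)"
    using assms mdeg_3E unfolding homogeneous_iff by metis
  then obtain p q r where pqr: "\<And>m. m \<in> ?K \<Longrightarrow>
      m = single (p m) 1 + (single (q m) 1 + single (r m) 1)"
    by metis
  define c0 where "c0 = (\<lambda>i j k. \<Sum>m\<in>?K. if i = p m \<and> j = q m \<and> k = r m then lookup F m else 0)"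
  have monomial: "(\<Prod>i\<in>UNIV. f i ^ lookup m i) = f (p m) * (f (q m) * f (r m))"
    if "m \<in> ?K" for m and f :: "5 \<Rightarrow> real"
    by (subst pqr[OF that]) (simp only: prod_power_lookup_add prod_power_single)
  have monomial': "(\<Prod>i\<in>UNIV. f i ^ lookup m i) = f (p m) * (f (q m) * f (r m))"
    if "m \<in> ?K" for m and f :: "5 \<Rightarrow> complex"
    by (subst pqr[OF that]) (simp only: prod_power_lookup_add prod_power_single)
  show ?thesis
  proof
    show "symmetrization c0 i j k = symmetrization c0 j i k" for i j k by (simp add: symmetrization_def)
    show "symmetrization c0 i j k = symmetrization c0 i k j" for i j k by (simp add: symmetrization_def)
    show "eval F x = tri (symmetrization c0) x x x" for x
      by (simp add: tri_symmetrization c0_def tri_of_terms eval_def eval_via_def monomial)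
    show "eval (complexify F) x = tri (symmetrization c0) x x x" for x
      by (simp add: tri_symmetrization c0_def tri_of_terms eval_complexify eval_via_def monomial')
  qed
qed

section \<open>Singular points in terms of the trilinear form\<close>

text \<open>Links the formal \<open>partial\<close> to an analytic derivative. By uniqueness of
  derivatives, its values can then be read off from the trilinear form instead of being compared
  monomial by monomial.\<close>

lemma has_field_derivative_eval:
  fixes P :: "('n::finite, 'a::real_normed_field) mpoly"
  shows "((\<lambda>t. eval P (x + t *s axis l 1)) has_field_derivative eval (partial l P) x) (at 0)"
proof -
  have split: "(\<Prod>i\<in>UNIV. f i) = f l * (\<Prod>i\<in>UNIV - {l}. f i)" for f :: "'n \<Rightarrow> 'a"
    by (rule prod.remove) auto
  have eq: "(\<Prod>i\<in>UNIV. ((x + t *s axis l 1) $ i) ^ e i) = (x $ l + t) ^ e l * (\<Prod>i\<in>UNIV - {l}. x $ i ^ e i)" for t e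
    by (subst split) (auto simp: axis_def intro!: arg_cong2[of _ _ _ _ times] prod.cong)
  have "((\<lambda>t. eval P (x + t *s axis l 1)) has_field_derivative
      (\<Sum>m\<in>keys P. lookup P m * (of_nat (lookup m l) *
         x $ l ^ (lookup m l - 1) * (\<Prod>i\<in>UNIV - {l}. x $ i ^ lookup m i)))) (at 0)"
    unfolding eval_def eval_via_def eq
    by (rule DERIV_sum) (auto intro!: derivative_eq_intros)
  also have "(\<Sum>m\<in>keys P. lookup P m * (of_nat (lookup m l) *
         x $ l ^ (lookup m l - 1) * (\<Prod>i\<in>UNIV - {l}. x $ i ^ lookup m i))) =
      eval (partial l P) x"
    unfolding partial_def eval_sum
  proof (rule sum.cong[OF refl])
    fix m
    have "(\<Prod>i\<in>UNIV - {l}. x $ i ^ lookup (m - single l 1) i) =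
        (\<Prod>i\<in>UNIV - {l}. x $ i ^ lookup m i)"
      by (rule prod.cong) (auto simp: lookup_minus lookup_single when_def)
    then have "(\<Prod>i\<in>UNIV. x $ i ^ lookup (m - single l 1) i) =
        x $ l ^ (lookup m l - 1) * (\<Prod>i\<in>UNIV - {l}. x $ i ^ lookup m i)"
      by (subst split) (simp add: lookup_minus)
    then show "lookup P m * (of_nat (lookup m l) *
         x $ l ^ (lookup m l - 1) * (\<Prod>i\<in>UNIV - {l}. x $ i ^ lookup m i)) =
       eval (single (m - single l 1)
         (of_nat (lookup m l) * lookup P m)) x"
      by (simp add: eval_def eval_via_single mult_ac)
  qed
  finally show ?thesis .
qed

locale real_cubic =
  fixes c :: "5 \<Rightarrow> 5 \<Rightarrow> 5 \<Rightarrow> real"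
  assumes c_swap12: "c i j k = c j i k" and c_swap23: "c i j k = c i k j"
begin

abbreviation B :: "'a::real_field ^ 5 \<Rightarrow> 'a ^ 5 \<Rightarrow> 'a ^ 5 \<Rightarrow> 'a" where "B \<equiv> tri c"

lemma B_commute12: "B x y z = B y x z"
proof -
  have "(\<lambda>i j k. c j i k) = c" using c_swap12 by (intro ext) simp
  then show ?thesis using tri_swap12[of c x y z] by argo
qed

lemma B_commute23: "B x y z = B x z y"
proof -
  have "(\<lambda>i j k. c i k j) = c" using c_swap23 by (intro ext) simp
  then show ?thesis using tri_swap23[of c x y z] by argo
qed

lemma B_commute13: "B x y z = B z y x"
  using B_commute12[of x y z] B_commute23[of y x z] B_commute12[of y z x] by argo

lemma B_left_commute: "B x y z = B y z x"
  using B_commute12[of x y z] B_commute23[of y x z] by argo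

lemmas B_add1 = tri_add1[of c]
lemmas B_scale1 = tri_scale1[of c]

lemma B_add2: "B x (y + y') z = B x y z + B x y' z"
  using B_add1[of y y' x z] B_commute12[of x "y + y'" z] B_commute12[of x y z] B_commute12[of x y' z] by argo

lemma B_add3: "B x y (z + z') = B x y z + B x y z'"
  using B_add1[of z z' y x] B_commute13[of x y "z + z'"] B_commute13[of x y z] B_commute13[of x y z'] by argo

lemma B_scale2: "B x (a *s y) z = a * B x y z"
  using B_scale1[of a y x z] B_commute12[of x "a *s y" z] B_commute12[of x y z] by argo

lemma B_scale3: "B x y (a *s z) = a * B x y z"
  using B_scale1[of a z y x] B_commute13[of x y "a *s z"] B_commute13[of x y z] by argo

lemma B_uminus1: "B (- x) y z = - B x y z" and B_uminus2: "B x (- y) z = - B x y z"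
  and B_uminus3: "B x y (- z) = - B x y z"
  using B_scale1[of "-1" x y z] B_scale2[of x "-1" y z] B_scale3[of x y "-1" z] by simp_all

lemma B_diff1: "B (x - x') y z = B x y z - B x' y z"
  using B_add1[of x "- x'"] by (simp add: B_uminus1)

lemma B_diff2: "B x (y - y') z = B x y z - B x y' z"
  using B_add2[of x y "- y'"] by (simp add: B_uminus2)

lemma B_diff3: "B x y (z - z') = B x y z - B x y z'"
  using B_add3[of x y z "- z'"] by (simp add: B_uminus3)

lemma B_zero: "B 0 y z = 0" "B x 0 z = 0" "B x y 0 = 0"
  by (simp_all add: tri_def)

lemmas B_linear = B_add1 B_add2 B_add3 B_scale1 B_scale2 B_scale3 B_uminus1 B_uminus2 B_uminus3
  B_diff1 B_diff2 B_diff3 B_zero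

lemma B_expand3: "B x y z = (\<Sum>i\<in>UNIV. z $ i * B x y (axis i 1))"
proof -
  have "B x y (\<Sum>i\<in>A. z $ i *s axis i 1) = (\<Sum>i\<in>A. z $ i * B x y (axis i 1))" for A
    by (induction A rule: infinite_finite_induct) (simp_all add: B_linear)
  from this[of UNIV] show ?thesis by (simp add: basis_expansion)
qed

lemma has_field_derivative_B_cube:
  fixes x v :: "'a::real_normed_field ^ 5"
  shows "((\<lambda>t. B (x + t *s v) (x + t *s v) (x + t *s v)) has_field_derivative 3 * B x x v) (at 0)"
proof -
  have "B (x + t *s v) (x + t *s v) (x + t *s v) = B x x x + t * (3 * B x x v) + t\<^sup>2 * (3 * B x v v) + t ^ 3 * B v v v" for t
    using B_commute23[of x v x] B_left_commute[of v x x] B_left_commute[of v x v] B_left_commute[of v v x]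
    by (simp add: B_linear algebra_simps power2_eq_square power3_eq_cube)
  then show ?thesis by (auto intro!: derivative_eq_intros)
qed

definition sing :: "complex ^ 5 \<Rightarrow> bool"
  where "sing x \<longleftrightarrow> x \<noteq> 0 \<and> (\<forall>v. B x x v = 0)"

text \<open>The partial derivatives at \<open>x\<close> are \<open>3 * B x x (axis l 1)\<close>,
  which determine \<open>B x x\<close>; the vanishing of the cubic itself is the case
  \<open>v = x\<close>.\<close>

lemma singular_locus_eq:
  assumes "\<And>x. eval P x = B x x x"
  shows "singular_locus P = {proj_point x | x. sing x}"
proof -
  have part: "eval (partial l P) x = 3 * B x x (axis l 1)" for l x
    using DERIV_unique[OF has_field_derivative_eval[of P x l]] has_field_derivative_B_cube[of x "axis l 1"]
    by (simp add: assms)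
  have "(eval P x = 0 \<and> (\<forall>i. eval (partial i P) x = 0)) \<longleftrightarrow> (\<forall>v. B x x v = 0)" for x
  proof
    assume *: "eval P x = 0 \<and> (\<forall>i. eval (partial i P) x = 0)"
    show "\<forall>v. B x x v = 0"
    proof
      fix v show "B x x v = 0" using * by (subst B_expand3) (simp add: part)
    qed
  qed (simp add: part assms)
  then show ?thesis unfolding singular_locus_def sing_def by blast
qed

lemma sing_scale: "sing x \<Longrightarrow> k \<noteq> 0 \<Longrightarrow> sing (k *s x)"
  by (simp add: sing_def B_linear)

end

lemma proj_point_eq_iff:
  assumes "proj_point x = proj_point y"
  obtains k where "k \<noteq> 0" "x = k *s y"
proof -
  have "x \<in> proj_point x" unfolding proj_point_def by (auto intro: exI[of _ 1])
  with assms that show ?thesis unfolding proj_point_def by auto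
qed

lemma proj_point_scale: "k \<noteq> 0 \<Longrightarrow> proj_point (k *s x) = proj_point x"
  unfolding proj_point_def
  by (auto simp: vector_smult_assoc) (metis divide_eq_0_iff nonzero_divide_eq_eq)

locale finitely_singular_cubic = real_cubic +
  assumes finite_sing: "finite {proj_point x | x. sing x}"
begin

text \<open>The form in which finiteness is used: a family of singular points over an infinite
  parameter set repeats a projective point, and comparing two such members yields the contradictions
  below.\<close>

lemma sing_familyE:
  assumes "infinite S" "\<And>s. s \<in> S \<Longrightarrow> sing (f s)"
  obtains s s' k where "s \<in> S" "s' \<in> S" "s \<noteq> s'" "k \<noteq> 0" "f s = k *s f s'"
proof -
  have "(\<lambda>s. proj_point (f s)) ` S \<subseteq> {proj_point x | x. sing x}" using assms by blast
  then have "\<not> inj_on (\<lambda>s. proj_point (f s)) S"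
    using assms(1) finite_sing finite_imageD finite_subset by blast
  then show ?thesis unfolding inj_on_def using that proj_point_eq_iff by metis
qed

end

section \<open>Irreducibility\<close>

text \<open>Degree and order at 0 are additive and both sum to \<open>n\<close> over the two
  factors, while the order never exceeds the degree. Hence they agree on \<open>p\<close>, which
  leaves a constant times a power of the variable.\<close>

lemma monom_factor:
  fixes p q :: "'a::idom poly"
  assumes "p * q = monom a n" "a \<noteq> 0"
  obtains b k where "p = monom b k"
proof -
  have nz: "p \<noteq> 0" "q \<noteq> 0" using assms by (auto simp: monom_eq_0_iff)
  have deg: "degree p + degree q = n"
    using degree_mult_eq[OF nz] assms by (simp add: degree_monom_eq)
  have "order 0 p + order 0 q = n"
    using order_mult[of p q 0] assms nz by (simp add: monom_eq_0_iff order_0_monom)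
  with deg order_degree[OF nz(1), of 0] order_degree[OF nz(2), of 0] have ord: "order 0 p = degree p" by linarith
  have "monom 1 (degree p) dvd p"
    using monom_1_dvd_iff[OF nz(1)] ord by simp
  then obtain r where r: "p = monom 1 (degree p) * r" by (rule dvdE)
  with nz have "r \<noteq> 0" by auto
  then have "degree p = degree p + degree r"
    using r degree_mult_eq[of "monom 1 (degree p)" r] by (simp add: monom_eq_0_iff degree_monom_eq)
  then obtain b where "r = [:b:]" using degree_eq_zeroE[of r] by auto
  with r have "p = monom b (degree p)" by (simp add: smult_monom)
  with that show ?thesis by blast
qed

section \<open>Factors of homogeneous polynomials are homogeneous\<close>

text \<open>Substitutes \<open>Var i\<close> times a new variable T for \<open>Var i\<close>: the
  coefficient of T^e is the part of degree e, so homogeneity becomes being a monomial in T.\<close>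

definition graded :: "('n::finite, 'a::comm_semiring_1) mpoly \<Rightarrow> ('n, 'a) mpoly poly"
  where "graded P = eval_via (\<lambda>c. [:Const c:]) (\<lambda>i. monom (Var i) 1) P"

lemma graded_mult: "graded (P * Q) = graded P * graded Q"
  unfolding graded_def
  by (rule eval_via_mult) (simp_all add: Const_def single_add mult_single mult.commute)

lemma Var_power: "Var i ^ k = single (single i k) 1"
  by (induction k) (simp_all add: Var_def mult_single single_add[symmetric])

lemma prod_Var_power:
  "(\<Prod>i\<in>UNIV. Var i ^ lookup m i :: ('n::finite, 'a::comm_semiring_1) mpoly) = single m 1"
proof -
  have "(\<Prod>i\<in>S. Var i ^ lookup m i :: ('n, 'a) mpoly) =
      single (\<Sum>i\<in>S. single i (lookup m i)) 1" if "finite S" for S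
    using that by (induction S rule: finite_induct) (simp_all add: Var_power mult_single)
  moreover have "(\<Sum>i\<in>UNIV. single i (lookup m i)) = m"
    by (rule poly_mapping_eqI) (simp add: lookup_sum lookup_single when_def)
  ultimately show ?thesis by simp
qed

lemma prod_monom: "(\<Prod>i\<in>S. monom (f i) (e i)) = monom (\<Prod>i\<in>S. f i) (\<Sum>i\<in>S. e i)"
  by (induction S rule: infinite_finite_induct) (simp_all add: mult_monom)

lemma graded_eq:
  "graded P = (\<Sum>m\<in>keys P. monom (single m (lookup P m)) (mdeg m))"
  unfolding graded_def eval_via_def
proof (rule sum.cong[OF refl])
  fix m :: "'a \<Rightarrow>\<^sub>0 nat"
  have "(\<Prod>i\<in>UNIV. monom (Var i) 1 ^ lookup m i) = monom (single m (1::'b)) (mdeg m)"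
    unfolding monom_power prod_monom by (simp add: prod_Var_power mdeg_def)
  then show "[:Const (lookup P m):] * (\<Prod>i\<in>UNIV. monom (Var i) 1 ^ lookup m i) =
      monom (single m (lookup P m)) (mdeg m)"
    by (simp add: smult_monom Const_def mult_single)
qed

lemma lookup_coeff_graded:
  "lookup (coeff (graded P) e) m = (if mdeg m = e then lookup P m else 0)"
proof -
  have "lookup (coeff (graded P) e) m =
      (\<Sum>n\<in>keys P. if m = n then if mdeg m = e then lookup P m else 0 else 0)"
    unfolding graded_eq coeff_sum lookup_sum
    by (rule sum.cong) (auto simp: coeff_monom lookup_single when_def)
  then show ?thesis by (auto simp: in_keys_iff)
qed

lemma homogeneous_iff_graded: "homogeneous d P \<longleftrightarrow> (\<exists>Q. graded P = monom Q d)"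
proof
  assume h: "homogeneous d P"
  have "graded P = monom P d"
    by (rule poly_eqI, rule poly_mapping_eqI)
       (use h in \<open>auto simp: lookup_coeff_graded coeff_monom homogeneous_iff in_keys_iff\<close>)
  then show "\<exists>Q. graded P = monom Q d" ..
next
  assume "\<exists>Q. graded P = monom Q d"
  then obtain Q where Q: "graded P = monom Q d" ..
  show "homogeneous d P"
    unfolding homogeneous_iff
  proof
    fix m assume "m \<in> keys P"
    then have "lookup (coeff (graded P) (mdeg m)) m \<noteq> 0"
      by (simp add: lookup_coeff_graded in_keys_iff)
    then show "mdeg m = d" by (auto simp: Q coeff_monom split: if_splits)
  qed
qed

text \<open>The linear order on the variables makes the polynomial ring an integral domain, as
  \<open>monom_factor\<close> requires of its coefficients.\<close>

lemma homogeneous_factor: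
  fixes P Q :: "('n::{finite,linorder}, real) mpoly"
  assumes "homogeneous d (P * Q)" "P * Q \<noteq> 0"
  obtains e where "homogeneous e P"
proof -
  obtain R where R: "graded P * graded Q = monom R d"
    using assms(1) by (auto simp: homogeneous_iff_graded graded_mult)
  have "R \<noteq> 0"
  proof
    assume "R = 0"
    then have "graded (P * Q) = 0" using R by (simp add: graded_mult)
    then have "P * Q = 0"
      using lookup_coeff_graded[of "P * Q"] by (intro poly_mapping_eqI) (metis coeff_0 lookup_zero)
    with assms(2) show False ..
  qed
  then obtain b k where "graded P = monom b k" using monom_factor[OF R] by blast
  with that show ?thesis by (auto simp: homogeneous_iff_graded)
qed

lemma homogeneous_unique:
  assumes "homogeneous d P" "homogeneous e P" "P \<noteq> 0"
  shows "d = e"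
proof -
  obtain m where "m \<in> keys P" using assms(3) by fastforce
  with assms show ?thesis by (auto simp: homogeneous_iff)
qed

lemma homogeneous_0_dvd_1:
  fixes P :: "('n::finite, 'a::field) mpoly"
  assumes "homogeneous 0 P" "P \<noteq> 0"
  shows "P dvd 1"
proof -
  have "lookup P m = lookup (Const (lookup P 0)) m" for m
    using assms(1) mdeg_0E[of m]
    by (cases "m = 0"; cases "m \<in> keys P")
       (auto simp: Const_def lookup_single homogeneous_iff in_keys_iff)
  then have P: "P = Const (lookup P 0)" by (rule poly_mapping_eqI)
  with assms(2) have "lookup P 0 \<noteq> 0" by (metis Const_def single_zero)
  then have "1 = P * Const (1 / lookup P 0)"
    by (subst P) (simp add: Const_def mult_single)
  then show ?thesis by (rule dvdI)
qed

lemma eval_homogeneous_1: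
  fixes P :: "('n::finite, real) mpoly"
  assumes "homogeneous 1 P"
  obtains a where "\<And>x. eval (complexify P) x = (\<Sum>m\<in>keys P. of_real (lookup P m) * x $ a m)"
proof -
  have "\<forall>m\<in>keys P. \<exists>i. m = single i 1"
    using assms mdeg_1E unfolding homogeneous_iff by metis
  then obtain a where a: "\<And>m. m \<in> keys P \<Longrightarrow> m = single (a m) 1" by metis
  have "(\<Prod>i\<in>UNIV. x $ i ^ lookup m i) = x $ a m" if "m \<in> keys P" for m and x :: "complex ^ 'n"
    by (subst a[OF that]) (rule prod_power_single)
  then show ?thesis using that by (simp add: eval_complexify eval_via_def)
qed

lemma eval_homogeneous_2:
  fixes P :: "('n::finite, real) mpoly"
  assumes "homogeneous 2 P"
  obtains a b where "\<And>x. eval (complexify P) x = (\<Sum>m\<in>keys P. of_real (lookup P m) * (x $ a m * x $ b m))"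
proof -
  have "\<forall>m\<in>keys P. \<exists>i j. m = single i 1 + single j 1"
    using assms mdeg_2E unfolding homogeneous_iff by metis
  then obtain a b where a: "\<And>m. m \<in> keys P \<Longrightarrow> m = single (a m) 1 + single (b m) 1" by metis
  have "(\<Prod>i\<in>UNIV. x $ i ^ lookup m i) = x $ a m * x $ b m" if "m \<in> keys P" for m and x :: "complex ^ 'n"
    by (subst a[OF that]) (simp only: prod_power_lookup_add prod_power_single)
  then show ?thesis using that by (simp add: eval_complexify eval_via_def)
qed

lemma quadratic_root:
  fixes a b c :: complex
  assumes "a \<noteq> 0"
  obtains z where "a * z\<^sup>2 + b * z + c = 0"
proof -
  define z where "z = (- b + csqrt (b\<^sup>2 - 4 * a * c)) / (2 * a)"
  have "4 * a * (a * z\<^sup>2 + b * z + c) = (2 * a * z + b)\<^sup>2 - (b\<^sup>2 - 4 * a * c)"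
    by (simp add: power2_eq_square algebra_simps)
  also have "2 * a * z + b = csqrt (b\<^sup>2 - 4 * a * c)" using assms by (simp add: z_def)
  finally have "a * z\<^sup>2 + b * z + c = 0" using assms by simp
  with that show ?thesis by blast
qed

section \<open>A linear factor produces infinitely many singular points\<close>

context finitely_singular_cubic
begin

text \<open>The hyperplane l = 0 is a projective 3-space and contains infinitely many pairwise
  disjoint lines. Each of them meets the quadric, and the intersection points are singular and
  distinct.\<close>

lemma not_linear_times_quadric:
  fixes P Q :: "(5, real) mpoly"
  assumes P: "homogeneous 1 P" "P \<noteq> 0" and Q: "homogeneous 2 Q"
    and B: "\<And>x::complex^5. B x x x = eval (complexify P) x * eval (complexify Q) x"
  shows False
proof -
  define l where "l x = eval (complexify P) x" for x
  define q where "q x = eval (complexify Q) x" for x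
  obtain a where a: "\<And>x. l x = (\<Sum>m\<in>keys P. of_real (lookup P m) * x $ a m)"
    using eval_homogeneous_1[OF P(1)] unfolding l_def by blast
  have l_add: "l (x + y) = l x + l y" and l_scale: "l (r *s x) = r * l x" for x y r
    by (simp_all add: a algebra_simps sum.distrib sum_distrib_left)
  obtain b d where bd: "\<And>x. q x = (\<Sum>m\<in>keys Q. of_real (lookup Q m) * (x $ b m * x $ d m))"
    using eval_homogeneous_2[OF Q] unfolding q_def by blast
  define q1 where "q1 x y = (\<Sum>m\<in>keys Q. of_real (lookup Q m) * (x $ b m * y $ d m + y $ b m * x $ d m))"
    for x y :: "complex ^ 5"
  have q_add: "q (x + t *s y) = q x + t * q1 x y + t\<^sup>2 * q y" for x y t
    by (simp add: bd q1_def algebra_simps sum.distrib sum_distrib_left power2_eq_square)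
  have singI: "sing x" if "x \<noteq> 0" "l x = 0" "q x = 0" for x
    unfolding sing_def
  proof (intro conjI allI)
    fix v
    \<comment> \<open>Both factors vanish at \<open>x\<close>, so their product has order at least
      two in \<open>t\<close>.\<close>
    have "B (x + t *s v) (x + t *s v) (x + t *s v) = t\<^sup>2 * (l v * (q1 x v + t * q v))" for t
      using that by (simp add: B l_add l_scale q_add power2_eq_square algebra_simps flip: l_def q_def)
    then have "((\<lambda>t. B (x + t *s v) (x + t *s v) (x + t *s v)) has_field_derivative 0) (at 0)"
      by (auto intro!: derivative_eq_intros)
    from DERIV_unique[OF this has_field_derivative_B_cube] show "B x x v = 0" by simp
  qed fact
  obtain j where j: "l (axis j 1) \<noteq> 0"
  proof (rule ccontr)
    assume "\<not> thesis"
    with that have zero: "l (axis j 1) = 0" for j by blast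
    have sum0: "l (\<Sum>i\<in>S. x $ i *s axis i 1) = 0" for x :: "complex ^ 5" and S
      by (induction S rule: infinite_finite_induct) (simp_all add: l_add l_scale zero, simp_all add: a)
    have "l x = 0" for x using sum0[of x UNIV] by (simp add: basis_expansion)
    then have "eval P x = 0" for x using eval_complexify_of_real[of P x] by (simp add: l_def)
    with P(2) eval_eq_0_iff show False by blast
  qed
  \<comment> \<open>Indices are taken modulo 5, so \<open>j + 1\<close>, ..., \<open>j + 4\<close>
    are the indices other than \<open>j\<close>. The vectors \<open>u 1\<close>, ...,
    \<open>u 4\<close> form a basis of the kernel of \<open>l\<close>.\<close>
  define u where "u k = axis (j + k) 1 - (l (axis (j + k) 1) / l (axis j 1)) *s axis j 1" for k
  have l_u: "l (u k) = 0" for k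
    using l_add[of "u k" "(l (axis (j + k) 1) / l (axis j 1)) *s axis j 1"] j by (simp add: u_def l_scale)
  have nth: "u 1 $ (j + k) = (if k = 1 then 1 else 0)" "u 2 $ (j + k) = (if k = 2 then 1 else 0)"
    "u 3 $ (j + k) = (if k = 3 then 1 else 0)" "u 4 $ (j + k) = (if k = 4 then 1 else 0)" if "k \<noteq> 0" for k
    using that by (auto simp: u_def axis_def)
  \<comment> \<open>The lines through \<open>v s\<close> and \<open>w s\<close> are disjoint for
    different \<open>s\<close>: the coordinates \<open>j + 3\<close>, \<open>j + 4\<close> of a
    point on one are \<open>s\<close> times its coordinates \<open>j + 1\<close>,
    \<open>j + 2\<close>, so \<open>s\<close> can be read off.\<close>
  define v where "v s = u 1 + s *s u 3" for s
  define w where "w s = u 2 + s *s u 4" for s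
  have nth_vw: "(\<alpha> *s v s + \<beta> *s w s) $ (j + 1) = \<alpha>" "(\<alpha> *s v s + \<beta> *s w s) $ (j + 2) = \<beta>"
    "(\<alpha> *s v s + \<beta> *s w s) $ (j + 3) = \<alpha> * s" "(\<alpha> *s v s + \<beta> *s w s) $ (j + 4) = \<beta> * s" for \<alpha> \<beta> s
    by (simp_all add: v_def w_def nth)
  have l_vw: "l (\<alpha> *s v s + \<beta> *s w s) = 0" for \<alpha> \<beta> s
    by (simp add: v_def w_def l_add l_scale l_u)
  have "\<exists>\<alpha> \<beta>. (\<alpha>, \<beta>) \<noteq> (0, 0) \<and> q (\<alpha> *s v s + \<beta> *s w s) = 0" for s
  proof (cases "q (w s) = 0")
    case True then show ?thesis by (intro exI[of _ 0] exI[of _ 1]) simp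
  next
    case False
    then obtain z where "q (w s) * z\<^sup>2 + q1 (v s) (w s) * z + q (v s) = 0" using quadratic_root by blast
    then show ?thesis
      using q_add[of "v s" z "w s"] by (intro exI[of _ 1] exI[of _ z]) (simp add: algebra_simps)
  qed
  then obtain \<alpha> \<beta> where ab: "\<And>s. (\<alpha> s, \<beta> s) \<noteq> (0, 0)" "\<And>s. q (\<alpha> s *s v s + \<beta> s *s w s) = 0" by metis
  define x where "x s = \<alpha> s *s v s + \<beta> s *s w s" for s
  have x_nth: "x s $ (j + 1) = \<alpha> s" "x s $ (j + 2) = \<beta> s" "x s $ (j + 3) = \<alpha> s * s" "x s $ (j + 4) = \<beta> s * s" for s
    unfolding x_def by (rule nth_vw)+
  have "sing (x s)" for s
  proof (rule singI)
    show "x s \<noteq> 0" using ab(1)[of s] x_nth(1,2)[of s] by auto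
  qed (simp_all add: x_def l_vw ab)
  then obtain s s' k where s: "s \<noteq> s'" "k \<noteq> 0" "x s = k *s x s'"
    using sing_familyE[OF infinite_UNIV_char_0, of x] by metis
  have "\<alpha> s = k * \<alpha> s'" "\<beta> s = k * \<beta> s'" "\<alpha> s * s = k * (\<alpha> s' * s')" "\<beta> s * s = k * (\<beta> s' * s')"
    using x_nth[of s] x_nth[of s'] s(3) by auto
  then have "\<alpha> s * s = \<alpha> s * s'" "\<beta> s * s = \<beta> s * s'"
    by (metis mult.assoc)+
  with s(1) ab(1)[of s] show False by auto
qed

end

lemma irreducible_cubic:
  fixes F :: "(5, real) mpoly"
  assumes "finitely_singular_cubic c" "homogeneous 3 F" "F \<noteq> 0"
    and B: "\<And>x. eval (complexify F) x = tri c x x x"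
  shows "irreducible F"
proof (rule irreducibleI)
  interpret finitely_singular_cubic c by fact
  show "\<not> F dvd 1"
  proof
    assume "F dvd 1"
    then obtain G where "1 = F * G" by (rule dvdE)
    then have "eval F 0 * eval G 0 = 1" by (metis eval_1 eval_mult)
    moreover have "eval F 0 = 0"
      using form_scale[of 3 "eval F" 0 0] assms(2) unfolding form_def by auto
    ultimately show False by simp
  qed
  fix P Q assume F: "F = P * Q"
  have nz: "P \<noteq> 0" "Q \<noteq> 0" using F \<open>F \<noteq> 0\<close> by auto
  obtain d where d: "homogeneous d P" using homogeneous_factor[of 3 P Q] assms F by metis
  obtain e where e: "homogeneous e Q" using homogeneous_factor[of 3 Q P] assms F by (metis mult.commute)
  have "d + e = 3"
    using homogeneous_unique[OF homogeneous_mult[OF d e]] assms F by metis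
  then consider "d = 0" | "e = 0" | "d = 1" "e = 2" | "d = 2" "e = 1" by linarith
  then show "P dvd 1 \<or> Q dvd 1"
  proof cases
    case 1 then show ?thesis using homogeneous_0_dvd_1 d nz by blast
  next
    case 2 then show ?thesis using homogeneous_0_dvd_1 e nz by blast
  next
    case 3
    then have False
      using not_linear_times_quadric[of P Q] d e nz B by (simp add: F eval_complexify_mult)
    then show ?thesis ..
  next
    case 4
    then have False
      using not_linear_times_quadric[of Q P] d e nz B by (simp add: F eval_complexify_mult mult.commute)
    then show ?thesis ..
  qed
qed fact

section \<open>The Hessian at a singular point of type A\<close>

text \<open>\<open>A_equation n (t *s y) = t\<^sup>2 * A_quad n t y\<close>, so \<open>A_quad n 0\<close> is the quadratic part of the equation.\<close>

definition A_quad :: "nat \<Rightarrow> complex \<Rightarrow> complex ^ 4 \<Rightarrow> complex"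
  where "A_quad n t y = (y $ 0)\<^sup>2 + (y $ 1)\<^sup>2 + (y $ 2)\<^sup>2 + t ^ (n - 1) * (y $ 3) ^ (n + 1)"

lemma has_derivative_vecI:
  fixes f :: "'b::euclidean_space \<Rightarrow> 'a::euclidean_space ^ 'n::finite"
  assumes "\<And>i. ((\<lambda>x. f x $ i) has_derivative (\<lambda>h. D h $ i)) (at x)"
  shows "(f has_derivative D) (at x)"
  unfolding has_derivative_componentwise_within[of f]
proof
  fix b :: "'a ^ 'n" assume "b \<in> Basis"
  then obtain i u where b: "b = axis i u" unfolding Basis_vec_def by blast
  have "((\<lambda>x. f x $ i \<bullet> u) has_derivative (\<lambda>h. D h $ i \<bullet> u)) (at x)"
    by (rule has_derivative_inner_left[OF assms])
  then show "((\<lambda>x. f x \<bullet> b) has_derivative (\<lambda>h. D h \<bullet> b)) (at x)"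
    by (simp add: b inner_axis)
qed

lemma has_derivative_scaled_vector:
  fixes a v :: "complex ^ 'n::finite"
  shows "((\<lambda>t. a + t *s v) has_derivative (\<lambda>t. t *s v)) (at t0)"
proof -
  have "linear (\<lambda>t. t *s v)"
    by (rule linearI) (simp_all add: vec_eq_iff algebra_simps)
  then have "bounded_linear (\<lambda>t. t *s v)" by (rule linear_conv_bounded_linear[THEN iffD1])
  then have "((\<lambda>t. t *s v) has_derivative (\<lambda>t. t *s v)) (at t0)" by (rule bounded_linear_imp_has_derivative)
  then show ?thesis by (auto intro!: derivative_eq_intros)
qed

lemma tendsto_tri:
  fixes f g h :: "'b \<Rightarrow> complex ^ 5"
  assumes "(f \<longlongrightarrow> x) A" "(g \<longlongrightarrow> y) A" "(h \<longlongrightarrow> z) A"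
  shows "((\<lambda>t. tri c (f t) (g t) (h t)) \<longlongrightarrow> tri c x y z) A"
  unfolding tri_def using assms by (auto intro!: tendsto_intros)

context real_cubic
begin

text \<open>\<open>L\<close> and \<open>M\<close> are the derivatives of the chart and of its
  inverse, so \<open>L\<close> identifies \<complex>^4 with the directions of the affine chart. As
  \<open>x0\<close> is singular, the cubic at x0 + t h starts with 3 t^2 B x0 h h; comparison with
  the local equation gives the quadratic part, and no second derivative of the chart is
  involved.\<close>

lemma A_point_chart:
  assumes A: "A_point n P (proj_point p)" and P: "\<And>x. eval P x = B x x x" and p: "sing p" and n: "n \<ge> 1"
  obtains x0 r i a and L :: "complex ^ 4 \<Rightarrow> complex ^ 5" and M where "x0 = r *s p" "r \<noteq> 0" "x0 $ i = 1" "a \<noteq> 0"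
    "\<And>y z. L (y + z) = L y + L z" "\<And>b y. L (b *s y) = b *s L y"
    "\<And>y. L y $ i = 0" "\<And>h. h $ i = 0 \<Longrightarrow> L (M h) = h" "\<And>y. M (L y) = y"
    "\<And>y. B x0 (L y) (L y) = a * A_quad n 0 y"
proof -
  obtain i U V \<phi> \<psi> u where U: "open U" "0 \<in> U" and V: "open V"
    and holo: "holo_map_on U \<phi>" "holo_map_on V \<psi>"
    and \<phi>: "\<And>y. y \<in> U \<Longrightarrow> \<phi> y \<in> V" "\<And>y. y \<in> U \<Longrightarrow> \<phi> y $ i = 1" "\<And>y. y \<in> U \<Longrightarrow> \<psi> (\<phi> y) = y"
    and \<psi>: "\<And>x. x \<in> V \<Longrightarrow> x $ i = 1 \<Longrightarrow> \<psi> x \<in> U" "\<And>x. x \<in> V \<Longrightarrow> x $ i = 1 \<Longrightarrow> \<phi> (\<psi> x) = x"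
    and \<phi>0: "\<phi> 0 \<in> proj_point p" and u: "holo_on U u" "\<And>y. y \<in> U \<Longrightarrow> u y \<noteq> 0"
    and eq: "\<And>y. y \<in> U \<Longrightarrow> eval P (\<phi> y) = u y * A_equation n y"
    using A unfolding A_point_def by blast
  define x0 where "x0 = \<phi> 0"
  obtain r where r: "x0 = r *s p" "r \<noteq> 0" using \<phi>0 unfolding x0_def proj_point_def by blast
  have x0: "x0 \<in> V" "x0 $ i = 1" "\<psi> x0 = 0" using \<phi> U by (auto simp: x0_def)
  have sing0: "B x0 x0 v = 0" for v using p by (simp add: r sing_def B_linear)
  have "\<forall>j. \<exists>D. ((\<lambda>y. \<phi> y $ j) has_derivative D) (at 0) \<and> (\<forall>b v. D (b *s v) = b * D v)"
    using holo(1) U(2) unfolding holo_map_on_def holo_on_def by blast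
  then obtain D where D: "\<And>j. ((\<lambda>y. \<phi> y $ j) has_derivative D j) (at 0)" "\<And>j b v. D j (b *s v) = b * D j v"
    by metis
  define L where "L y = (\<chi> j. D j y)" for y
  have L_scale: "L (b *s y) = b *s L y" for b y by (simp add: L_def D vec_eq_iff)
  have L_add: "L (y + z) = L y + L z" for y z
    using D(1)[THEN has_derivative_linear] by (simp add: L_def vec_eq_iff linear_add)
  have \<phi>_der: "(\<phi> has_derivative L) (at 0)"
    by (rule has_derivative_vecI) (simp add: L_def D)
  have "\<forall>j. \<exists>E. ((\<lambda>x. \<psi> x $ j) has_derivative E) (at x0)"
    using holo(2) x0(1) unfolding holo_map_on_def holo_on_def by blast
  then obtain E where E: "\<And>j. ((\<lambda>x. \<psi> x $ j) has_derivative E j) (at x0)" by metis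
  define M where "M h = (\<chi> j. E j h)" for h
  have \<psi>_der: "(\<psi> has_derivative M) (at x0)"
    by (rule has_derivative_vecI) (simp add: M_def E)
  have der_line: "((\<lambda>t. \<phi> (t *s y)) has_derivative (\<lambda>t. t *s L y)) (at 0)" for y
  proof -
    have "((\<lambda>t. t *s y) has_derivative (\<lambda>t. t *s y)) (at 0)"
      using has_derivative_scaled_vector[of 0 y 0] by simp
    from has_derivative_compose[OF this, of \<phi> L] \<phi>_der show ?thesis by (simp add: L_scale)
  qed
  have ev_U: "eventually (\<lambda>t. t *s y \<in> U) (at 0)" for y
  proof -
    have "isCont (\<lambda>t. 0 + t *s y) 0"
      by (rule has_derivative_continuous[OF has_derivative_scaled_vector])
    then have "((\<lambda>t. t *s y) \<longlongrightarrow> 0) (at 0)" by (simp add: isCont_def)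
    from topological_tendstoD[OF this U] show ?thesis .
  qed
  have component_der: "((\<lambda>t. \<phi> (t *s y) $ j) has_field_derivative L y $ j) (at 0)" for y j
    using bounded_linear.has_derivative[OF bounded_linear_vec_nth der_line]
    by (simp add: has_field_derivative_def mult_commute_abs)
  have Li: "L y $ i = 0" for y
  proof -
    have "((\<lambda>t. \<phi> (t *s y) $ i) has_field_derivative 0) (at 0)"
    proof (rule DERIV_cong_ev[THEN iffD2])
      show "eventually (\<lambda>t. \<phi> (t *s y) $ i = 1) (nhds 0)"
        using ev_U[of y] by (simp add: eventually_nhds_conv_at U \<phi> eventually_mono)
    qed (auto intro: derivative_eq_intros)
    with component_der show ?thesis by (rule DERIV_unique)
  qed
  have LM: "L (M h) = h" if h: "h $ i = 0" for h
  proof -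
    have line: "((\<lambda>t. x0 + t *s h) has_derivative (\<lambda>t. t *s h)) (at 0)"
      by (rule has_derivative_scaled_vector)
    have "((\<lambda>t. \<psi> (x0 + t *s h)) has_derivative (\<lambda>t. M (t *s h))) (at 0)"
      using has_derivative_compose[OF line, of \<psi> M] \<psi>_der by simp
    then have der: "((\<lambda>t. \<phi> (\<psi> (x0 + t *s h))) has_derivative (\<lambda>t. L (M (t *s h)))) (at 0)"
      using has_derivative_compose[of "\<lambda>t. \<psi> (x0 + t *s h)" _ 0 UNIV \<phi> L] \<phi>_der x0(3) by simp
    have "((\<lambda>t. x0 + t *s h) \<longlongrightarrow> x0) (at 0)"
      using has_derivative_continuous[OF line] by (simp add: isCont_def)
    from topological_tendstoD[OF this V x0(1)]
    have "eventually (\<lambda>t. x0 + t *s h \<in> V) (nhds 0)" using x0(1) by (simp add: eventually_nhds_conv_at)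
    then have "eventually (\<lambda>t. \<phi> (\<psi> (x0 + t *s h)) = x0 + t *s h) (nhds 0)"
      by (rule eventually_mono) (use \<psi>(2) x0(2) h in auto)
    then obtain T where T: "open T" "0 \<in> T" "\<And>t. t \<in> T \<Longrightarrow> \<phi> (\<psi> (x0 + t *s h)) = x0 + t *s h"
      unfolding eventually_nhds by blast
    have "((\<lambda>t. x0 + t *s h) has_derivative (\<lambda>t. L (M (t *s h)))) (at 0)"
      by (rule has_derivative_transform_within_open[OF der T(1,2)]) (use T(3) in auto)
    from has_derivative_unique[OF this line] have "L (M (1 *s h)) = 1 *s h" by meson
    then show ?thesis by simp
  qed
  have ret: "M (L y) = y" for y
  proof -
    have der: "((\<lambda>t. \<psi> (\<phi> (t *s y))) has_derivative (\<lambda>t. M (t *s L y))) (at 0)"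
      using has_derivative_compose[OF der_line, of \<psi> M] \<psi>_der by (simp add: x0_def)
    have "eventually (\<lambda>t. t *s y \<in> U) (nhds 0)"
      using ev_U[of y] U(2) by (simp add: eventually_nhds_conv_at)
    then obtain T where T: "open T" "0 \<in> T" "\<And>t. t \<in> T \<Longrightarrow> t *s y \<in> U"
      unfolding eventually_nhds by blast
    have "((\<lambda>t. 0 + t *s y) has_derivative (\<lambda>t. M (t *s L y))) (at 0)"
      by (rule has_derivative_transform_within_open[OF der T(1,2)]) (use T(3) \<phi>(3) in auto)
    from has_derivative_unique[OF this has_derivative_scaled_vector] have "M (1 *s L y) = 1 *s y" by meson
    then show ?thesis by simp
  qed
  have hess: "3 * B x0 (L y) (L y) =
      u 0 * A_quad n 0 y" for y
  proof -
    \<comment> \<open>The difference quotient of the chart along \<open>y\<close>, with limit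
      \<open>L y\<close>. The local equation is divided by t^2 before passing to the limit.\<close>
    define h where "h t = (\<chi> j. (\<phi> (t *s y) $ j - x0 $ j) / t)" for t
    have h_lim: "(h \<longlongrightarrow> L y) (at 0)"
      unfolding h_def
    proof (rule tendsto_vec_lambda[THEN tendsto_eq_rhs])
      fix j
      show "((\<lambda>t. (\<phi> (t *s y) $ j - x0 $ j) / t) \<longlongrightarrow> L y $ j) (at 0)"
        using component_der[of y j] by (simp add: has_field_derivative_iff x0_def)
    qed simp
    have \<phi>_h: "\<phi> (t *s y) = x0 + t *s h t" if "t \<noteq> 0" for t
      using that by (simp add: vec_eq_iff h_def)
    have "u differentiable at 0" using u(1) U(2) unfolding holo_on_def differentiable_def by blast
    then have "isCont u 0" by (rule differentiable_imp_continuous_within)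
    moreover have "((\<lambda>t. t *s y) \<longlongrightarrow> 0) (at 0)"
      using has_derivative_continuous[OF has_derivative_scaled_vector[of 0 y 0]] by (simp add: isCont_def)
    ultimately have u_lim: "((\<lambda>t. u (t *s y)) \<longlongrightarrow> u 0) (at 0)" by (rule isCont_tendsto_compose)
    have "((\<lambda>t. u (t *s y) * A_quad n t y) \<longlongrightarrow>
        u 0 * A_quad n 0 y) (at 0)"
      unfolding A_quad_def by (intro tendsto_intros u_lim)
    moreover have "eventually (\<lambda>t. u (t *s y) * A_quad n t y =
        3 * B x0 (h t) (h t) + t * B (h t) (h t) (h t)) (at 0)"
    proof -
      have "eventually (\<lambda>t. t *s y \<in> U \<and> t \<noteq> 0) (at 0)"
        using ev_U[of y] eventually_neq_at_within[of 0 0] by (rule eventually_conj)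
      then show ?thesis
      proof (rule eventually_mono)
        fix t :: complex assume t: "t *s y \<in> U \<and> t \<noteq> 0"
        have "B (\<phi> (t *s y)) (\<phi> (t *s y)) (\<phi> (t *s y)) = t\<^sup>2 * (3 * B x0 (h t) (h t) + t * B (h t) (h t) (h t))"
          unfolding \<phi>_h[OF t[THEN conjunct2]]
          using sing0[of "h t"] sing0[of x0] B_commute23[of x0 "h t" x0] B_left_commute[of "h t" x0 x0]
            B_left_commute[of "h t" x0 "h t"] B_left_commute[of "h t" "h t" x0]
          by (simp add: B_linear algebra_simps power2_eq_square)
        moreover have "A_equation n (t *s y) =
            t\<^sup>2 * A_quad n t y"
        proof -
          have "t ^ (n + 1) = t\<^sup>2 * t ^ (n - 1)" using n by (simp flip: power_add)
          then show ?thesis by (simp add: A_equation_def A_quad_def power_mult_distrib algebra_simps)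
        qed
        ultimately have "t\<^sup>2 * (3 * B x0 (h t) (h t) + t * B (h t) (h t) (h t)) =
            t\<^sup>2 * (u (t *s y) * A_quad n t y)"
          using eq[of "t *s y"] t by (simp add: P mult_ac)
        then show "u (t *s y) * A_quad n t y =
            3 * B x0 (h t) (h t) + t * B (h t) (h t) (h t)" using t by simp
      qed
    qed
    ultimately have "((\<lambda>t. 3 * B x0 (h t) (h t) + t * B (h t) (h t) (h t)) \<longlongrightarrow>
        u 0 * A_quad n 0 y) (at 0)"
      by (rule Lim_transform_eventually)
    moreover have "((\<lambda>t. 3 * B x0 (h t) (h t) + t * B (h t) (h t) (h t)) \<longlongrightarrow>
        3 * B x0 (L y) (L y) + 0 * B (L y) (L y) (L y)) (at 0)"
      by (intro tendsto_intros tendsto_tri h_lim)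
    ultimately show ?thesis using tendsto_unique[of "at (0::complex)"] by fastforce
  qed
  show ?thesis
  proof (rule that[of x0 r i "u 0 / 3" L M])
    show "B x0 (L y) (L y) = u 0 / 3 * A_quad n 0 y" for y
      using hess[of y] by (simp add: field_simps)
    show "u 0 / 3 \<noteq> 0" using u(2) U(2) by simp
  qed (use r x0 L_add L_scale Li LM ret in auto)
qed

text \<open>For n >= 2 the last coordinate does not occur in the quadratic part, so its image
  \<open>k\<close> under the derivative of the chart is a kernel vector. It is no multiple of
  \<open>p\<close> because it is tangent to the chart, where \<open>p\<close> has no
  direction.\<close>

lemma A_point_degenerate:
  assumes "A_point n P (proj_point p)" "\<And>x. eval P x = B x x x" "sing p" "n \<ge> 2"
  obtains k where "\<And>a. k \<noteq> a *s p" "\<And>v. B p k v = 0"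
proof -
  obtain x0 r i a and L :: "complex ^ 4 \<Rightarrow> complex ^ 5" and M where x0: "x0 = r *s p" "r \<noteq> 0" "x0 $ i = 1" and a: "a \<noteq> 0"
    and L: "\<And>y z. L (y + z) = L y + L z" "\<And>b y. L (b *s y) = b *s L y"
      "\<And>y. L y $ i = 0" "\<And>h. h $ i = 0 \<Longrightarrow> L (M h) = h" "\<And>y. M (L y) = y"
    and hess: "\<And>y. B x0 (L y) (L y) = a * A_quad n 0 y"
    by (rule A_point_chart[OF assms(1-3) order_trans[OF one_le_numeral assms(4)]]) (rule that)
  define k where "k = L (axis 3 1)"
  have "B x0 (L y) (L y) = a * ((y $ 0)\<^sup>2 + (y $ 1)\<^sup>2 + (y $ 2)\<^sup>2)" for y
    using hess[of y] assms(4) by (simp add: A_quad_def)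
  note hess' = this
  have kL: "B x0 k (L y) = 0" for y
  proof -
    have "B x0 (L (axis 3 1 + y)) (L (axis 3 1 + y)) = B x0 k k + 2 * B x0 k (L y) + B x0 (L y) (L y)"
      using B_commute23[of x0 k "L y"] by (simp add: L(1) k_def B_linear)
    moreover have "B x0 (L (axis 3 1 + y)) (L (axis 3 1 + y)) = B x0 (L y) (L y)"
      unfolding hess' by (simp add: axis_def)
    moreover have "B x0 k k = 0" unfolding k_def hess' by (simp add: axis_def)
    ultimately show ?thesis by simp
  qed
  have "B x0 k v = 0" for v
  proof -
    \<comment> \<open>The chart directions and \<open>x0\<close> together span the whole space, and
      \<open>x0\<close> is orthogonal to \<open>k\<close> because it is singular.\<close>
    define h where "h = v - (v $ i) *s x0"
    have "B x0 k h = 0" using kL[of "M h"] L(4)[of h] x0(3) by (simp add: h_def)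
    moreover have "B x0 k x0 = 0" using assms(3) B_commute23[of x0 k x0] by (simp add: sing_def x0 B_linear)
    ultimately show ?thesis by (simp add: h_def B_linear)
  qed
  then have "B p k v = 0" for v using x0 by (simp add: B_linear)
  moreover have "k \<noteq> b *s p" for b
  proof
    assume "k = b *s p"
    then have "k = (b / r) *s x0" using x0 by (simp add: vec_eq_iff)
    then have "b / r = 0" using L(3)[of "axis 3 1"] x0(3) by (simp add: k_def)
    with \<open>k = (b / r) *s x0\<close> have "L (axis 3 1) = L 0" using L(2)[of 0 0] by (simp add: k_def)
    then have "(axis 3 1 :: complex ^ 4) = 0" by (metis L(5))
    then show False by (simp add: axis_eq_0_iff)
  qed
  ultimately show ?thesis using that by blast
qed

text \<open>For n = 1 the quadratic part is a nondegenerate form in four variables. A kernel vector,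
  moved into the chart directions by a multiple of \<open>x0\<close>, must therefore vanish.\<close>

lemma A_point_nondegenerate:
  assumes "A_point 1 P (proj_point p)" "\<And>x. eval P x = B x x x" "sing p" "\<And>v. B p k v = 0"
  obtains a where "k = a *s p"
proof -
  obtain x0 r i a and L :: "complex ^ 4 \<Rightarrow> complex ^ 5" and M where x0: "x0 = r *s p" "r \<noteq> 0" "x0 $ i = 1" and a: "a \<noteq> 0"
    and L: "\<And>y z. L (y + z) = L y + L z" "\<And>b y. L (b *s y) = b *s L y"
      "\<And>y. L y $ i = 0" "\<And>h. h $ i = 0 \<Longrightarrow> L (M h) = h" "\<And>y. M (L y) = y"
    and hess: "\<And>y. B x0 (L y) (L y) = a * A_quad 1 0 y"
    by (rule A_point_chart[OF assms(1-3) order_refl]) (rule that)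
  define q where "q y = (y $ 0)\<^sup>2 + (y $ 1)\<^sup>2 + (y $ 2)\<^sup>2 + (y $ 3)\<^sup>2" for y :: "complex ^ 4"
  have hess': "B x0 (L y) (L y) = a * q y" for y using hess[of y] by (simp add: q_def A_quad_def power2_eq_square)
  define h where "h = k - (k $ i) *s x0"
  define y where "y = M h"
  have h: "L y = h" using L(4)[of h] x0(3) by (simp add: h_def y_def)
  have Bh: "B x0 h v = 0" for v
    using assms(3,4) by (simp add: h_def x0 B_linear sing_def)
  \<comment> \<open>Adding the kernel vector \<open>y\<close> to a coordinate vector does not change
    the form; the difference is \<open>2 * y $ j\<close>.\<close>
  have "y $ j = 0" for j
  proof -
    have "B x0 (L (y + axis j 1)) (L (y + axis j 1)) = B x0 (L (axis j 1)) (L (axis j 1))"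
      using Bh[of "L (axis j 1)"] Bh[of h] B_commute23[of x0 h "L (axis j 1)"] by (simp add: L(1) h B_linear)
    then have "q (y + axis j 1) = q (axis j 1)" using a by (simp add: hess')
    moreover have "B x0 (L y) (L y) = 0" using Bh by (simp add: h)
    then have "q y = 0" using a by (simp add: hess')
    moreover have "q (y + axis j 1) = q y + q (axis j 1) + 2 * y $ j"
      using exhaust_4[of j] by (auto simp: q_def axis_def power2_eq_square algebra_simps)
    ultimately show ?thesis by simp
  qed
  then have "y = 0" by (simp add: vec_eq_iff)
  then have "h = 0" using L(2)[of 0 y] h by simp
  then have "k = (k $ i * r) *s p" by (simp add: h_def x0 vector_smult_assoc)
  with that show ?thesis by blast
qed

end

section \<open>Two birational parametrizations\<close>

lemma exhaust_5: "i = 0 \<or> i = 1 \<or> i = 2 \<or> i = 3 \<or> i = 4" for i :: 5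
proof (cases i)
  case (of_int z)
  then have "z = 0 \<or> z = 1 \<or> z = 2 \<or> z = 3 \<or> z = 4" by auto
  with of_int show ?thesis by auto
qed

lemma form_if: "form d f \<Longrightarrow> form d g \<Longrightarrow> form d (\<lambda>x. if b then f x else g x)"
  by (cases b) simp_all

lemma form_tri:
  assumes "\<And>i. form d (\<lambda>x. f x $ i)" "\<And>i. form e (\<lambda>x. g x $ i)" "\<And>i. form k (\<lambda>x. h x $ i)" "d + e + k = n"
  shows "form n (\<lambda>x. tri c (f x) (g x) (h x))"
  unfolding tri_def using assms by (auto intro!: form_sum form_mult form_cmult)

section \<open>Projection from a real node\<close>

text \<open>At s x0 + z the cubic takes the value s Q(z) + f(z), as the higher powers of s vanish at
  a node. The residual point s = - f(z) / Q(z) inverts the projection, and the vector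
  \<open>v\<close> shows that \<open>Q\<close> is not identically zero.\<close>

lemma birational_node:
  fixes f :: "real ^ 5 \<Rightarrow> real" and p v :: "real ^ 5"
  assumes "real_cubic c" and f: "\<And>x. f x = tri c x x x"
    and p: "p \<noteq> 0" "\<And>v. tri c p p v = 0" and q: "tri c p v v \<noteq> 0"
  shows "birational_forms f"
proof -
  interpret real_cubic c by fact
  obtain j where j: "p $ j \<noteq> 0" using p(1) by (auto simp: vec_eq_iff)
  define x0 where "x0 = (1 / p $ j) *s p"
  have x0: "x0 $ j = 1" "B x0 x0 v = 0" for v using j p(2) by (simp_all add: x0_def B_linear)
  have x0': "B x0 v x0 = 0" "B v x0 x0 = 0" for v
    using x0(2)[of v] B_commute23[of x0 v x0] B_left_commute[of v x0 x0] by simp_all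
  have qv: "B x0 v v \<noteq> 0" using q j by (simp add: x0_def B_linear)
  define \<pi> where "\<pi> x = x - x $ j *s x0" for x :: "real ^ 5"
  \<comment> \<open>\<open>\<sigma>\<close> numbers the coordinates other than \<open>j\<close>, and
    \<open>\<eta>\<close> embeds \<real>^4 as the hyperplane on which coordinate \<open>j\<close> is
    0.\<close>
  define \<sigma> :: "4 \<Rightarrow> 5" where "\<sigma> i = (if i = 1 then j + 1 else if i = 2 then j + 2 else if i = 3 then j + 3 else j + 4)" for i
  define \<eta> :: "real ^ 4 \<Rightarrow> real ^ 5" where
    "\<eta> y = (\<chi> k. if k = j + 1 then y $ 1 else if k = j + 2 then y $ 2 else if k = j + 3 then y $ 3
      else if k = j + 4 then y $ 4 else 0)" for y
  have \<eta>_\<sigma>: "\<eta> y $ \<sigma> i = y $ i" for y i using exhaust_4[of i] by (auto simp: \<eta>_def \<sigma>_def)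
  have \<eta>_j: "\<eta> y $ j = 0" for y by (simp add: \<eta>_def)
  have \<eta>_\<pi>: "\<eta> (\<chi> i. \<pi> x $ \<sigma> i) = \<pi> x" for x
  proof -
    have cover: "k = j \<or> k = j + 1 \<or> k = j + 2 \<or> k = j + 3 \<or> k = j + 4" for k :: 5
    proof -
      have "k = j + (k - j)" by simp
      then show ?thesis using exhaust_5[of "k - j"] by (metis add_0_right)
    qed
    have "\<pi> x $ j = 0" by (simp add: \<pi>_def x0)
    then have "\<eta> (\<chi> i. \<pi> x $ \<sigma> i) $ k = \<pi> x $ k" for k
      using cover[of k] by (elim disjE) (simp_all add: \<eta>_def \<sigma>_def)
    then show ?thesis by (simp add: vec_eq_iff)
  qed
  have \<eta>_scale: "\<eta> (b *s y) = b *s \<eta> y" for b y by (simp add: vec_eq_iff \<eta>_def)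
  define Q where "Q z = 3 * B x0 z z" for z
  have f_add: "f (s *s x0 + r *s z) = s * r\<^sup>2 * Q z + r ^ 3 * f z" for s r z
    using B_left_commute[of z x0 z] B_left_commute[of z z x0]
    by (simp add: f Q_def B_linear x0 x0' power2_eq_square power3_eq_cube algebra_simps)
  define g where "g x = (\<chi> i. \<pi> x $ \<sigma> i)" for x
  define h where "h y = Q (\<eta> y) *s \<eta> y - f (\<eta> y) *s x0" for y
  have form_\<pi>: "form 1 (\<lambda>x. \<pi> x $ i)" for i
    unfolding \<pi>_def vector_minus_component vector_smult_component
    by (rule form_diff[OF form_coord form_mult[OF form_coord form_const]]) simp
  have form_\<eta>: "form 1 (\<lambda>y. \<eta> y $ i)" for i
  proof -
    have "form 1 (\<lambda>y :: real ^ 4. if i = j + 1 then y $ 1 else if i = j + 2 then y $ 2 else if i = j + 3 then y $ 3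
        else if i = j + 4 then y $ 4 else 0 :: real)"
      for i
      by (intro form_if form_coord form_zero)
    then show ?thesis by (simp add: \<eta>_def)
  qed
  have const: "form 0 (\<lambda>x. x0 $ i)" for i by (rule form_const)
  have \<pi>v': "B x0 (\<pi> v) (\<pi> v) \<noteq> 0"
    using qv by (simp add: \<pi>_def B_linear x0 x0')
  then have \<pi>v: "\<pi> v \<noteq> 0" by (auto simp: B_zero)
  show ?thesis
    unfolding birational_forms_def
  proof (intro exI conjI allI)
    show "(0::nat) < 1" by simp
    show "form 1 (\<lambda>x. g x $ i)" for i unfolding g_def using form_\<pi> by simp
    show "form 3 (\<lambda>y. h y $ i)" for i
    proof -
      have "form 2 (\<lambda>y. Q (\<eta> y))" unfolding Q_def
        by (rule form_cmult) (rule form_tri[OF const form_\<eta> form_\<eta>], simp)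
      moreover have "form 3 (\<lambda>y. f (\<eta> y))" unfolding f by (rule form_tri[OF form_\<eta> form_\<eta> form_\<eta>]) simp
      ultimately show ?thesis unfolding h_def
        by (auto intro!: form_diff form_mult[OF _ form_\<eta>] form_mult[OF _ const])
    qed
    show "form 2 (\<lambda>x. Q (\<pi> x))" unfolding Q_def
      by (rule form_cmult) (rule form_tri[OF const form_\<pi> form_\<pi>], simp)
    show "form 2 (\<lambda>y. Q (\<eta> y))" unfolding Q_def
      by (rule form_cmult) (rule form_tri[OF const form_\<eta> form_\<eta>], simp)
    show "form 0 (\<lambda>x. (- x0) $ i)" for i by (rule form_const)
    show "h (g x) = Q (\<pi> x) *s x + f x *s (- x0)" for x
    proof -
      have "f x = x $ j * Q (\<pi> x) + f (\<pi> x)"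
        using f_add[of "x $ j" 1 "\<pi> x"] by (simp add: \<pi>_def)
      then show ?thesis unfolding h_def g_def \<eta>_\<pi>
        by (simp add: \<pi>_def[of x] vec_eq_iff algebra_simps)
    qed
    show "g (h y) = Q (\<eta> y) *s y" for y
    proof -
      have "\<pi> (h y) = Q (\<eta> y) *s \<eta> y"
        by (simp add: \<pi>_def h_def \<eta>_j x0 vec_eq_iff)
      then show ?thesis by (simp add: g_def vec_eq_iff \<eta>_\<sigma>)
    qed
    show "f (h y) = 0" for y
    proof -
      have "h y = (- f (\<eta> y)) *s x0 + Q (\<eta> y) *s \<eta> y" by (simp add: h_def vec_eq_iff)
      then show ?thesis by (simp only: f_add) (simp add: power2_eq_square power3_eq_cube)
    qed
    show "(\<chi> i. \<pi> v $ \<sigma> i) \<noteq> 0"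
    proof
      assume "(\<chi> i. \<pi> v $ \<sigma> i) = 0"
      then have "\<pi> v = \<eta> (0 *s 0)" using \<eta>_\<pi>[of v] by simp
      with \<pi>v show False unfolding \<eta>_scale by simp
    qed
    show "Q (\<eta> (\<chi> i. \<pi> v $ \<sigma> i)) \<noteq> 0" using \<pi>v' by (simp add: \<eta>_\<pi> Q_def)
  qed
qed

section \<open>Parametrization of a norm equation\<close>

lemma vector_4 [simp]:
  "(vector [a, b, c, d] :: 'a::zero ^ 4) $ 1 = a" "(vector [a, b, c, d] :: 'a::zero ^ 4) $ 2 = b"
  "(vector [a, b, c, d] :: 'a::zero ^ 4) $ 3 = c" "(vector [a, b, c, d] :: 'a::zero ^ 4) $ 4 = d"
  by (simp_all add: vector_def)

text \<open>Put q = q1 + i q2, G = g1 + i g2 and u = l (x_0 + i x_1) + G. On f = 0 the norms of u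
  and q agree, so w = q + conj(u) satisfies u w = q conj(w). Hence the ratio Re w : Im w and the
  last three coordinates recover u, and with it x_0 + i x_1.\<close>

lemma birational_norm:
  fixes l g1 g2 q1 q2 C :: "real ^ 3 \<Rightarrow> real" and f :: "real ^ 5 \<Rightarrow> real"
  defines "w \<equiv> \<lambda>x::real^5. vector [x $ 2, x $ 3, x $ 4] :: real ^ 3"
  assumes forms: "form 1 l" "form 2 g1" "form 2 g2" "form 2 q1" "form 2 q2" "form 3 C"
    and norm: "\<And>z. l z * C z = (g1 z)\<^sup>2 + (g2 z)\<^sup>2 - (q1 z)\<^sup>2 - (q2 z)\<^sup>2"
    and z0: "l z0 \<noteq> 0" "q1 z0 \<noteq> 0 \<or> q2 z0 \<noteq> 0"
    and f: "\<And>x. f x = ((x $ 0)\<^sup>2 + (x $ 1)\<^sup>2) * l (w x) + 2 * (x $ 0 * g1 (w x) + x $ 1 * g2 (w x)) + C (w x)"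
  shows "birational_forms f"
proof -
  have scale: "l (\<mu> *s z) = \<mu> * l z" "g1 (\<mu> *s z) = \<mu>\<^sup>2 * g1 z" "g2 (\<mu> *s z) = \<mu>\<^sup>2 * g2 z"
    "q1 (\<mu> *s z) = \<mu>\<^sup>2 * q1 z" "q2 (\<mu> *s z) = \<mu>\<^sup>2 * q2 z" "C (\<mu> *s z) = \<mu> ^ 3 * C z" for \<mu> z
    using forms[THEN form_scale, of \<mu> z] by simp_all
  define L where "L x = l (w x)" for x
  \<comment> \<open>\<open>w1\<close> and \<open>w2\<close> are the real and imaginary parts of w =
    q + conj(u).\<close>
  define w1 where "w1 x = q1 (w x) + L x * x $ 0 + g1 (w x)" for x
  define w2 where "w2 x = q2 (w x) - L x * x $ 1 - g2 (w x)" for x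
  \<comment> \<open>The scaling is chosen so that \<open>y $ 4 : \<Lambda> y\<close> equals Re w :
    Im w at y = \<open>g x\<close>.\<close>
  define g :: "real ^ 5 \<Rightarrow> real ^ 4" where
    "g x = vector [w2 x * x $ 2, w2 x * x $ 3, w2 x * x $ 4, L x * w1 x]" for x
  define W :: "real ^ 4 \<Rightarrow> real ^ 3" where "W y = vector [y $ 1, y $ 2, y $ 3]" for y
  define \<Lambda> where "\<Lambda> y = l (W y)" for y
  define \<Omega> where "\<Omega> y = (y $ 4)\<^sup>2 + (\<Lambda> y)\<^sup>2" for y
  \<comment> \<open>With w = y_4 + i \<open>\<Lambda> y\<close> and |w|^2 =
    \<open>\<Omega> y\<close>, the complex number A1 + i A2 is q conj(w)^2 - G |w|^2. Division by
    \<open>M y\<close> gives x_0 + i x_1, because u = q conj(w) / w.\<close>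
  define A1 where "A1 y = q1 (W y) * ((y $ 4)\<^sup>2 - (\<Lambda> y)\<^sup>2) + 2 * (q2 (W y) * (y $ 4 * \<Lambda> y)) - g1 (W y) * \<Omega> y" for y
  define A2 where "A2 y = q2 (W y) * ((y $ 4)\<^sup>2 - (\<Lambda> y)\<^sup>2) - 2 * (q1 (W y) * (y $ 4 * \<Lambda> y)) - g2 (W y) * \<Omega> y" for y
  define M where "M y = \<Lambda> y * \<Omega> y" for y
  define h :: "real ^ 4 \<Rightarrow> real ^ 5" where
    "h y = (\<chi> i. if i = 0 then A1 y else if i = 1 then A2 y else if i = 2 then M y * y $ 1
       else if i = 3 then M y * y $ 2 else M y * y $ 3)" for y
  define a where "a x = (w2 x)\<^sup>2 * (L x ^ 3 * ((w1 x)\<^sup>2 + (w2 x)\<^sup>2))" for x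
  define b where "b y = 2 * ((M y)\<^sup>2 * ((\<Lambda> y)\<^sup>2 * (q1 (W y) * y $ 4 + q2 (W y) * \<Lambda> y)))" for y
  \<comment> \<open>Off the hypersurface, q conj(w) - u w = |q|^2 - |u|^2 = - L f. The composite
    therefore differs from a multiple of the identity by f times - conj(w), up to the scaling factor
    recorded here.\<close>
  define K :: "real ^ 5 \<Rightarrow> real ^ 5" where
    "K x = (\<chi> i. if i = 0 then - ((w2 x)\<^sup>2 * (L x ^ 3 * w1 x)) else if i = 1 then (w2 x)\<^sup>2 * (L x ^ 3 * w2 x) else 0)" for x
  have coord: "form 1 (\<lambda>x. x $ i)" for i by (rule form_coord)
  have w_nth: "form 1 (\<lambda>x. w x $ i)" for i
    using exhaust_3[of i] coord by (auto simp: w_def)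
  have W_nth: "form 1 (\<lambda>y. W y $ i)" for i
    using exhaust_3[of i] coord by (auto simp: W_def)
  have fw: "form 1 L" "form 2 (\<lambda>x. g1 (w x))" "form 2 (\<lambda>x. g2 (w x))" "form 2 (\<lambda>x. q1 (w x))" "form 2 (\<lambda>x. q2 (w x))"
    unfolding L_def using forms[THEN form_compose, OF w_nth] by simp_all
  have fW: "form 1 \<Lambda>" "form 2 (\<lambda>x. g1 (W x))" "form 2 (\<lambda>x. g2 (W x))" "form 2 (\<lambda>x. q1 (W x))" "form 2 (\<lambda>x. q2 (W x))"
    unfolding \<Lambda>_def using forms[THEN form_compose, OF W_nth] by simp_all
  have fw1: "form 2 w1" and fw2: "form 2 w2"
    unfolding w1_def w2_def by (intro form_add form_diff fw form_mult[OF fw(1) coord] one_add_one)+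
  have f\<Omega>: "form 2 \<Omega>" unfolding \<Omega>_def by (intro form_add form_power[OF coord] form_power[OF fW(1)]) simp_all
  have fM: "form 3 M" unfolding M_def by (rule form_mult[OF fW(1) f\<Omega>]) simp
  have fsq: "form 2 (\<lambda>y. (y $ 4)\<^sup>2 - (\<Lambda> y)\<^sup>2)" by (intro form_diff form_power[OF coord] form_power[OF fW(1)]) simp_all
  have f\<Lambda>4: "form 2 (\<lambda>y. y $ 4 * \<Lambda> y)" by (rule form_mult[OF coord fW(1)]) simp
  have fA: "form 4 A1" "form 4 A2"
    unfolding A1_def A2_def
    by (intro form_add form_diff form_cmult form_mult[OF fW(2) f\<Omega>] form_mult[OF fW(3) f\<Omega>]
        form_mult[OF fW(4) fsq] form_mult[OF fW(5) fsq] form_mult[OF fW(4) f\<Lambda>4] form_mult[OF fW(5) f\<Lambda>4]; simp)+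
  have fK: "form 9 (\<lambda>x. (w2 x)\<^sup>2 * (L x ^ 3 * w2 x))" "form 9 (\<lambda>x. (w2 x)\<^sup>2 * (L x ^ 3 * w1 x))"
    by (rule form_mult[OF form_power[OF fw2 refl] form_mult[OF form_power[OF fw(1) refl] fw2 refl]], simp)
       (rule form_mult[OF form_power[OF fw2 refl] form_mult[OF form_power[OF fw(1) refl] fw1 refl]], simp)
  have lf: "L x * f x = (L x * x $ 0 + g1 (w x))\<^sup>2 + (L x * x $ 1 + g2 (w x))\<^sup>2 - (q1 (w x))\<^sup>2 - (q2 (w x))\<^sup>2" for x
  proof -
    have "L x * f x = (L x)\<^sup>2 * ((x $ 0)\<^sup>2 + (x $ 1)\<^sup>2) + 2 * L x * (x $ 0 * g1 (w x) + x $ 1 * g2 (w x)) + L x * C (w x)"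
      by (simp add: f L_def power2_eq_square algebra_simps)
    then show ?thesis unfolding L_def norm by (simp add: power2_eq_square algebra_simps)
  qed
  have W_g: "W (g x) = w2 x *s w x" for x
    by (simp add: W_def g_def w_def vec_eq_iff forall_3)
  have g4: "g x $ 4 = L x * w1 x" for x by (simp add: g_def)
  have \<Lambda>_g: "\<Lambda> (g x) = w2 x * L x" for x by (simp add: \<Lambda>_def L_def W_g scale)
  have A_g: "A1 (g x) = a x * x $ 0 - f x * ((w2 x)\<^sup>2 * (L x ^ 3 * w1 x))"
      "A2 (g x) = a x * x $ 1 + f x * ((w2 x)\<^sup>2 * (L x ^ 3 * w2 x))" for x
  proof -
    have "q1 (w x) * ((w1 x)\<^sup>2 - (w2 x)\<^sup>2) + 2 * (q2 (w x) * (w1 x * w2 x)) - g1 (w x) * ((w1 x)\<^sup>2 + (w2 x)\<^sup>2) =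
        L x * ((w1 x)\<^sup>2 + (w2 x)\<^sup>2) * x $ 0 - (L x * f x) * w1 x"
      unfolding lf unfolding w1_def w2_def by algebra
    moreover have "A1 (g x) = (w2 x)\<^sup>2 * (L x)\<^sup>2 * (q1 (w x) * ((w1 x)\<^sup>2 - (w2 x)\<^sup>2) + 2 * (q2 (w x) * (w1 x * w2 x)) - g1 (w x) * ((w1 x)\<^sup>2 + (w2 x)\<^sup>2))"
      unfolding A1_def \<Omega>_def W_g \<Lambda>_g g4 scale by algebra
    ultimately show "A1 (g x) = a x * x $ 0 - f x * ((w2 x)\<^sup>2 * (L x ^ 3 * w1 x))"
      unfolding a_def by algebra
    have "q2 (w x) * ((w1 x)\<^sup>2 - (w2 x)\<^sup>2) - 2 * (q1 (w x) * (w1 x * w2 x)) - g2 (w x) * ((w1 x)\<^sup>2 + (w2 x)\<^sup>2) =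
        L x * ((w1 x)\<^sup>2 + (w2 x)\<^sup>2) * x $ 1 + (L x * f x) * w2 x"
      unfolding lf unfolding w1_def w2_def by algebra
    moreover have "A2 (g x) = (w2 x)\<^sup>2 * (L x)\<^sup>2 * (q2 (w x) * ((w1 x)\<^sup>2 - (w2 x)\<^sup>2) - 2 * (q1 (w x) * (w1 x * w2 x)) - g2 (w x) * ((w1 x)\<^sup>2 + (w2 x)\<^sup>2))"
      unfolding A2_def \<Omega>_def W_g \<Lambda>_g g4 scale by algebra
    ultimately show "A2 (g x) = a x * x $ 1 + f x * ((w2 x)\<^sup>2 * (L x ^ 3 * w2 x))"
      unfolding a_def by algebra
  qed
  have M_g: "M (g x) * w2 x = a x" for x
    unfolding M_def \<Omega>_def \<Lambda>_g g4 a_def by algebra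
  have h_nth: "h y $ 0 = A1 y" "h y $ 1 = A2 y" "h y $ 2 = M y * y $ 1" "h y $ 3 = M y * y $ 2" "h y $ 4 = M y * y $ 3" for y
    by (simp_all add: h_def)
  have w_h: "w (h y) = M y *s W y" for y
    by (simp add: w_def W_def h_nth vec_eq_iff forall_3)
  have w12_h: "w1 (h y) = 2 * ((M y * \<Lambda> y) * (q1 (W y) * y $ 4 + q2 (W y) * \<Lambda> y)) * y $ 4"
    "w2 (h y) = 2 * ((M y * \<Lambda> y) * (q1 (W y) * y $ 4 + q2 (W y) * \<Lambda> y)) * \<Lambda> y" for y
    unfolding w1_def w2_def L_def w_h h_nth scale A1_def A2_def M_def \<Lambda>_def[symmetric] \<Omega>_def by algebra+
  have L_h: "L (h y) = M y * \<Lambda> y" for y unfolding L_def w_h scale \<Lambda>_def ..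
  have f_h: "f (h y) = 0" for y
  proof -
    have "f (h y) = ((A1 y)\<^sup>2 + (A2 y)\<^sup>2) * (M y * \<Lambda> y) + 2 * (A1 y * ((M y)\<^sup>2 * g1 (W y)) + A2 y * ((M y)\<^sup>2 * g2 (W y))) + (M y) ^ 3 * C (W y)"
      unfolding f w_h scale h_nth \<Lambda>_def ..
    also have "\<dots> = (M y * \<Lambda> y) * ((A1 y + g1 (W y) * \<Omega> y)\<^sup>2 + (A2 y + g2 (W y) * \<Omega> y)\<^sup>2
        + (\<Omega> y)\<^sup>2 * (\<Lambda> y * C (W y) - (g1 (W y))\<^sup>2 - (g2 (W y))\<^sup>2))"
      unfolding M_def by algebra
    also have "\<dots> = 0"
      using norm[of "W y"] unfolding \<Lambda>_def[symmetric] A1_def A2_def \<Omega>_def by algebra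
    finally show ?thesis .
  qed
  \<comment> \<open>The fourth coordinate solves q1 y_4 + q2 l = 1 at \<open>z0\<close>; if
    \<open>q1 z0 = 0\<close>, the product \<open>q2 z0 * l z0\<close> is already nonzero.\<close>
  define y0 :: "real ^ 4" where
    "y0 = vector [z0 $ 1, z0 $ 2, z0 $ 3, if q1 z0 = 0 then 0 else (1 - q2 z0 * l z0) / q1 z0]"
  have W_y0: "W y0 = z0" by (simp add: W_def y0_def vec_eq_iff forall_3)
  have b_y0: "b y0 \<noteq> 0"
  proof -
    have "\<Lambda> y0 \<noteq> 0" using z0(1) by (simp add: \<Lambda>_def W_y0)
    then have "\<Omega> y0 > 0" unfolding \<Omega>_def by (metis add_nonneg_pos zero_le_power2 zero_less_power2)
    then have "M y0 \<noteq> 0" using \<open>\<Lambda> y0 \<noteq> 0\<close> by (simp add: M_def)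
    moreover have "q1 z0 * y0 $ 4 + q2 z0 * l z0 \<noteq> 0" using z0 by (simp add: y0_def)
    ultimately show ?thesis using \<open>\<Lambda> y0 \<noteq> 0\<close> by (simp add: b_def W_y0 \<Lambda>_def)
  qed
  show ?thesis
    unfolding birational_forms_def
  proof (intro exI conjI allI)
    show "(0::nat) < 3" by simp
    show "form 3 (\<lambda>x. g x $ i)" for i
    proof -
      have "form 3 (\<lambda>x. w2 x * x $ j)" for j by (rule form_mult[OF fw2 coord]) simp
      moreover have "form 3 (\<lambda>x. L x * w1 x)" by (rule form_mult[OF fw(1) fw1]) simp
      ultimately show ?thesis using exhaust_4[of i] by (auto simp: g_def)
    qed
    show "form 4 (\<lambda>y. h y $ i)" for i
    proof -
      have "form 4 (\<lambda>y. M y * y $ j)" for j by (rule form_mult[OF fM coord]) simp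
      then show ?thesis using fA exhaust_5[of i] by (auto simp: h_def)
    qed
    show "form 11 a" unfolding a_def
      by (rule form_mult[OF form_power[OF fw2 refl] form_mult[OF form_power[OF fw(1) refl]
            form_add[OF form_power[OF fw1 refl] form_power[OF fw2 refl]] refl]]) simp
    show "form 11 b" unfolding b_def
      by (rule form_cmult, rule form_mult[OF form_power[OF fM refl] form_mult[OF form_power[OF fW(1) refl]
            form_add[OF form_mult[OF fW(4) coord refl] form_mult[OF fW(5) fW(1) refl]] refl]]) simp
    show "form 9 (\<lambda>x. K x $ i)" for i
      unfolding K_def using fK(1) form_uminus[OF fK(2)] form_zero
      by (cases "i = 0"; cases "i = 1") simp_all
    show "h (g x) = a x *s x + f x *s K x" for x
    proof -
      have "h (g x) $ i = (a x *s x + f x *s K x) $ i" for i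
        using exhaust_5[of i] A_g[of x] M_g[of x] by (auto simp: h_def K_def g_def mult.assoc[symmetric])
      then show ?thesis by (simp add: vec_eq_iff)
    qed
    show "g (h y) = b y *s y" for y
    proof -
      have "g (h y) $ i = (b y *s y) $ i" for i
        using exhaust_4[of i] by (auto simp: g_def h_nth w12_h L_h b_def power2_eq_square algebra_simps)
      then show ?thesis by (simp add: vec_eq_iff)
    qed
    show "f (h y) = 0" for y by (rule f_h)
    show "y0 \<noteq> 0"
    proof
      assume "y0 = 0"
      then have "z0 = 0" using W_y0 by (simp add: W_def vec_eq_iff forall_3)
      then have "\<Lambda> y0 = 0" using scale(1)[of 0 0] by (simp add: \<Lambda>_def W_y0)
      with b_y0 show False by (simp add: b_def)
    qed
  qed (rule b_y0)
qed

section \<open>Projection from the line through two singular points\<close>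

lemma UNIV_5: "UNIV = {0, 1, 2, 3, 4 :: 5}"
  using exhaust_5 by auto

lemma sum_5: "sum f (UNIV :: 5 set) = f 0 + f 1 + f 2 + f 3 + f 4"
  unfolding UNIV_5 by (simp add: ac_simps)

definition columns5 :: "'a ^ 5 \<Rightarrow> 'a ^ 5 \<Rightarrow> 'a ^ 5 \<Rightarrow> 'a ^ 5 \<Rightarrow> 'a ^ 5 \<Rightarrow> 'a ^ 5 ^ 5"
  where "columns5 a b c d e = (\<chi> i j. if j = 0 then a $ i else if j = 1 then b $ i else if j = 2 then c $ i
    else if j = 3 then d $ i else e $ i)"

lemma columns5_mult:
  fixes a :: "'a::field ^ 5"
  shows "columns5 a b c d e *v x = x $ 0 *s a + x $ 1 *s b + x $ 2 *s c + x $ 3 *s d + x $ 4 *s e"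
  by (simp add: vec_eq_iff columns5_def matrix_vector_mult_def sum_5 mult.commute)

lemma columns5_invertible:
  fixes a :: "'a::field ^ 5"
  assumes "\<And>x0 x1 x2 x3 x4. x0 *s a + x1 *s b + x2 *s c + x3 *s d + x4 *s e = 0 \<Longrightarrow>
    x0 = 0 \<and> x1 = 0 \<and> x2 = 0 \<and> x3 = 0 \<and> x4 = 0"
  obtains N where "columns5 a b c d e ** N = mat 1"
proof -
  have "x = 0" if "columns5 a b c d e *v x = 0" for x
  proof -
    have 0: "x $ 0 = 0 \<and> x $ 1 = 0 \<and> x $ 2 = 0 \<and> x $ 3 = 0 \<and> x $ 4 = 0"
      by (rule assms) (use that in \<open>simp only: columns5_mult\<close>)
    have "x $ i = 0" for i using exhaust_5[of i] 0 by (elim disjE) simp_all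
    then show ?thesis by (simp add: vec_eq_iff)
  qed
  then have "\<exists>N. N ** columns5 a b c d e = mat 1" unfolding matrix_left_invertible_ker by simp
  then obtain N where "N ** columns5 a b c d e = mat 1" ..
  then have "columns5 a b c d e ** N = mat 1" by (simp only: matrix_left_right_inverse[of N])
  then show ?thesis by (rule that)
qed

lemma span5:
  fixes a :: "'a::field ^ 5"
  assumes "\<And>x0 x1 x2 x3 x4. x0 *s a + x1 *s b + x2 *s c + x3 *s d + x4 *s e = 0 \<Longrightarrow>
    x0 = 0 \<and> x1 = 0 \<and> x2 = 0 \<and> x3 = 0 \<and> x4 = 0"
  obtains x0 x1 x2 x3 x4 where "v = x0 *s a + x1 *s b + x2 *s c + x3 *s d + x4 *s e"
proof -
  obtain N where N: "columns5 a b c d e ** N = mat 1"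
    by (rule columns5_invertible[OF assms])
  have "v = columns5 a b c d e *v (N *v v)" by (simp add: matrix_vector_mul_assoc N)
  then show ?thesis unfolding columns5_mult by (rule that)
qed

lemma smult_cancel: "a \<noteq> 0 \<Longrightarrow> a *s x = y \<Longrightarrow> x = (1 / a) *s y" for x :: "'a::field ^ 'n"
  by (auto simp: vector_smult_assoc)

lemma smult_solve:
  fixes x :: "'a::field ^ 'n"
  assumes "a \<noteq> 0" "b *s y + c *s z + d *s w + e *s v + a *s x = 0"
  shows "x = (- b / a) *s y + (- c / a) *s z + (- d / a) *s w + (- e / a) *s v"
proof (rule vec_eq_iff[THEN iffD2], rule allI)
  fix i
  have "b * y $ i + c * z $ i + d * w $ i + e * v $ i + a * x $ i = 0"
    using arg_cong[OF assms(2), of "\<lambda>u. u $ i"] by simp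
  then have "a * x $ i = - (b * y $ i + c * z $ i + d * w $ i + e * v $ i)"
    by algebra
  then have "x $ i = - (b * y $ i + c * z $ i + d * w $ i + e * v $ i) / a"
    using assms(1) by (metis nonzero_mult_div_cancel_left)
  then show "x $ i = ((- b / a) *s y + (- c / a) *s z + (- d / a) *s w + (- e / a) *s v) $ i"
    by (simp add: add_divide_distrib diff_divide_distrib)
qed

context real_cubic
begin

lemmas B_sym = B_commute12 B_commute23

lemma singD:
  assumes "sing x"
  shows "B x x v = 0" "B x v x = 0" "B v x x = 0"
  using assms B_commute23[of x v x] B_left_commute[of v x x] by (simp_all add: sing_def)

end

section \<open>The discriminant quartic of the projection\<close>

locale cubic_line = finitely_singular_cubic +
  fixes p p' :: "complex ^ 5"
  assumes sing_p: "sing p" and sing_p': "sing p'"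
    and indep: "a *s p + b *s p' = 0 \<Longrightarrow> a = 0 \<and> b = 0"
begin

definition off_line :: "complex ^ 5 \<Rightarrow> bool"
  where "off_line x \<longleftrightarrow> (\<forall>a b. x \<noteq> a *s p + b *s p')"

text \<open>At x + a p + b p' the cubic is B x x x + 3 a B p x x + 3 b B p' x x + 6 a b B p p' x.
  Apart from the line, the plane through \<open>x\<close> thus cuts out a conic, which degenerates
  where \<open>D\<close> vanishes.\<close>

definition D :: "complex ^ 5 \<Rightarrow> complex"
  where "D x = 3 * B p x x * B p' x x - 2 * B p p' x * B x x x"

definition dD :: "complex ^ 5 \<Rightarrow> complex ^ 5 \<Rightarrow> complex"
  where "dD x v = 6 * B p x v * B p' x x + 6 * B p x x * B p' x v - 2 * B p p' v * B x x x - 6 * B p p' x * B x x v"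

lemmas zero_simps = singD[OF sing_p] singD[OF sing_p']

lemma off_lineD: "off_line x \<Longrightarrow> a *s x + b *s p + d *s p' = 0 \<Longrightarrow> a = 0 \<and> b = 0 \<and> d = 0"
proof -
  assume x: "off_line x" and 0: "a *s x + b *s p + d *s p' = 0"
  have "a = 0"
  proof (rule ccontr)
    assume a: "a \<noteq> 0"
    have "x = (- b / a) *s p + (- d / a) *s p'"
      using smult_solve[OF a, of b p d p' 0 0 0 0 x] 0 by (simp add: add_ac)
    then show False using x unfolding off_line_def by blast
  qed
  with 0 indep show ?thesis by auto
qed

text \<open>Otherwise the entire line through \<open>p\<close> and \<open>p'\<close> would be
  singular.\<close>

lemma l_nonzero: obtains v where "B p p' v \<noteq> 0"
proof (rule ccontr)
  assume "\<not> thesis"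
  with that have 0: "B p p' v = 0" for v by blast
  have "sing (p + s *s p')" for s
    unfolding sing_def
  proof (intro conjI allI)
    show "p + s *s p' \<noteq> 0" using indep[of 1 s] by auto
    show "B (p + s *s p') (p + s *s p') v = 0" for v
      using 0[of v] B_commute12[of p' p v] by (simp add: B_linear zero_simps)
  qed
  then obtain s s' k where "s \<noteq> s'" "k \<noteq> 0" "p + s *s p' = k *s (p + s' *s p')"
    using sing_familyE[OF infinite_UNIV_char_0, of "\<lambda>s. p + s *s p'"] by metis
  moreover from this have "(1 - k) *s p + (s - k * s') *s p' = 0"
    by (simp add: vec_eq_iff algebra_simps)
  ultimately show False using indep by fastforce
qed

lemma l_neq_0_off_line: "B p p' x \<noteq> 0 \<Longrightarrow> off_line x"
  unfolding off_line_def by (auto simp: B_linear zero_simps)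

text \<open>The form \<open>B q\<close> has \<open>q\<close> and \<open>k\<close> in its kernel, and
  on the hyperplane \<open>B p p' v = 0\<close> also \<open>q'\<close> is orthogonal to everything.
  Only one dimension remains, so an isotropic \<open>x\<close> is orthogonal to the whole
  hyperplane, and \<open>B q x\<close> is a multiple of the functional defining it.\<close>

lemma degenerate_proportional:
  assumes q: "(q = p \<and> q' = p') \<or> (q = p' \<and> q' = p)"
    and k: "\<And>a. k \<noteq> a *s q" "\<And>v. B q k v = 0"
    and x: "B q x x = 0" "B p p' x = 0"
  obtains m where "\<And>v. B q x v = m * B p p' v"
proof -
  have l: "B q q' v = B p p' v" for v using q B_commute12[of p p' v] by auto
  have zq: "B q q v = 0" "B q' q' v = 0" "B q v q = 0" "B q' v q' = 0" "B q q' q' = 0" "B q q' q = 0" for v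
    using q zero_simps by (auto simp: zero_simps)
  have indq: "a = 0 \<and> b = 0" if "a *s q + b *s q' = 0" for a b
    using q indep[of a b] indep[of b a] that by (auto simp: add.commute)
  obtain v0 where v0: "B p p' v0 \<noteq> 0" by (rule l_nonzero)
  have k_off: "k \<noteq> a *s q + b *s q'" for a b
  proof
    assume k': "k = a *s q + b *s q'"
    have "b * B p p' v0 = 0" using k(2)[of v0] by (simp add: k' B_linear zq l)
    with v0 have "b = 0" by simp
    with k' k(1)[of a] show False by simp
  qed
  have l_k: "B p p' k = 0" using k(2)[of q'] l[of k] B_commute23[of q k q'] by simp
  have l_qq': "B p p' q = 0" "B p p' q' = 0" using l[of q] l[of q'] zq by simp_all
  show ?thesis
  proof (cases "\<exists>a b c. x = a *s q + b *s q' + c *s k")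
    case True
    then obtain a b c where "x = a *s q + b *s q' + c *s k" by blast
    then have "B q x v = b * B p p' v" for v by (simp add: B_linear zq k l)
    with that show ?thesis by blast
  next
    case False
    have ind: "x0 = 0 \<and> x1 = 0 \<and> x2 = 0 \<and> x3 = 0 \<and> x4 = 0"
      if 0: "x0 *s q + x1 *s q' + x2 *s k + x3 *s x + x4 *s v0 = 0" for x0 x1 x2 x3 x4
    proof -
      have "B p p' (x0 *s q + x1 *s q' + x2 *s k + x3 *s x + x4 *s v0) = x4 * B p p' v0"
        by (simp add: B_linear l_qq' l_k x)
      with 0 v0 have x4: "x4 = 0" by (simp add: B_zero)
      have x3: "x3 = 0"
      proof (rule ccontr)
        assume "x3 \<noteq> 0"
        from smult_solve[OF this, of x0 q x1 q' x2 k 0 0 x] 0 x4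
        have "x = (- x0 / x3) *s q + (- x1 / x3) *s q' + (- x2 / x3) *s k" by simp
        then show False using False by blast
      qed
      have x2: "x2 = 0"
      proof (rule ccontr)
        assume "x2 \<noteq> 0"
        from smult_solve[OF this, of x0 q x1 q' 0 0 0 0 k] 0 x4 x3
        have "k = (- x0 / x2) *s q + (- x1 / x2) *s q'" by simp
        then show False using k_off by blast
      qed
      show ?thesis using indq[of x0 x1] 0 x4 x3 x2 by simp
    qed
    have "B q x v = B q x v0 / B p p' v0 * B p p' v" for v
    proof -
      obtain x0 x1 x2 x3 x4 where v: "v = x0 *s q + x1 *s q' + x2 *s k + x3 *s x + x4 *s v0"
        using span5[of q q' k x v0 v, OF ind] by blast
      have "B q x q' = 0" using x(2) l[of x] B_commute23[of q x q'] by simp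
      moreover have "B q x k = 0" using k(2)[of x] B_commute23[of q x k] by simp
      ultimately show ?thesis using v0 by (simp add: v B_linear zq x l_qq' l_k)
    qed
    with that show ?thesis by blast
  qed
qed

text \<open>If \<open>B p p' x = 0\<close>, both \<open>B p x\<close> and \<open>B p' x\<close> are
  multiples m, m' of \<open>B p p'\<close>. Then x + s p + t p' is singular as soon as s m + t m' +
  s t = 0; solving for t gives a curve of singular points.\<close>

lemma l_nonzero_off_line:
  assumes k: "\<And>a. k \<noteq> a *s p" "\<And>v. B p k v = 0"
    and k': "\<And>a. k' \<noteq> a *s p'" "\<And>v. B p' k' v = 0"
    and x: "sing x" "off_line x"
  shows "B p p' x \<noteq> 0"
proof
  assume l: "B p p' x = 0"
  obtain m where m: "\<And>v. B p x v = m * B p p' v"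
    using degenerate_proportional[OF disjI1[OF conjI[OF refl refl]] k] singD[OF x(1)] l by blast
  obtain m' where m': "\<And>v. B p' x v = m' * B p p' v"
    using degenerate_proportional[OF disjI2[OF conjI[OF refl refl]] k'] singD[OF x(1)] l by blast
  define f where "f s = x + s *s p + (- (s * m / (s + m'))) *s p'" for s
  have "sing (f s)" if "s \<in> - {- m'}" for s
    unfolding sing_def
  proof (intro conjI allI)
    show "f s \<noteq> 0" using off_lineD[OF x(2), of 1 s "- (s * m / (s + m'))"] by (auto simp: f_def)
    fix v
    have "s + m' \<noteq> 0" using that by (auto simp: add_eq_0_iff2)
    moreover have "B (f s) (f s) v = 2 * (s * m + (- (s * m / (s + m'))) * m' + s * (- (s * m / (s + m')))) * B p p' v"
      unfolding f_def using m[of v] m'[of v] B_commute12[of x p v] B_commute12[of x p' v] B_commute12[of p' p v]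
      by (simp add: B_linear zero_simps singD[OF x(1)] algebra_simps)
    ultimately show "B (f s) (f s) v = 0" by (simp add: field_simps)
  qed
  moreover have "infinite (- {- m'})" by (simp add: Compl_eq_Diff_UNIV infinite_UNIV_char_0)
  ultimately obtain s s' k where s: "s \<noteq> s'" "f s = k *s f s'" using sing_familyE by metis
  then have "(1 - k) *s x + (s - k * s') *s p + (- (s * m / (s + m')) + k * (s' * m / (s' + m'))) *s p' = 0"
    by (simp add: f_def vec_eq_iff algebra_simps)
  from off_lineD[OF x(2) this] s(1) show False by simp
qed

text \<open>\<open>B p y y\<close> and \<open>B p' y y\<close> equal 2 a d and 2 a b times
  \<open>B p p' x\<close>, and both vanish at a singular \<open>y\<close>.\<close>

lemma sing_same_projection:
  assumes x: "sing x" "B p p' x \<noteq> 0" and y: "sing y" "off_line y" and y_eq: "y = a *s x + b *s p + d *s p'"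
  shows "y = a *s x" "a \<noteq> 0"
proof -
  show a: "a \<noteq> 0"
  proof
    assume "a = 0"
    then have "y = b *s p + d *s p'" using y_eq by simp
    with y(2) show False unfolding off_line_def by blast
  qed
  have "B p y y = 2 * a * d * B p p' x"
    using B_commute23[of p x p'] by (simp add: y_eq B_linear zero_simps singD[OF x(1)])
  moreover have "B p' y y = 2 * a * b * B p p' x"
    using B_commute12[of p' p x] B_left_commute[of p' x p] B_commute13[of x p p'] B_left_commute[of p p' x] B_commute23[of p p' x] B_commute12[of x p p']
    by (simp add: y_eq B_linear zero_simps singD[OF x(1)])
  ultimately have "b = 0" "d = 0" using singD[OF y(1)] a x(2) by auto
  then show "y = a *s x" using y_eq by simp
qed

lemma sing_dD: "sing x \<Longrightarrow> dD x v = 0"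
  by (simp add: dD_def singD)

text \<open>The lift is the singular point of the degenerate conic over \<open>x\<close>. The values
  of \<open>a\<close> and \<open>b\<close> are forced by the vanishing of B p' z z and B p z z at
  the lift z.\<close>

lemma lift_sing:
  assumes l: "B p p' x \<noteq> 0" and d: "\<And>v. dD x v = 0"
  obtains a b where "sing (x + a *s p + b *s p')"
proof -
  define a where "a = - B p' x x / (2 * B p p' x)"
  define b where "b = - B p x x / (2 * B p p' x)"
  \<comment> \<open>Euler's relation \<open>dD x x = 4 * D x\<close> turns the vanishing derivative
    into a zero of the quartic.\<close>
  have D: "3 * B p x x * B p' x x = 2 * B p p' x * B x x x"
    using d[of x] by (simp add: dD_def algebra_simps)
  have "B (x + a *s p + b *s p') (x + a *s p + b *s p') v = 0" for v
  proof -
    have "B (x + a *s p + b *s p') (x + a *s p + b *s p') v =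
        B x x v + 2 * a * B p x v + 2 * b * B p' x v + 2 * a * b * B p p' v"
      using B_commute12[of x p v] B_commute12[of x p' v] B_commute12[of p' p v]
      by (simp add: B_linear zero_simps algebra_simps)
    moreover have "6 * (B p p' x)\<^sup>2 * (B x x v + 2 * a * B p x v + 2 * b * B p' x v + 2 * a * b * B p p' v) =
        B p p' x * (- dD x v) + B p p' v * (3 * B p x x * B p' x x - 2 * B p p' x * B x x x)"
      unfolding dD_def a_def b_def using l by (simp add: field_simps power2_eq_square)
    ultimately show ?thesis using D d[of v] l by simp
  qed
  moreover have "x + a *s p + b *s p' \<noteq> 0"
    using off_lineD[OF l_neq_0_off_line[OF l], of 1 a b] by auto
  ultimately show ?thesis using that unfolding sing_def by blast
qed

lemma D_has_field_derivative: "((\<lambda>t. D (x + t *s v)) has_field_derivative dD x v) (at 0)"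
proof -
  have D_eq: "D (x + t *s v) = 3 * (B p x x + t * (2 * B p x v) + t\<^sup>2 * B p v v) * (B p' x x + t * (2 * B p' x v) + t\<^sup>2 * B p' v v)
      - 2 * (B p p' x + t * B p p' v) * (B x x x + t * (3 * B x x v) + t\<^sup>2 * (3 * B x v v) + t ^ 3 * B v v v)" for t
    using B_commute23[of p x v] B_commute23[of p' x v]
      B_commute23[of x v x] B_left_commute[of v x x] B_left_commute[of v x v] B_left_commute[of v v x]
    by (simp add: D_def B_linear algebra_simps power2_eq_square power3_eq_cube)
  show ?thesis unfolding D_eq by (auto intro!: derivative_eq_intros simp: dD_def algebra_simps)
qed

lemma D_translate: "D (x + a *s p + b *s p') = D x"
proof -
  have n: "B x p x = B p x x" "B x x p = B p x x" "B x p' x = B p' x x" "B x x p' = B p' x x"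
    "B p x p' = B p p' x" "B p' p x = B p p' x" "B p' x p = B p p' x" "B x p p' = B p p' x" "B x p' p = B p p' x"
    by (metis B_sym)+
  show ?thesis
    by (simp add: D_def B_linear zero_simps n) (simp add: algebra_simps)
qed

lemma dD_translate: "dD (x + a *s p + b *s p') v = dD x v"
proof -
  have "x + a *s p + b *s p' + t *s v = (x + t *s v) + a *s p + b *s p'" for t
    by (simp add: algebra_simps)
  then have "((\<lambda>t. D (x + t *s v)) has_field_derivative dD (x + a *s p + b *s p') v) (at 0)"
    using D_has_field_derivative[of "x + a *s p + b *s p'" v] by (simp only: D_translate)
  then show ?thesis using D_has_field_derivative DERIV_unique by blast
qed

text \<open>Along the line through two nodes of the quartic \<open>D = 0\<close>, the cubic \<open>dD\<close> vanishes at both nodes;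
  two further nodes on that line force it to vanish identically.\<close>

lemma not_collinear:
  assumes x: "sing x" "B p p' x \<noteq> 0" and y: "sing y" "B p p' y \<noteq> 0"
    and z: "sing z" "off_line z" and z': "sing z'" "off_line z'" and l_z: "B p p' z \<noteq> 0"
    and ne: "\<And>a. y \<noteq> a *s x" "\<And>a. z \<noteq> a *s x" "\<And>a. z \<noteq> a *s y" "\<And>a. z' \<noteq> a *s x" "\<And>a. z' \<noteq> a *s y" "\<And>a. z' \<noteq> a *s z"
    and z_eq: "z = a *s x + b *s y + e *s p + d *s p'"
    and z'_eq: "z' = a' *s x + b' *s y + e' *s p + d' *s p'"
  shows False
proof -
  have x_only: "w \<noteq> a *s x + e *s p + d *s p'" if "sing w" "off_line w" "\<And>a. w \<noteq> a *s x" for w a e d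
    using sing_same_projection(1)[OF x that(1,2)] that(3) by blast
  have y_only: "w \<noteq> a *s y + e *s p + d *s p'" if "sing w" "off_line w" "\<And>a. w \<noteq> a *s y" for w a e d
    using sing_same_projection(1)[OF y that(1,2)] that(3) by blast
  have "a \<noteq> 0" "b \<noteq> 0" "a' \<noteq> 0" "b' \<noteq> 0"
    using y_only[OF z ne(3), of b e d] x_only[OF z ne(2), of a e d] y_only[OF z' ne(5), of b' e' d']
      x_only[OF z' ne(4), of a' e' d'] z_eq z'_eq by auto
  \<comment> \<open>Otherwise \<open>z\<close> and \<open>z'\<close> would have the same projection
    from the line and hence be proportional.\<close>
  have det: "a * b' \<noteq> a' * b"
  proof
    assume det: "a * b' = a' * b"
    have "z' = (a' / a) *s z + (e' - a' / a * e) *s p + (d' - a' / a * d) *s p'"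
    proof -
      have "b' = a' / a * b" using det \<open>a \<noteq> 0\<close> by (simp add: field_simps)
      then show ?thesis using \<open>a \<noteq> 0\<close> by (simp add: z_eq z'_eq vec_eq_iff algebra_simps)
    qed
    from sing_same_projection(1)[OF z(1) l_z z' this] ne show False by blast
  qed
  \<comment> \<open>On the line through \<open>x\<close> and \<open>y\<close> the derivative of
    \<open>D\<close> is a binary cubic divisible by s t; \<open>k0\<close> and \<open>k1\<close> are
    the coefficients of the remaining linear factor.\<close>
  define k0 where "k0 v = 12 * (B p' x y * B p x v + B p x y * B p' x v - B p p' x * B x y v)" for v
  define k1 where "k1 v = 12 * (B p' x y * B p y v + B p x y * B p' y v - B p p' y * B x y v)" for v
  have dD_eq: "dD (s *s x + t *s y) v = s * t * (s * k0 v + t * k1 v)" for s t v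
    unfolding dD_def k0_def k1_def
    using B_commute23[of p x y] B_commute23[of p' x y] B_commute12[of x y v]
      B_commute23[of x y x] B_left_commute[of y x x]
      B_commute23[of y x y] B_left_commute[of x y y]
    by (simp add: B_linear singD[OF x(1)] singD[OF y(1)] algebra_simps)
  have "a * k0 v + b * k1 v = 0" for v
    using sing_dD[OF z(1), of v] dD_translate[of "a *s x + b *s y" e d v] \<open>a \<noteq> 0\<close> \<open>b \<noteq> 0\<close>
    by (simp add: z_eq dD_eq)
  moreover have "a' * k0 v + b' * k1 v = 0" for v
    using sing_dD[OF z'(1), of v] dD_translate[of "a' *s x + b' *s y" e' d' v] \<open>a' \<noteq> 0\<close> \<open>b' \<noteq> 0\<close>
    by (simp add: z'_eq dD_eq)
  ultimately have ab: "a * k0 v + b * k1 v = 0" "a' * k0 v + b' * k1 v = 0" for v by blast+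
  have k: "(a * b' - a' * b) * k0 v = 0" "(a * b' - a' * b) * k1 v = 0" for v
    using ab[of v] by algebra+
  have dD0: "dD (x + s *s y) v = 0" for s v
    using dD_eq[of 1 s v] k[of v] det by simp
  \<comment> \<open>The excluded parameter is the point of the line at which \<open>B p p'\<close>
    vanishes and no lift is available.\<close>
  define S where "S = - {- (B p p' x / B p p' y)}"
  have "\<exists>u w. sing (x + s *s y + u *s p + w *s p')" if "s \<in> S" for s
  proof -
    have "B p p' (x + s *s y) \<noteq> 0"
      using that y(2) by (auto simp: S_def B_linear add_eq_0_iff2 field_simps)
    then show ?thesis using lift_sing dD0 by metis
  qed
  then obtain u w where uw: "\<And>s. s \<in> S \<Longrightarrow> sing (x + s *s y + u s *s p + w s *s p')" by metis
  have "infinite S" by (simp add: S_def Compl_eq_Diff_UNIV infinite_UNIV_char_0)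
  then obtain s s' k where s: "s \<noteq> s'" "x + s *s y + u s *s p + w s *s p' = k *s (x + s' *s y + u s' *s p + w s' *s p')"
    using sing_familyE[of S "\<lambda>s. x + s *s y + u s *s p + w s *s p'"] uw by metis
  define \<alpha> where "\<alpha> = s - k * s'"
  have eq: "\<alpha> *s y = (k - 1) *s x + (k * u s' - u s) *s p + (k * w s' - w s) *s p'"
    using s(2) by (simp add: \<alpha>_def vec_eq_iff algebra_simps)
  show False
  proof (cases "\<alpha> = 0")
    case True
    then have "(k - 1) *s x + (k * u s' - u s) *s p + (k * w s' - w s) *s p' = 0" using eq by simp
    from off_lineD[OF l_neq_0_off_line[OF x(2)] this] True s(1) show False by (simp add: \<alpha>_def)
  next
    case False
    have "y = (1 / \<alpha>) *s ((k - 1) *s x + (k * u s' - u s) *s p + (k * w s' - w s) *s p')"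
      by (rule smult_cancel[OF False eq])
    then have "y = ((k - 1) / \<alpha>) *s x + ((k * u s' - u s) / \<alpha>) *s p + ((k * w s' - w s) / \<alpha>) *s p'"
      by (simp only: vector_add_ldistrib vector_smult_assoc times_divide_eq_left mult_1_left)
    from sing_same_projection(1)[OF x y(1) l_neq_0_off_line[OF y(2)] this] ne(1) show False by blast
  qed
qed

end

section \<open>Pencils of conics through two conjugate pairs of points\<close>

lemma binary_quartic_zero:
  fixes a b c d e :: real
  assumes "\<And>x y. a * x ^ 4 + b * x ^ 3 * y + c * x\<^sup>2 * y\<^sup>2 + d * x * y ^ 3 + e * y ^ 4 = 0"
  shows "a = 0 \<and> b = 0 \<and> c = 0 \<and> d = 0 \<and> e = 0"
  using assms[of 1 0] assms[of 0 1] assms[of 1 1] assms[of 1 "-1"] assms[of 2 1] by simp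

lemma binary_quadratic_product:
  fixes a b c a' b' c' A B C D E :: real
  assumes "\<And>x y. (a * x\<^sup>2 + b * x * y + c * y\<^sup>2) * (a' * x\<^sup>2 + b' * x * y + c' * y\<^sup>2) =
    A * x ^ 4 + B * x ^ 3 * y + C * x\<^sup>2 * y\<^sup>2 + D * x * y ^ 3 + E * y ^ 4"
  shows "a * a' = A" "a * b' + b * a' = B" "a * c' + b * b' + c * a' = C" "b * c' + c * b' = D" "c * c' = E"
proof -
  have "(a * a' - A) * x ^ 4 + (a * b' + b * a' - B) * x ^ 3 * y + (a * c' + b * b' + c * a' - C) * x\<^sup>2 * y\<^sup>2
      + (b * c' + c * b' - D) * x * y ^ 3 + (c * c' - E) * y ^ 4 = 0" for x y
    using assms[of x y] by algebra
  from binary_quartic_zero[OF this]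
  show "a * a' = A" "a * b' + b * a' = B" "a * c' + b * b' + c * a' = C" "b * c' + c * b' = D" "c * c' = E"
    by simp_all
qed

definition proportional3 :: "real \<Rightarrow> real \<Rightarrow> real \<Rightarrow> real \<Rightarrow> real \<Rightarrow> real \<Rightarrow> bool"
  where "proportional3 a b c a' b' c' \<longleftrightarrow>
    (\<exists>u v. (u, v) \<noteq> (0, 0) \<and> u * a + v * a' = 0 \<and> u * b + v * b' = 0 \<and> u * c + v * c' = 0)"

lemma proportional3_minors:
  assumes "a * b' = b * a'" "a * c' = c * a'" "b * c' = c * b'"
  shows "proportional3 a b c a' b' c'"
proof (cases "a' = 0 \<and> b' = 0 \<and> c' = 0")
  case True then show ?thesis unfolding proportional3_def by (intro exI[of _ 0] exI[of _ 1]) simp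
next
  case False
  then consider "a' \<noteq> 0" | "b' \<noteq> 0" | "c' \<noteq> 0" by blast
  then show ?thesis
  proof cases
    case 1 then show ?thesis unfolding proportional3_def
      using assms by (intro exI[of _ a'] exI[of _ "- a"]) (simp add: mult.commute)
  next
    case 2 then show ?thesis unfolding proportional3_def
      using assms by (intro exI[of _ b'] exI[of _ "- b"]) (simp add: mult.commute)
  next
    case 3 then show ?thesis unfolding proportional3_def
      using assms by (intro exI[of _ c'] exI[of _ "- c"]) (simp add: mult.commute)
  qed
qed

lemma proportional3_commute: "proportional3 a b c a' b' c' \<longleftrightarrow> proportional3 a' b' c' a b c"
  unfolding proportional3_def by (metis (no_types, opaque_lifting) add.commute prod.inject)

text \<open>The hypotheses describe a product equal to K x^4. If K is nonzero both factors are
  multiples of x^2, and if K = 0 one of them is zero.\<close>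

lemma product_fourth_power:
  fixes a b c a' b' c' K :: real
  assumes "a * a' = K" "a * b' + b * a' = 0" "a * c' + b * b' + c * a' = 0" "b * c' + c * b' = 0" "c * c' = 0"
  shows "proportional3 a b c a' b' c'"
proof -
  have *: "proportional3 a b c a' b' c'"
    if "a * b' + b * a' = 0" "a * c' + b * b' + c * a' = 0" "b * c' + c * b' = 0" "c = 0" for a b c a' b' c' :: real
  proof (cases "b = 0")
    case True
    then have "a = 0 \<or> c' = 0" "a = 0 \<or> b' = 0" using that by auto
    then show ?thesis using True that(4) by (intro proportional3_minors) auto
  next
    case False
    then have "c' = 0" "b' = 0" "a' = 0" using that by auto
    then show ?thesis by (intro proportional3_minors) auto
  qed
  have "c = 0 \<or> c' = 0" using assms(5) by simp
  then show ?thesis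
  proof
    assume "c = 0"
    then show ?thesis using assms by (intro *)
  next
    assume "c' = 0"
    then have "proportional3 a' b' c' a b c" using assms by (intro *) (simp_all add: algebra_simps)
    then show ?thesis by (rule proportional3_commute[THEN iffD1])
  qed
qed

lemma real_quadratic_nonreal_root:
  fixes a b c m n :: real and z :: complex
  assumes "Im z \<noteq> 0" "z\<^sup>2 + m * z + n = 0" "a * z\<^sup>2 + b * z + c = 0"
  shows "b = a * m" "c = a * n"
proof -
  have "(b - a * m) * z + (c - a * n) = 0"
    using assms(2,3) by (simp add: algebra_simps) algebra
  then have "of_real (b - a * m) * z + of_real (c - a * n) = 0" by simp
  then have "Im (of_real (b - a * m) * z + of_real (c - a * n)) = 0" "Re (of_real (b - a * m) * z + of_real (c - a * n)) = 0"
    by simp_all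
  then show "b = a * m" "c = a * n" using assms(1) by auto
qed

text \<open>The product is K times the square of x^2 + m x y + n y^2, which is irreducible over
  \<real>. One factor vanishes at the nonreal root, so it is a multiple of this form, and then so is
  the other.\<close>

lemma product_definite_square:
  fixes a b c a' b' c' K m n :: real and z :: complex
  assumes z: "Im z \<noteq> 0" "z\<^sup>2 + m * z + n = 0" and K: "K \<noteq> 0"
    and eq: "a * a' = K" "a * b' + b * a' = K * (2 * m)" "a * c' + b * b' + c * a' = K * (m\<^sup>2 + 2 * n)"
      "b * c' + c * b' = K * (2 * m * n)" "c * c' = K * n\<^sup>2"
  shows "proportional3 a b c a' b' c'"
proof -
  have n: "n \<noteq> 0"
  proof
    assume "n = 0"
    then have "z * (z + m) = 0" using z(2) by (simp add: power2_eq_square algebra_simps)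
    then have "z = 0 \<or> z = - of_real m" by (simp add: add_eq_0_iff2)
    then show False using z(1) by auto
  qed
  have "(a * z\<^sup>2 + b * z + c) * (a' * z\<^sup>2 + b' * z + c') =
      (a * a') * z ^ 4 + (a * b' + b * a') * z ^ 3 + (a * c' + b * b' + c * a') * z\<^sup>2 + (b * c' + c * b') * z + c * c'"
    by simp algebra
  also have "\<dots> = K * (z\<^sup>2 + m * z + n)\<^sup>2"
    unfolding eq by simp algebra
  finally have "(a * z\<^sup>2 + b * z + c) * (a' * z\<^sup>2 + b' * z + c') = K * (z\<^sup>2 + m * z + n)\<^sup>2" .
  then have "a * z\<^sup>2 + b * z + c = 0 \<or> a' * z\<^sup>2 + b' * z + c' = 0" using z(2) by simp
  moreover have *: "proportional3 a b c a' b' c'" if "a * z\<^sup>2 + b * z + c = 0" "a * a' = K"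
    "a * b' + b * a' = K * (2 * m)" "c * c' = K * n\<^sup>2" for a b c a' b' c' :: real
  proof -
    note r = real_quadratic_nonreal_root[OF z that(1)]
    have a: "a \<noteq> 0" using that(2) K by auto
    have "a * (b' - a' * m) = 0" using that(3) unfolding that(2)[symmetric] r by (simp add: algebra_simps)
    moreover have "a * n * (c' - a' * n) = 0"
      using that(4) unfolding that(2)[symmetric] r by (simp add: algebra_simps power2_eq_square)
    ultimately have "b' = a' * m" "c' = a' * n" using a n by auto
    then show ?thesis using r by (intro proportional3_minors) (simp_all add: mult_ac)
  qed
  ultimately show ?thesis
    using *[of a b c a' b' c', OF _ eq(1,2,5)] *[of a' b' c' a b c] eq(1,2,5) proportional3_commute[of a b c a' b' c']
    by (metis add.commute mult.commute)
qed

definition binary_norm :: "complex \<Rightarrow> complex \<Rightarrow> complex \<Rightarrow> real \<Rightarrow> real \<Rightarrow> real"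
  where "binary_norm G11 G12 G22 x y =
    (cmod (G11 * (of_real x)\<^sup>2 + 2 * G12 * of_real x * of_real y + G22 * (of_real y)\<^sup>2))\<^sup>2"

lemma binary_norm_nonneg: "0 \<le> binary_norm G11 G12 G22 x y"
  by (simp add: binary_norm_def)

text \<open>The condition on \<open>G\<close> says that the complex form is a square up to a
  constant. Its double root is at infinity, real or nonreal; the norm is accordingly a constant
  times the fourth power of a real linear form or the square of a definite form.\<close>

lemma norm_of_square_split:
  fixes G11 G12 G22 :: complex and a b c a' b' c' :: real
  assumes G: "G12\<^sup>2 = G11 * G22"
    and eq: "\<And>(x :: real) y :: real. binary_norm G11 G12 G22 x y =
      (a * x\<^sup>2 + b * x * y + c * y\<^sup>2) * (a' * x\<^sup>2 + b' * x * y + c' * y\<^sup>2)"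
  shows "proportional3 a b c a' b' c'"
proof (cases "G11 = 0")
  case True
  then have "G12 = 0" using G by simp
  define K where "K = (cmod G22)\<^sup>2"
  have "(a * x\<^sup>2 + b * x * y + c * y\<^sup>2) * (a' * x\<^sup>2 + b' * x * y + c' * y\<^sup>2) =
      0 * x ^ 4 + 0 * x ^ 3 * y + 0 * x\<^sup>2 * y\<^sup>2 + 0 * x * y ^ 3 + K * y ^ 4" for x y
    using eq[of x y] True \<open>G12 = 0\<close> by (simp add: K_def binary_norm_def norm_mult norm_power power_mult_distrib)
  note p = binary_quadratic_product[OF this]
  have "proportional3 c b a c' b' a'"
    by (rule product_fourth_power[of _ _ K]) (use p in \<open>simp_all add: algebra_simps\<close>)
  then show ?thesis unfolding proportional3_def by blast
next
  case False
  define z where "z = - (G12 / G11)"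
  define K where "K = (cmod G11)\<^sup>2"
  have K: "K \<noteq> 0" using False by (simp add: K_def)
  have N: "binary_norm G11 G12 G22 x y = K * ((x - Re z * y)\<^sup>2 + (Im z * y)\<^sup>2)\<^sup>2" for x y :: real
  proof -
    have "G22 = G12\<^sup>2 / G11" using False G by (simp add: field_simps)
    then have "G11 * (of_real x)\<^sup>2 + 2 * G12 * of_real x * of_real y + G22 * (of_real y)\<^sup>2 = G11 * (x - z * y)\<^sup>2"
      using False by (simp add: z_def power2_eq_square field_simps)
    then have "binary_norm G11 G12 G22 x y = K * ((cmod (x - z * y))\<^sup>2)\<^sup>2"
      by (simp add: K_def binary_norm_def norm_mult norm_power power_mult_distrib)
    also have "(cmod (x - z * y))\<^sup>2 = (x - Re z * y)\<^sup>2 + (Im z * y)\<^sup>2"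
      by (simp add: cmod_power2)
    finally show ?thesis .
  qed
  show ?thesis
  proof (cases "Im z = 0")
    case True
    \<comment> \<open>Translating the real double root to 0 turns the product into K x^4.\<close>
    define s where "s = Re z"
    have "(a * x\<^sup>2 + (b + 2 * a * s) * x * y + (a * s\<^sup>2 + b * s + c) * y\<^sup>2) *
        (a' * x\<^sup>2 + (b' + 2 * a' * s) * x * y + (a' * s\<^sup>2 + b' * s + c') * y\<^sup>2) =
        K * x ^ 4 + 0 * x ^ 3 * y + 0 * x\<^sup>2 * y\<^sup>2 + 0 * x * y ^ 3 + 0 * y ^ 4" for x y
    proof -
      have "((x + s * y - Re z * y)\<^sup>2 + (Im z * y)\<^sup>2)\<^sup>2 = x ^ 4"
        using True by (simp add: s_def flip: power_mult)
      moreover have "a * (x + s * y)\<^sup>2 + b * (x + s * y) * y + c * y\<^sup>2 =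
          a * x\<^sup>2 + (b + 2 * a * s) * x * y + (a * s\<^sup>2 + b * s + c) * y\<^sup>2" for a b c
        by algebra
      ultimately show ?thesis using eq[of "x + s * y" y] N[of "x + s * y" y]
        by simp
    qed
    note p = binary_quadratic_product[OF this]
    have "proportional3 a (b + 2 * a * s) (a * s\<^sup>2 + b * s + c) a' (b' + 2 * a' * s) (a' * s\<^sup>2 + b' * s + c')"
      by (rule product_fourth_power[OF p])
    then obtain u v where uv: "(u, v) \<noteq> (0, 0)" "u * a + v * a' = 0" "u * (b + 2 * a * s) + v * (b' + 2 * a' * s) = 0"
      "u * (a * s\<^sup>2 + b * s + c) + v * (a' * s\<^sup>2 + b' * s + c') = 0"
      unfolding proportional3_def by blast
    have "u * b + v * b' = 0" using uv(2,3) by algebra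
    moreover from this have "u * c + v * c' = 0" using uv(2,4) by algebra
    ultimately show ?thesis using uv(1,2) unfolding proportional3_def by blast
  next
    case im: False
    define m where "m = - 2 * Re z"
    define n where "n = (Re z)\<^sup>2 + (Im z)\<^sup>2"
    have root: "z\<^sup>2 + m * z + n = 0"
      by (simp add: complex_eq_iff m_def n_def power2_eq_square algebra_simps)
    have "(a * x\<^sup>2 + b * x * y + c * y\<^sup>2) * (a' * x\<^sup>2 + b' * x * y + c' * y\<^sup>2) =
        K * x ^ 4 + (K * (2 * m)) * x ^ 3 * y + (K * (m\<^sup>2 + 2 * n)) * x\<^sup>2 * y\<^sup>2 + (K * (2 * m * n)) * x * y ^ 3 + (K * n\<^sup>2) * y ^ 4" for x y
    proof -
      have "(x - Re z * y)\<^sup>2 + (Im z * y)\<^sup>2 = x\<^sup>2 + m * x * y + n * y\<^sup>2"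
        by (simp add: m_def n_def power2_eq_square algebra_simps)
      then have "(a * x\<^sup>2 + b * x * y + c * y\<^sup>2) * (a' * x\<^sup>2 + b' * x * y + c' * y\<^sup>2) = K * (x\<^sup>2 + m * x * y + n * y\<^sup>2)\<^sup>2"
        using eq[of x y] N[of x y] by simp
      then show ?thesis by algebra
    qed
    from product_definite_square[OF im root K binary_quadratic_product[OF this]] show ?thesis .
  qed
qed

section \<open>The pencil of conics restricted to a real line\<close>

text \<open>A real basis spans the plane over \<complex> as well. Real points carry the norm
  identity, whereas the kernel vector of the Hessian is complex.\<close>

lemma line_kernel:
  fixes l0 l1 l2 :: real
  assumes "l0 \<noteq> 0 \<or> l1 \<noteq> 0"
  obtains r1 s1 t1 r2 s2 t2 :: real where "l0 * r1 + l1 * s1 + l2 * t1 = 0" "l0 * r2 + l1 * s2 + l2 * t2 = 0"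
    "\<And>(r :: complex) (s :: complex) t :: complex. l0 * r + l1 * s + l2 * t = 0 \<Longrightarrow>
      \<exists>x y :: complex. r = x * of_real r1 + y * of_real r2 \<and> s = x * of_real s1 + y * of_real s2 \<and>
        t = x * of_real t1 + y * of_real t2"
proof (cases "l0 = 0")
  case False
  show ?thesis
  proof (rule that[of "- l1 / l0" 1 0 "- l2 / l0" 0 1], goal_cases)
    case (3 r s t)
    then have "l0 * r = - (l1 * s + l2 * t)" by (simp add: add_eq_0_iff2 add.assoc)
    then have "r = s * of_real (- l1 / l0) + t * of_real (- l2 / l0)"
      using False by (simp add: field_simps)
    then show ?case by (intro exI[of _ s] exI[of _ t]) simp
  qed (use False in \<open>simp_all add: field_simps\<close>)
next
  case True
  then have l1: "l1 \<noteq> 0" using assms by simp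
  show ?thesis
  proof (rule that[of 1 0 0 0 "- l2 / l1" 1], goal_cases)
    case (3 r s t)
    then have "l1 * s = - (l2 * t)" using True by (simp add: add_eq_0_iff2)
    then have "s = t * of_real (- l2 / l1)" using l1 by (simp add: field_simps)
    then show ?case by (intro exI[of _ r] exI[of _ t]) simp
  qed (use True l1 in \<open>simp_all add: field_simps\<close>)
qed

text \<open>The conics \<open>u s t + v (r\<^sup>2 + s\<^sup>2 + t\<^sup>2) = 0\<close> are those through \<open>(\<plusminus> i, 0, 1)\<close> and \<open>(\<plusminus> i, 1, 0)\<close>.
  The line \<open>l = 0\<close> contains none of these points.\<close>

lemma pencil_on_line:
  fixes l0 l1 l2 u v :: real
  assumes l: "l0 \<noteq> 0 \<or> l1 \<noteq> 0" "l0 \<noteq> 0 \<or> l2 \<noteq> 0"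
    and zero: "\<And>r s t. l0 * r + l1 * s + l2 * t = 0 \<Longrightarrow> u * (s * t) + v * (r\<^sup>2 + s\<^sup>2 + t\<^sup>2) = 0"
  shows "u = 0" "v = 0"
proof -
  have "l2\<^sup>2 + l0\<^sup>2 \<noteq> 0" using l(2) by (auto simp: sum_power2_eq_zero_iff)
  \<comment> \<open>At the point (-l2, 0, l0) of the line, s t vanishes while the sum of squares
    does not.\<close>
  then show v: "v = 0" using zero[of "- l2" 0 l0] by auto
  show "u = 0"
  proof (cases "l0 = 0")
    case False
    then show ?thesis using zero[of "- (l1 + l2)" l0 l0] v by (auto simp: algebra_simps)
  next
    case True
    then show ?thesis using zero[of 0 "- l2" l1] v l by auto
  qed
qed

lemma pencil_form_definite:
  fixes l0 l1 l2 r1 s1 t1 r2 s2 t2 \<alpha> \<beta> \<gamma> :: real and G11 G12 G22 :: complex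
  assumes l: "l0 \<noteq> 0 \<or> l1 \<noteq> 0" "l0 \<noteq> 0 \<or> l2 \<noteq> 0"
    and w: "l0 * r1 + l1 * s1 + l2 * t1 = 0" "l0 * r2 + l1 * s2 + l2 * t2 = 0"
      "\<And>(r :: real) (s :: real) t :: real. l0 * r + l1 * s + l2 * t = 0 \<Longrightarrow>
        \<exists>x y. r = x * r1 + y * r2 \<and> s = x * s1 + y * s2 \<and> t = x * t1 + y * t2"
    and G: "G12\<^sup>2 = G11 * G22"
    and eq: "\<And>(x :: real) (y :: real) r s t. r = x * r1 + y * r2 \<Longrightarrow> s = x * s1 + y * s2 \<Longrightarrow> t = x * t1 + y * t2 \<Longrightarrow>
      binary_norm G11 G12 G22 x y =
      \<alpha> * (s * t)\<^sup>2 + \<beta> * (s * t) * (r\<^sup>2 + s\<^sup>2 + t\<^sup>2) + \<gamma> * (r\<^sup>2 + s\<^sup>2 + t\<^sup>2)\<^sup>2"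
    and nonsquare: "\<And>\<kappa> u v. (u, v) \<noteq> (0, 0) \<Longrightarrow> \<not> (\<alpha> = \<kappa> * u\<^sup>2 \<and> \<beta> = \<kappa> * (2 * u * v) \<and> \<gamma> = \<kappa> * v\<^sup>2)"
  shows "0 < \<gamma>" "\<beta>\<^sup>2 < 4 * \<alpha> * \<gamma>"
proof -
  show disc: "\<beta>\<^sup>2 < 4 * \<alpha> * \<gamma>"
  proof (rule ccontr)
    assume "\<not> \<beta>\<^sup>2 < 4 * \<alpha> * \<gamma>"
    then have d: "\<beta>\<^sup>2 - 4 * \<alpha> * \<gamma> \<ge> 0" by simp
    \<comment> \<open>A nonnegative discriminant splits the quadratic form in s t and r^2 + s^2 +
      t^2 into two real linear factors.\<close>
    obtain u v u' v' where f: "\<alpha> = u * u'" "\<beta> = u * v' + v * u'" "\<gamma> = v * v'"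
    proof (cases "\<gamma> = 0")
      case True
      then show ?thesis using that[of 1 \<alpha> \<beta> 0] by simp
    next
      case False
      define e where "e = sqrt (\<beta>\<^sup>2 - 4 * \<alpha> * \<gamma>)"
      have e: "e\<^sup>2 = \<beta>\<^sup>2 - 4 * \<alpha> * \<gamma>" using d by (simp add: e_def)
      have "\<alpha> = (\<beta> + e) / 2 * ((\<beta> - e) / (2 * \<gamma>))"
        using False e by (simp add: field_simps power2_eq_square)
      moreover have "\<beta> = (\<beta> + e) / 2 * 1 + \<gamma> * ((\<beta> - e) / (2 * \<gamma>))" using False by (simp add: field_simps)
      ultimately show ?thesis using that[of "(\<beta> + e) / 2" "(\<beta> - e) / (2 * \<gamma>)" 1 \<gamma>] by (simp add: mult_ac)
    qed
    have indep: "u * v' \<noteq> v * u'"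
    proof
      assume dep: "u * v' = v * u'"
      consider "u \<noteq> 0" | "u = 0" "v \<noteq> 0" | "u = 0" "v = 0" by blast
      then show False
      proof cases
        case 1
        then show False using nonsquare[of u v "u' / u"] f dep by (simp add: field_simps power2_eq_square)
      next
        case 2
        then show False using nonsquare[of u v "v' / v"] f dep by (simp add: field_simps power2_eq_square)
      next
        case 3
        then show False using nonsquare[of 1 0 0] f by simp
      qed
    qed
    define qa where "qa u v = u * (s1 * t1) + v * (r1\<^sup>2 + s1\<^sup>2 + t1\<^sup>2)" for u v
    define qb where "qb u v = u * (s1 * t2 + s2 * t1) + v * (2 * (r1 * r2 + s1 * s2 + t1 * t2))" for u v
    define qc where "qc u v = u * (s2 * t2) + v * (r2\<^sup>2 + s2\<^sup>2 + t2\<^sup>2)" for u v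
    have q: "qa u v * x\<^sup>2 + qb u v * x * y + qc u v * y\<^sup>2 =
        u * ((x * s1 + y * s2) * (x * t1 + y * t2)) + v * ((x * r1 + y * r2)\<^sup>2 + (x * s1 + y * s2)\<^sup>2 + (x * t1 + y * t2)\<^sup>2)" for u v x y
      unfolding qa_def qb_def qc_def by algebra
    have "binary_norm G11 G12 G22 x y =
        (qa u v * x\<^sup>2 + qb u v * x * y + qc u v * y\<^sup>2) * (qa u' v' * x\<^sup>2 + qb u' v' * x * y + qc u' v' * y\<^sup>2)" for x y :: real
      unfolding q eq[OF refl refl refl] f by algebra
    from norm_of_square_split[OF G this] obtain x y where xy: "(x, y) \<noteq> (0, 0)"
      "x * qa u v + y * qa u' v' = 0" "x * qb u v + y * qb u' v' = 0" "x * qc u v + y * qc u' v' = 0"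
      unfolding proportional3_def by blast
    have zero: "(x * u + y * u') * (s * t) + (x * v + y * v') * (r\<^sup>2 + s\<^sup>2 + t\<^sup>2) = 0" if rst: "l0 * r + l1 * s + l2 * t = 0" for r s t
    proof -
      obtain a b where ab: "r = a * r1 + b * r2" "s = a * s1 + b * s2" "t = a * t1 + b * t2" using w(3)[OF rst] by blast
      have "(x * u + y * u') * (s * t) + (x * v + y * v') * (r\<^sup>2 + s\<^sup>2 + t\<^sup>2) =
          x * (qa u v * a\<^sup>2 + qb u v * a * b + qc u v * b\<^sup>2) + y * (qa u' v' * a\<^sup>2 + qb u' v' * a * b + qc u' v' * b\<^sup>2)"
        unfolding q ab by algebra
      also have "\<dots> = 0" using xy(2-4) by algebra
      finally show ?thesis .
    qed
    have "x * u + y * u' = 0" "x * v + y * v' = 0" using pencil_on_line[OF l zero] by simp_all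
    then have "x * (u * v' - v * u') = 0" "y * (u * v' - v * u') = 0" by algebra+
    with indep xy(1) show False by auto
  qed
  \<comment> \<open>At this point of the line s t = 0, so only the \<open>\<gamma>\<close> term is
    left, and the norm shows that it is nonnegative.\<close>
  obtain x y where xy: "- l2 = x * r1 + y * r2" "0 = x * s1 + y * s2" "l0 = x * t1 + y * t2"
    using w(3)[of "- l2" 0 l0] by auto
  have "\<gamma> * (l2\<^sup>2 + l0\<^sup>2)\<^sup>2 \<ge> 0"
    using eq[OF xy] binary_norm_nonneg[of G11 G12 G22 x y] by simp
  moreover have "l2\<^sup>2 + l0\<^sup>2 \<noteq> 0" using l(2) by (auto simp: sum_power2_eq_zero_iff)
  ultimately have "\<gamma> \<ge> 0" by (metis mult_neg_pos not_le zero_less_power2)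
  moreover have "\<gamma> \<noteq> 0" using disc by auto
  ultimately show "0 < \<gamma>" by simp
qed

text \<open>Supplies a point of a double conic that is off the line, so that it lifts to a singular
  point of the cubic, and is none of the four base points.\<close>

lemma pencil_point:
  fixes l0 l1 l2 u v :: real
  assumes l: "l0 \<noteq> 0 \<or> l1 \<noteq> 0" and uv: "(u, v) \<noteq> (0, 0)"
  obtains r s t :: complex where "u * (s * t) + v * (r\<^sup>2 + s\<^sup>2 + t\<^sup>2) = 0" "l0 * r + l1 * s + l2 * t \<noteq> 0"
    "s * t \<noteq> 0 \<or> r\<^sup>2 + s\<^sup>2 + t\<^sup>2 \<noteq> 0"
proof (cases "v = 0")
  case True
  \<comment> \<open>The candidates on s t = 0 are (1, 1, 0) and (2, 1, 0).\<close>
  have "(of_real l0 + of_real l1 :: complex) \<noteq> 0 \<or> (of_real l0 * 2 + of_real l1 :: complex) \<noteq> 0"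
  proof (rule ccontr)
    assume "\<not> ?thesis"
    then have "of_real (l0 + l1) = (0 :: complex)" "of_real (l0 * 2 + l1) = (0 :: complex)" by simp_all
    then have "l0 + l1 = 0" "l0 * 2 + l1 = 0" by (simp_all only: of_real_eq_0_iff)
    with l show False by auto
  qed
  then show ?thesis using that[of 1 0 1] that[of 1 0 2] True by auto
next
  case False
  note goal = that
  \<comment> \<open>With s = 1 and t = 1 or 2, both square roots r give points of the conic. If they
    all lay on the line, then l1 = l2 = 0 and every r = 0, which forces
    \<open>v = 0\<close>.\<close>
  have main: thesis if t: "t = 1 \<or> t = 2" and ne: "\<And>r :: complex. v * r\<^sup>2 = - (u * t + v * (1 + t\<^sup>2)) \<Longrightarrow>
      of_real l0 * r \<noteq> 0 \<or> l1 + l2 * t \<noteq> 0" for t :: real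
  proof -
    define r where "r = csqrt (of_real (- (u * t + v * (1 + t\<^sup>2)) / v))"
    have r: "v * r\<^sup>2 = - (u * t + v * (1 + t\<^sup>2))" using False by (simp add: r_def)
    have "of_real l0 * r \<noteq> 0 \<or> of_real (l1 + l2 * t) \<noteq> (0 :: complex)"
      using ne[OF r] by (simp only: of_real_eq_0_iff)
    have "l0 * r + of_real (l1 + l2 * t) \<noteq> 0 \<or> l0 * (- r) + of_real (l1 + l2 * t) \<noteq> 0"
    proof (rule ccontr)
      assume "\<not> ?thesis"
      then have z: "l0 * r + of_real (l1 + l2 * t) = 0" "l0 * (- r) + of_real (l1 + l2 * t) = 0" by blast+
      have "2 * (of_real l0 * r) = (0 :: complex)" "2 * of_real (l1 + l2 * t) = (0 :: complex)" using z by algebra+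
      then have "of_real l0 * r = (0 :: complex)" "of_real (l1 + l2 * t) = (0 :: complex)"
        by (metis mult_eq_0_iff zero_neq_numeral)+
      with \<open>of_real l0 * r \<noteq> 0 \<or> of_real (l1 + l2 * t) \<noteq> (0 :: complex)\<close> show False by blast
    qed
    then consider "l0 * r + of_real (l1 + l2 * t) \<noteq> 0" | "l0 * (- r) + of_real (l1 + l2 * t) \<noteq> 0" by blast
    then show thesis
    proof cases
      case 1
      then show thesis
        by (intro goal[of 1 "of_real t" r]) (use t r in \<open>auto simp: algebra_simps\<close>)
    next
      case 2
      then show thesis
        by (intro goal[of 1 "of_real t" "- r"]) (use t r in \<open>auto simp: algebra_simps\<close>)
    qed
  qed
  show ?thesis
  proof (rule ccontr)
    assume no: "\<not> thesis"
    then obtain r1 :: complex where r1: "v * r1\<^sup>2 = of_real (- (u * 1 + v * (1 + 1\<^sup>2)))" "of_real l0 * r1 = 0" "l1 + l2 * 1 = 0"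
      using main[of 1] by blast
    from no obtain r2 :: complex where r2: "v * r2\<^sup>2 = of_real (- (u * 2 + v * (1 + 2\<^sup>2)))" "of_real l0 * r2 = 0" "l1 + l2 * 2 = 0"
      using main[of 2] by blast
    have "l1 = 0" "l2 = 0" using r1(3) r2(3) by simp_all
    with l have "l0 \<noteq> 0" by simp
    then have "r1 = 0" "r2 = 0" using r1(2) r2(2) by simp_all
    then have "of_real (u + 2 * v) = (0 :: complex)" "of_real (2 * u + 5 * v) = (0 :: complex)"
      using r1(1) r2(1) by (simp_all add: algebra_simps add_eq_0_iff2)
    then have "u + 2 * v = 0" "2 * u + 5 * v = 0" by (simp_all only: of_real_eq_0_iff)
    then have "v = 0" by simp
    with False show False ..
  qed
qed

section \<open>Conjugate coordinates\<close>

text \<open>The coefficients are real and the arguments lie in any real field, so one list describes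
  the form at real and at complex points.\<close>

definition lin :: "(nat \<Rightarrow> real) \<Rightarrow> 'a::real_field \<Rightarrow> 'a \<Rightarrow> 'a \<Rightarrow> 'a"
  where "lin l r s t = of_real (l 0) * r + of_real (l 1) * s + of_real (l 2) * t"

definition quad :: "(nat \<Rightarrow> real) \<Rightarrow> 'a::real_field \<Rightarrow> 'a \<Rightarrow> 'a \<Rightarrow> 'a"
  where "quad a r s t = of_real (a 0) * (r ^ 2) + of_real (a 1) * (s ^ 2) + of_real (a 2) * (t ^ 2) +
    of_real (a 3) * (r * s) + of_real (a 4) * (r * t) + of_real (a 5) * (s * t)"

definition cub :: "(nat \<Rightarrow> real) \<Rightarrow> 'a::real_field \<Rightarrow> 'a \<Rightarrow> 'a \<Rightarrow> 'a"
  where "cub c r s t = of_real (c 0) * (r ^ 3) + of_real (c 1) * (s ^ 3) + of_real (c 2) * (t ^ 3) +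
    of_real (c 3) * (r ^ 2 * s) + of_real (c 4) * (r ^ 2 * t) + of_real (c 5) * (r * s ^ 2) +
    of_real (c 6) * (s ^ 2 * t) + of_real (c 7) * (r * t ^ 2) + of_real (c 8) * (s * t ^ 2) +
    of_real (c 9) * (r * s * t)"

definition quartic :: "(nat \<Rightarrow> real) \<Rightarrow> 'a::real_field \<Rightarrow> 'a \<Rightarrow> 'a \<Rightarrow> 'a"
  where "quartic d r s t = of_real (d 0) * (r ^ 4) + of_real (d 1) * (r ^ 3 * s) + of_real (d 2) * (r ^ 3 * t) +
    of_real (d 3) * (r ^ 2 * s ^ 2) + of_real (d 4) * (r ^ 2 * s * t) + of_real (d 5) * (r ^ 2 * t ^ 2) +
    of_real (d 6) * (r * s ^ 3) + of_real (d 7) * (r * s ^ 2 * t) + of_real (d 8) * (r * s * t ^ 2) +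
    of_real (d 9) * (r * t ^ 3) + of_real (d 10) * (s ^ 4) + of_real (d 11) * (s ^ 3 * t) +
    of_real (d 12) * (s ^ 2 * t ^ 2) + of_real (d 13) * (s * t ^ 3) + of_real (d 14) * (t ^ 4)"

text \<open>The coefficients of |g|^2 - l C with g = a + i b, in the order of the monomials of
  \<open>quartic\<close>.\<close>

definition discriminant :: "(nat \<Rightarrow> real) \<Rightarrow> (nat \<Rightarrow> real) \<Rightarrow> (nat \<Rightarrow> real) \<Rightarrow> (nat \<Rightarrow> real) \<Rightarrow> nat \<Rightarrow> real"
  where "discriminant l a b c = (!)
   [a 0 * a 0 + b 0 * b 0 - l 0 * c 0,
    2 * (a 0 * a 3) + 2 * (b 0 * b 3) - l 0 * c 3 - l 1 * c 0,
    2 * (a 0 * a 4) + 2 * (b 0 * b 4) - l 0 * c 4 - l 2 * c 0,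
    2 * (a 0 * a 1) + a 3 * a 3 + 2 * (b 0 * b 1) + b 3 * b 3 - l 0 * c 5 - l 1 * c 3,
    2 * (a 0 * a 5) + 2 * (a 3 * a 4) + 2 * (b 0 * b 5) + 2 * (b 3 * b 4) - l 0 * c 9 - l 1 * c 4 - l 2 * c 3,
    2 * (a 0 * a 2) + a 4 * a 4 + 2 * (b 0 * b 2) + b 4 * b 4 - l 0 * c 7 - l 2 * c 4,
    2 * (a 1 * a 3) + 2 * (b 1 * b 3) - l 0 * c 1 - l 1 * c 5,
    2 * (a 1 * a 4) + 2 * (a 3 * a 5) + 2 * (b 1 * b 4) + 2 * (b 3 * b 5) - l 0 * c 6 - l 1 * c 9 - l 2 * c 5,
    2 * (a 2 * a 3) + 2 * (a 4 * a 5) + 2 * (b 2 * b 3) + 2 * (b 4 * b 5) - l 0 * c 8 - l 1 * c 7 - l 2 * c 9,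
    2 * (a 2 * a 4) + 2 * (b 2 * b 4) - l 0 * c 2 - l 2 * c 7,
    a 1 * a 1 + b 1 * b 1 - l 1 * c 1,
    2 * (a 1 * a 5) + 2 * (b 1 * b 5) - l 1 * c 6 - l 2 * c 1,
    2 * (a 1 * a 2) + a 5 * a 5 + 2 * (b 1 * b 2) + b 5 * b 5 - l 1 * c 8 - l 2 * c 6,
    2 * (a 2 * a 5) + 2 * (b 2 * b 5) - l 1 * c 2 - l 2 * c 8,
    a 2 * a 2 + b 2 * b 2 - l 2 * c 2]"

lemma quartic_discriminant:
  "quartic (discriminant l a b c) r s t = (quad a r s t)\<^sup>2 + (quad b r s t)\<^sup>2 - lin l r s t * cub c r s t"
  unfolding quartic_def discriminant_def quad_def lin_def cub_def
  by (simp add: power2_eq_square power3_eq_cube power4_eq_xxxx algebra_simps)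

text \<open>Three derivatives at each of two complex points give twelve real linear equations for
  the fifteen coefficients; d 0, d 4 and d 12 remain free. The conjugate nodes impose nothing new.
  The subtracted \<open>2 * d 0\<close> is the s^2 t^2 term of the squared sum of squares.\<close>

lemma nodal_quartic_in_pencil:
  assumes P: "\<And>a b e. ((\<lambda>z. quartic d (\<i> + z * a) (z * b) (1 + z * e)) has_field_derivative 0) (at 0)"
    and Q: "\<And>a b e. ((\<lambda>z. quartic d (\<i> + z * a) (1 + z * b) (z * e)) has_field_derivative 0) (at 0)"
  shows "quartic d r s t = of_real (d 12 - 2 * d 0) * (s * t)\<^sup>2 + of_real (d 4) * (s * t) * (r\<^sup>2 + s\<^sup>2 + t\<^sup>2) +
    of_real (d 0) * (r\<^sup>2 + s\<^sup>2 + t\<^sup>2)\<^sup>2"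
proof -
  have i3: "\<i> ^ 3 = - \<i>" by (simp add: power3_eq_cube)
  have "((\<lambda>z. quartic d (\<i> + z * 1) (z * 0) (1 + z * 0)) has_field_derivative
      - 4 * \<i> * d 0 - 3 * d 2 + 2 * \<i> * d 5 + d 9) (at 0)"
    unfolding quartic_def by (auto intro!: derivative_eq_intros simp: i3 algebra_simps)
  from DERIV_unique[OF this P] have 1: "- 4 * \<i> * d 0 - 3 * d 2 + 2 * \<i> * d 5 + d 9 = 0" .
  have "((\<lambda>z. quartic d (\<i> + z * 0) (z * 1) (1 + z * 0)) has_field_derivative
      - \<i> * d 1 - d 4 + \<i> * d 8 + d 13) (at 0)"
    unfolding quartic_def by (auto intro!: derivative_eq_intros simp: i3 algebra_simps)
  from DERIV_unique[OF this P] have 2: "- \<i> * d 1 - d 4 + \<i> * d 8 + d 13 = 0" .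
  have "((\<lambda>z. quartic d (\<i> + z * 0) (z * 0) (1 + z * 1)) has_field_derivative
      - \<i> * d 2 - 2 * d 5 + 3 * \<i> * d 9 + 4 * d 14) (at 0)"
    unfolding quartic_def by (auto intro!: derivative_eq_intros simp: i3 algebra_simps)
  from DERIV_unique[OF this P] have 3: "- \<i> * d 2 - 2 * d 5 + 3 * \<i> * d 9 + 4 * d 14 = 0" .
  have "((\<lambda>z. quartic d (\<i> + z * 1) (1 + z * 0) (z * 0)) has_field_derivative
      - 4 * \<i> * d 0 - 3 * d 1 + 2 * \<i> * d 3 + d 6) (at 0)"
    unfolding quartic_def by (auto intro!: derivative_eq_intros simp: i3 algebra_simps)
  from DERIV_unique[OF this Q] have 4: "- 4 * \<i> * d 0 - 3 * d 1 + 2 * \<i> * d 3 + d 6 = 0" .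
  have "((\<lambda>z. quartic d (\<i> + z * 0) (1 + z * 1) (z * 0)) has_field_derivative
      - \<i> * d 1 - 2 * d 3 + 3 * \<i> * d 6 + 4 * d 10) (at 0)"
    unfolding quartic_def by (auto intro!: derivative_eq_intros simp: i3 algebra_simps)
  from DERIV_unique[OF this Q] have 5: "- \<i> * d 1 - 2 * d 3 + 3 * \<i> * d 6 + 4 * d 10 = 0" .
  have "((\<lambda>z. quartic d (\<i> + z * 0) (1 + z * 0) (z * 1)) has_field_derivative
      - \<i> * d 2 - d 4 + \<i> * d 7 + d 11) (at 0)"
    unfolding quartic_def by (auto intro!: derivative_eq_intros simp: i3 algebra_simps)
  from DERIV_unique[OF this Q] have 6: "- \<i> * d 2 - d 4 + \<i> * d 7 + d 11 = 0" .
  have "d 1 = 0" "d 2 = 0" "d 3 = 2 * d 0" "d 5 = 2 * d 0" "d 6 = 0" "d 7 = 0" "d 8 = 0" "d 9 = 0"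
    "d 10 = d 0" "d 11 = d 4" "d 13 = d 4" "d 14 = d 0"
    using 1 2 3 4 5 6 by (simp_all add: complex_eq_iff)
  then show ?thesis
    unfolding quartic_def by (simp add: power2_eq_square power4_eq_xxxx power3_eq_cube algebra_simps)
qed

section \<open>Real and imaginary parts of complex vectors\<close>

definition cv :: "real ^ 'n \<Rightarrow> complex ^ 'n" where "cv x = (\<chi> i. of_real (x $ i))"
definition cj :: "complex ^ 'n \<Rightarrow> complex ^ 'n" where "cj x = (\<chi> i. cnj (x $ i))"
definition re :: "complex ^ 'n \<Rightarrow> real ^ 'n" where "re x = (\<chi> i. Re (x $ i))"
definition im :: "complex ^ 'n \<Rightarrow> real ^ 'n" where "im x = (\<chi> i. Im (x $ i))"

lemma cj_cj [simp]: "cj (cj x) = x" by (simp add: cj_def vec_eq_iff)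
lemma cj_0 [simp]: "cj 0 = 0" by (simp add: cj_def vec_eq_iff)
lemma cj_eq_iff [simp]: "cj x = cj y \<longleftrightarrow> x = y" by (simp add: cj_def vec_eq_iff)
lemma cj_scale: "cj (a *s x) = cnj a *s cj x" by (simp add: cj_def vec_eq_iff)
lemma cj_add: "cj (x + y) = cj x + cj y" by (simp add: cj_def vec_eq_iff)
lemma cv_0 [simp]: "cv 0 = 0" by (simp add: cv_def vec_eq_iff)
lemma cv_add: "cv (x + y) = cv x + cv y" by (simp add: cv_def vec_eq_iff)
lemma cv_scale: "cv (a *s x) = of_real a *s cv x" by (simp add: cv_def vec_eq_iff)

lemma cv_re: "cv (re x) = (1/2) *s x + (1/2) *s cj x"
  by (simp add: vec_eq_iff cv_def re_def cj_def complex_eq_iff)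
lemma cv_im: "cv (im x) = (- \<i>/2) *s x + (\<i>/2) *s cj x"
  by (simp add: vec_eq_iff cv_def im_def cj_def complex_eq_iff)
lemma re_im: "x = cv (re x) + \<i> *s cv (im x)"
  by (simp add: vec_eq_iff cv_def re_def im_def complex_eq_iff)
lemma cj_re_im: "cj x = cv (re x) + (- \<i>) *s cv (im x)"
  by (simp add: vec_eq_iff cv_def re_def im_def cj_def complex_eq_iff)

lemma tri_cv: "tri c (cv x) (cv y) (cv z) = of_real (tri c x y z)"
  by (simp add: tri_def cv_def)

lemma tri_cj: "tri c (cj x) (cj y) (cj z) = cnj (tri c x y z)"
  by (simp add: tri_def cj_def)

lemma (in real_cubic) sing_cj: "sing x \<Longrightarrow> sing (cj x)"
  unfolding sing_def by (metis cj_0 cj_cj complex_cnj_zero tri_cj)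

context cubic_line
begin

lemma sing_off_line:
  assumes "sing x" "\<And>a. x \<noteq> a *s p" "\<And>a. x \<noteq> a *s p'"
  shows "off_line x"
  unfolding off_line_def
proof (intro allI notI)
  fix a b assume x: "x = a *s p + b *s p'"
  obtain v where v: "B p p' v \<noteq> 0" by (rule l_nonzero)
  have "B x x v = 2 * (a * b) * B p p' v"
    using B_commute12[of p' p v] by (simp add: x B_linear zero_simps)
  then have "a * b = 0" using assms(1) v by (simp add: sing_def)
  then show False using x assms(2)[of a] assms(3)[of b] by auto
qed

lemma pair_independent:
  assumes x: "sing x" "B p p' x \<noteq> 0" and y: "sing y" "off_line y" and ne: "\<And>a. y \<noteq> a *s x"
    and 0: "u *s x + v *s y + a *s p + b *s p' = 0"
  shows "u = 0 \<and> v = 0 \<and> a = 0 \<and> b = 0"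
proof -
  have v: "v = 0"
  proof (rule ccontr)
    assume n: "v \<noteq> 0"
    have "y = (- u / v) *s x + (- a / v) *s p + (- b / v) *s p'"
      using smult_solve[OF n, of u x a p b p' 0 0 y] 0 by (simp add: add_ac)
    then show False using sing_same_projection(1)[OF x y] ne by blast
  qed
  then have "u *s x + a *s p + b *s p' = 0" using 0 by simp
  from off_lineD[OF l_neq_0_off_line[OF x(2)] this] v show ?thesis by simp
qed

end

section \<open>Real coordinates adapted to three conjugate pairs\<close>

text \<open>\<open>im_Q\<close> normalizes the representatives: modulo the line, \<open>P\<close>
  and \<open>Q\<close> have the same imaginary part \<open>er\<close>, so they become et + i er and
  es + i er. This puts the four nodes at (\<plusminus> i, 0, 1) and (\<plusminus> i, 1, 0).\<close>

locale conjugate_frame = cubic_line c p "cj p" for c p +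
  fixes P Q k :: "complex ^ 5" and c0 c1 :: real
  assumes k: "k \<noteq> a *s p" "B p k v = 0"
    and P: "sing P" "off_line P" and Q: "sing Q" "off_line Q"
    and ne: "cj P \<noteq> a *s P" "Q \<noteq> a *s P" "Q \<noteq> a *s cj P" "cj Q \<noteq> a *s Q"
    and all_sing: "sing x \<Longrightarrow> \<exists>a. x = a *s p \<or> x = a *s cj p \<or> x = a *s P \<or> x = a *s cj P \<or> x = a *s Q \<or> x = a *s cj Q"
    and im_Q: "im Q = im P + c0 *s re p + c1 *s im p"
begin

definition "e0 = re p"
definition "e1 = im p"
definition "er = im P"
definition "es = re Q"
definition "et = re P"

definition E :: "complex \<Rightarrow> complex \<Rightarrow> complex \<Rightarrow> complex ^ 5"
  where "E r s t = r *s cv er + s *s cv es + t *s cv et"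

lemma k': "cj k \<noteq> a *s cj p" "B (cj p) (cj k) v = 0"
proof -
  show "cj k \<noteq> a *s cj p" using k(1)[of "cnj a"] cj_eq_iff[of k "cnj a *s p"] by (simp add: cj_scale)
  show "B (cj p) (cj k) v = 0" using tri_cj[of c p k "cj v"] k(2) by simp
qed

lemma l_off: "sing x \<Longrightarrow> off_line x \<Longrightarrow> B p (cj p) x \<noteq> 0"
  using l_nonzero_off_line[OF k k'] by blast

lemma off_line_cj: "off_line x \<Longrightarrow> off_line (cj x)"
  unfolding off_line_def
proof (intro allI notI)
  fix a b assume x: "\<forall>a b. x \<noteq> a *s p + b *s cj p" and "cj x = a *s p + b *s cj p"
  then have "x = cj (a *s p + b *s cj p)" by (metis cj_cj)
  then show False using x by (metis add.commute cj_add cj_cj cj_scale)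
qed

lemma P': "sing (cj P)" "off_line (cj P)" and Q': "sing (cj Q)" "off_line (cj Q)"
  using P Q sing_cj off_line_cj by auto

lemma ne': "cj Q \<noteq> a *s P" "cj Q \<noteq> a *s cj P"
  using ne(3)[of "cnj a"] ne(2)[of "cnj a"] by (metis cj_cj cj_scale)+

text \<open>A relation involving \<open>es\<close> would place \<open>Q\<close> and
  \<open>cj Q\<close> in the span of \<open>P\<close>, \<open>cj P\<close>, \<open>p\<close>,
  \<open>cj p\<close>, making four nodes collinear after projection. Without \<open>es\<close> the
  relation is one among these four independent vectors.\<close>

lemma frame_independent:
  assumes 0: "x0 *s cv e0 + x1 *s cv e1 + r *s cv er + s *s cv es + t *s cv et = 0"
  shows "x0 = 0 \<and> x1 = 0 \<and> r = 0 \<and> s = 0 \<and> t = 0"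
proof -
  have s: "s = 0"
  proof (rule ccontr)
    assume n: "s \<noteq> 0"
    obtain y0 y1 y2 y3 where es: "cv es = y0 *s cv e0 + y1 *s cv e1 + y2 *s cv er + y3 *s cv et"
    proof (rule that)
      have "x0 *s cv e0 + x1 *s cv e1 + r *s cv er + t *s cv et + s *s cv es = 0"
        using 0 by (simp add: add_ac)
      then show "cv es = (- x0 / s) *s cv e0 + (- x1 / s) *s cv e1 + (- r / s) *s cv er + (- t / s) *s cv et"
        by (rule smult_solve[OF n])
    qed
    have im: "cv (im Q) = cv er + of_real c0 *s cv e0 + of_real c1 *s cv e1"
      by (simp add: im_Q cv_add cv_scale er_def e0_def e1_def)
    \<comment> \<open>Applied with j = i for \<open>Q\<close> and with j = -i for
      \<open>cj Q\<close>.\<close>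
    have lin: "cv es + j *s cv (im Q) = (y3 / 2 - (y2 + j) * \<i> / 2) *s P + (y3 / 2 + (y2 + j) * \<i> / 2) *s cj P +
        ((y0 + j * c0) / 2 - (y1 + j * c1) * \<i> / 2) *s p + ((y0 + j * c0) / 2 + (y1 + j * c1) * \<i> / 2) *s cj p" for j
      unfolding es im unfolding e0_def e1_def er_def et_def cv_re cv_im
      by (simp add: vec_eq_iff field_simps)
    have Q_eq: "Q = cv es + \<i> *s cv (im Q)" using re_im[of Q] by (simp add: es_def)
    have Q'_eq: "cj Q = cv es + (- \<i>) *s cv (im Q)" using cj_re_im[of Q] by (simp add: es_def)
    show False
      by (rule not_collinear[OF P(1) l_off[OF P] P'(1) l_off[OF P'] Q Q' l_off[OF Q] ne(1-3) ne' ne(4)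
            Q_eq[unfolded lin] Q'_eq[unfolded lin]])
  qed
  have "x0 *s cv e0 + x1 *s cv e1 + r *s cv er + t *s cv et = 0" using 0 s by simp
  moreover have "x0 *s cv e0 + x1 *s cv e1 + r *s cv er + t *s cv et =
      (t / 2 - r * \<i> / 2) *s P + (t / 2 + r * \<i> / 2) *s cj P + (x0 / 2 - x1 * \<i> / 2) *s p + (x0 / 2 + x1 * \<i> / 2) *s cj p"
    unfolding e0_def e1_def er_def et_def cv_re cv_im by (simp add: vec_eq_iff field_simps)
  ultimately have "(t / 2 - r * \<i> / 2) *s P + (t / 2 + r * \<i> / 2) *s cj P + (x0 / 2 - x1 * \<i> / 2) *s p + (x0 / 2 + x1 * \<i> / 2) *s cj p = 0"
    by simp
  from pair_independent[OF P(1) l_off[OF P] P' ne(1) this]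
  have "t / 2 - r * \<i> / 2 = 0" "t / 2 + r * \<i> / 2 = 0" "x0 / 2 - x1 * \<i> / 2 = 0" "x0 / 2 + x1 * \<i> / 2 = 0" by blast+
  then have "2 * t = 0" "2 * \<i> * r = 0" "2 * x0 = 0" "2 * \<i> * x1 = 0" by algebra+
  with s show ?thesis by simp
qed

lemma frame_independent_real:
  assumes "x0 *s e0 + x1 *s e1 + r *s er + s *s es + t *s et = 0"
  shows "x0 = 0 \<and> x1 = 0 \<and> r = 0 \<and> s = 0 \<and> t = 0"
proof -
  have "of_real x0 *s cv e0 + of_real x1 *s cv e1 + of_real r *s cv er + of_real s *s cv es + of_real t *s cv et =
      cv (x0 *s e0 + x1 *s e1 + r *s er + s *s es + t *s et)"
    by (simp add: cv_add cv_scale)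
  also have "\<dots> = 0" unfolding assms by simp
  finally show ?thesis using frame_independent by (metis of_real_eq_0_iff)
qed

lemma frame_span:
  obtains a b r s t where "v = a *s p + b *s cj p + E r s t"
proof -
  obtain x0 x1 r s t where v: "v = x0 *s cv e0 + x1 *s cv e1 + r *s cv er + s *s cv es + t *s cv et"
    using span5[of "cv e0" "cv e1" "cv er" "cv es" "cv et" v, OF frame_independent] by blast
  have "v = (x0 / 2 - x1 * \<i> / 2) *s p + (x0 / 2 + x1 * \<i> / 2) *s cj p + E r s t"
    unfolding v E_def e0_def e1_def cv_re cv_im by (simp add: vec_eq_iff field_simps)
  with that show ?thesis by blast
qed

text \<open>These are the real and imaginary parts of \<open>B p p (cv v) = 0\<close>. They make the
  part of the cubic quadratic in the first two coordinates a multiple of x_0^2 + x_1^2.\<close>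

lemma e_relations: "B e0 e0 v = B e1 e1 v" "B e0 e1 v = 0"
proof -
  have "0 = B p p (cv v)" using sing_p by (simp add: sing_def)
  also have "\<dots> = of_real (B e0 e0 v - B e1 e1 v) + \<i> * of_real (2 * B e0 e1 v)"
    using B_commute12[of "cv e1" "cv e0" "cv v"]
    by (subst (1 2) re_im[of p]) (simp add: B_linear tri_cv e0_def[symmetric] e1_def[symmetric] algebra_simps)
  finally have "Re (of_real (B e0 e0 v - B e1 e1 v) + \<i> * of_real (2 * B e0 e1 v)) = 0"
    "Im (of_real (B e0 e0 v - B e1 e1 v) + \<i> * of_real (2 * B e0 e1 v)) = 0" by simp_all
  then show "B e0 e0 v = B e1 e1 v" "B e0 e1 v = 0" by simp_all
qed

definition l :: "nat \<Rightarrow> real" where "l = (!) [3 * B e0 e0 er, 3 * B e0 e0 es, 3 * B e0 e0 et]"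

text \<open>With the factor 3/2, twice x_0 times this form is the term 3 x_0 B e0 w w of the
  cubic.\<close>

definition quad_coeffs :: "real ^ 5 \<Rightarrow> nat \<Rightarrow> real" where
  "quad_coeffs e = (!) [3 / 2 * B e er er, 3 / 2 * B e es es, 3 / 2 * B e et et, 3 * B e er es, 3 * B e er et, 3 * B e es et]"

definition cub_coeffs :: "nat \<Rightarrow> real" where
  "cub_coeffs = (!) [B er er er, B es es es, B et et et, 3 * B er er es, 3 * B er er et, 3 * B er es es,
    3 * B es es et, 3 * B er et et, 3 * B es et et, 6 * B er es et]"

definition d :: "nat \<Rightarrow> real" where "d = discriminant l (quad_coeffs e0) (quad_coeffs e1) cub_coeffs"

lemma B_E1: "3 * B (cv e0) (cv e0) (E r s t) = lin l r s t"
  by (simp add: E_def lin_def l_def B_linear tri_cv algebra_simps)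

lemma B_E2: "3 / 2 * B (cv e) (E r s t) (E r s t) = quad (quad_coeffs e) r s t"
  using B_commute23[of "cv e" "cv er" "cv es"] B_commute23[of "cv e" "cv er" "cv et"] B_commute23[of "cv e" "cv es" "cv et"]
    B_commute23[of e er es] B_commute23[of e er et] B_commute23[of e es et]
  by (simp add: E_def quad_def quad_coeffs_def B_linear tri_cv algebra_simps power2_eq_square)

lemma B_E3: "B (E r s t) (E r s t) (E r s t) = cub cub_coeffs r s t"
  by (simp add: E_def cub_def cub_coeffs_def B_linear tri_cv algebra_simps power2_eq_square power3_eq_cube B_sym)

lemma l_E: "3 * B p (cj p) (E r s t) = 2 * lin l r s t"
proof -
  obtain v w where vw: "E r s t = cv v + \<i> *s cv w" using re_im by blast
  have "B (cv e1) (cv e1) (E r s t) = B (cv e0) (cv e0) (E r s t)"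
    unfolding vw by (simp add: B_linear tri_cv e_relations)
  moreover have "B (cv e0) (cv e1) (E r s t) = 0" "B (cv e1) (cv e0) (E r s t) = 0"
    unfolding vw by (simp_all add: B_linear tri_cv e_relations B_commute12[of e1 e0])
  ultimately have "B p (cj p) (E r s t) = 2 * B (cv e0) (cv e0) (E r s t)"
    by (subst re_im[of p], subst cj_re_im[of p]) (simp add: B_linear e0_def[symmetric] e1_def[symmetric] algebra_simps)
  then show ?thesis using B_E1[of r s t] by simp
qed

lemma B_p: "B p x y = B (cv e0) x y + \<i> * B (cv e1) x y" "B (cj p) x y = B (cv e0) x y - \<i> * B (cv e1) x y"
  by (subst re_im[of p], simp add: B_linear e0_def e1_def)
     (subst cj_re_im[of p], simp add: B_linear e0_def e1_def)

lemma D_E: "3 * D (E r s t) = 4 * quartic d r s t"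
proof -
  have "3 * D (E r s t) = 9 * ((B (cv e0) (E r s t) (E r s t))\<^sup>2 + (B (cv e1) (E r s t) (E r s t))\<^sup>2)
      - 2 * (3 * B p (cj p) (E r s t)) * B (E r s t) (E r s t) (E r s t)"
    unfolding D_def B_p(1)[of "E r s t" "E r s t"] B_p(2)[of "E r s t" "E r s t"]
    by (simp add: algebra_simps power2_eq_square)
  also have "\<dots> = 4 * ((3 / 2 * B (cv e0) (E r s t) (E r s t))\<^sup>2 + (3 / 2 * B (cv e1) (E r s t) (E r s t))\<^sup>2
      - lin l r s t * cub cub_coeffs r s t)"
    unfolding l_E B_E3 by (simp add: power2_eq_square algebra_simps)
  finally show ?thesis unfolding B_E2 d_def quartic_discriminant .
qed

lemma quartic_has_field_derivative:
  "((\<lambda>z. quartic d (r + z * r') (s + z * s') (t + z * t')) has_field_derivative 3 / 4 * dD (E r s t) (E r' s' t')) (at 0)"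
proof -
  have eq: "quartic d (r + z * r') (s + z * s') (t + z * t') = 3 / 4 * D (E r s t + z *s E r' s' t')" for z
    using D_E[of "r + z * r'" "s + z * s'" "t + z * t'"]
    by (simp add: E_def vec_eq_iff algebra_simps)
  show ?thesis unfolding eq by (rule DERIV_cmult[OF D_has_field_derivative])
qed

lemma P_E: "P = E \<i> 0 1"
  using re_im[of P] by (simp add: E_def er_def et_def add.commute)

lemma Q_E: "Q = E \<i> 1 0 + (\<i> * (c0 / 2 - c1 * \<i> / 2)) *s p + (\<i> * (c0 / 2 + c1 * \<i> / 2)) *s cj p"
proof -
  have "Q = cv es + \<i> *s (cv er + of_real c0 *s cv e0 + of_real c1 *s cv e1)"
    using re_im[of Q] by (simp add: es_def im_Q cv_add cv_scale er_def e0_def e1_def)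
  then show ?thesis
    unfolding E_def e0_def e1_def cv_re cv_im by (simp add: vec_eq_iff field_simps)
qed

lemma quartic_eq:
  "quartic d r s t = of_real (d 12 - 2 * d 0) * (s * t)\<^sup>2 + of_real (d 4) * (s * t) * (r\<^sup>2 + s\<^sup>2 + t\<^sup>2) +
    of_real (d 0) * (r\<^sup>2 + s\<^sup>2 + t\<^sup>2)\<^sup>2"
proof (rule nodal_quartic_in_pencil)
  fix a b e :: complex
  have "dD (E \<i> 0 1) v = 0" for v using sing_dD[OF P(1)] arg_cong[OF P_E, of "\<lambda>x. dD x v"] by simp
  then show "((\<lambda>z. quartic d (\<i> + z * a) (z * b) (1 + z * e)) has_field_derivative 0) (at 0)"
    using quartic_has_field_derivative[of \<i> a 0 b 1 e] by simp
  have "dD (E \<i> 1 0) v = 0" for v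
    using sing_dD[OF Q(1), of v] arg_cong[OF Q_E, of "\<lambda>x. dD x v"] by (simp only: dD_translate)
  then show "((\<lambda>z. quartic d (\<i> + z * a) (1 + z * b) (z * e)) has_field_derivative 0) (at 0)"
    using quartic_has_field_derivative[of \<i> a 1 b 0 e] by simp
qed

end

lemma quad_of_real: "quad a (of_real r) (of_real s) (of_real t) = (of_real (quad a r s t) :: complex)"
  by (simp add: quad_def)

lemma lin_of_real: "lin l (of_real r) (of_real s) (of_real t) = (of_real (lin l r s t) :: complex)"
  by (simp add: lin_def)

lemma form_lin: "form 1 (\<lambda>z :: real ^ 3. lin l (z $ 1) (z $ 2) (z $ 3))"
  unfolding lin_def by (intro form_add form_cmult form_coord)

lemma form_quad: "form 2 (\<lambda>z :: real ^ 3. quad a (z $ 1) (z $ 2) (z $ 3))"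
  unfolding quad_def
  by (intro form_add form_cmult form_power[OF form_coord] form_mult[OF form_coord form_coord]) simp_all

lemma form_cub: "form 3 (\<lambda>z :: real ^ 3. cub a (z $ 1) (z $ 2) (z $ 3))"
  unfolding cub_def
  by (intro form_add form_cmult form_power[OF form_coord] form_mult[OF form_power[OF form_coord refl] form_coord]
      form_mult[OF form_coord form_power[OF form_coord refl]] form_mult[OF form_mult[OF form_coord form_coord refl] form_coord])
    simp_all

lemma cj_cv: "cj (cv x) = cv x" by (simp add: cj_def cv_def)

context conjugate_frame
begin

lemma cj_E: "cj (E r s t) = E (cnj r) (cnj s) (cnj t)"
  by (simp add: E_def cj_add cj_scale cj_cv)

lemma E_unique:
  assumes "E r s t + a *s p + b *s cj p = E r' s' t' + a' *s p + b' *s cj p"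
  shows "r = r'" "s = s'" "t = t'"
proof -
  have p: "p = cv e0 + \<i> *s cv e1" "cj p = cv e0 + (- \<i>) *s cv e1"
    using re_im[of p] cj_re_im[of p] by (simp_all add: e0_def e1_def)
  have "((a - a') + (b - b')) *s cv e0 + (\<i> * (a - a') - \<i> * (b - b')) *s cv e1 + (r - r') *s cv er + (s - s') *s cv es + (t - t') *s cv et =
      (E r s t + a *s (cv e0 + \<i> *s cv e1) + b *s (cv e0 + (- \<i>) *s cv e1)) -
      (E r' s' t' + a' *s (cv e0 + \<i> *s cv e1) + b' *s (cv e0 + (- \<i>) *s cv e1))"
    by (simp add: E_def vec_eq_iff algebra_simps)
  also have "\<dots> = 0" using assms unfolding p(1)[symmetric] p(2)[symmetric] by simp
  finally have "r - r' = 0" "s - s' = 0" "t - t' = 0" using frame_independent by blast+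
  then show "r = r'" "s = s'" "t = t'" by simp_all
qed

section \<open>Definiteness of the quartic\<close>

text \<open>The linear form is nonzero at (i, 0, 1) and (i, 1, 0), because \<open>B p (cj p)\<close>
  does not vanish at \<open>P\<close> and \<open>Q\<close>.\<close>

lemma lin_nonzero: "l 0 \<noteq> 0 \<or> l 2 \<noteq> 0" "l 0 \<noteq> 0 \<or> l 1 \<noteq> 0"
proof -
  have "B p (cj p) P = B p (cj p) (E \<i> 0 1)" by (rule arg_cong[OF P_E])
  then have "lin l \<i> 0 1 \<noteq> 0" using l_off[OF P] l_E[of \<i> 0 1] by auto
  then show "l 0 \<noteq> 0 \<or> l 2 \<noteq> 0" by (auto simp: lin_def)
  have "B p (cj p) Q = B p (cj p) (E \<i> 1 0)"
    by (subst Q_E) (simp add: B_linear zero_simps)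
  then have "lin l \<i> 1 0 \<noteq> 0" using l_off[OF Q] l_E[of \<i> 1 0] by auto
  then show "l 0 \<noteq> 0 \<or> l 1 \<noteq> 0" by (auto simp: lin_def)
qed

text \<open>A double conic \<open>D = \<kappa> q\<^sup>2\<close> would have singular points other than the four nodes.\<close>

lemma not_double_conic:
  assumes uv: "(u, v) \<noteq> (0, 0)"
  shows "\<not> (d 12 - 2 * d 0 = \<kappa> * u\<^sup>2 \<and> d 4 = \<kappa> * (2 * u * v) \<and> d 0 = \<kappa> * v\<^sup>2)"
proof
  assume eq: "d 12 - 2 * d 0 = \<kappa> * u\<^sup>2 \<and> d 4 = \<kappa> * (2 * u * v) \<and> d 0 = \<kappa> * v\<^sup>2"
  obtain r s t :: complex where rst: "u * (s * t) + v * (r\<^sup>2 + s\<^sup>2 + t\<^sup>2) = 0" "l 0 * r + l 1 * s + l 2 * t \<noteq> 0"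
    "s * t \<noteq> 0 \<or> r\<^sup>2 + s\<^sup>2 + t\<^sup>2 \<noteq> 0"
    using pencil_point[OF lin_nonzero(2) uv] by blast
  have quartic: "quartic d r s t = of_real \<kappa> * (of_real u * (s * t) + of_real v * (r\<^sup>2 + s\<^sup>2 + t\<^sup>2))\<^sup>2" for r s t :: complex
  proof -
    have "quartic d r s t = of_real (\<kappa> * u\<^sup>2) * (s * t)\<^sup>2 + of_real (\<kappa> * (2 * u * v)) * (s * t) * (r\<^sup>2 + s\<^sup>2 + t\<^sup>2) +
        of_real (\<kappa> * v\<^sup>2) * (r\<^sup>2 + s\<^sup>2 + t\<^sup>2)\<^sup>2"
      using eq quartic_eq[of r s t] by metis
    then show ?thesis by (simp add: power2_eq_square algebra_simps)
  qed
  have l: "B p (cj p) (E r s t) \<noteq> 0" 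
  proof -
    have "lin l r s t \<noteq> 0" using rst(2) by (simp add: lin_def)
    then show ?thesis using l_E[of r s t] by auto
  qed
  \<comment> \<open>Since \<open>D\<close> is invariant under translation by \<open>p\<close> and
    \<open>cj p\<close>, only directions in the frame matter; there \<open>D\<close> is a multiple
    of a square vanishing at the point.\<close>
  have "dD (E r s t) w = 0" for w
  proof -
    obtain a b r' s' t' where w: "w = a *s p + b *s cj p + E r' s' t'" by (rule frame_span)
    have "E r s t + z *s w = (E r s t + z *s E r' s' t') + (z * a) *s p + (z * b) *s cj p" for z
      by (simp add: w vec_eq_iff algebra_simps)
    then have "D (E r s t + z *s w) = D (E r s t + z *s E r' s' t')" for z by (simp only: D_translate)
    then have "((\<lambda>z. D (E r s t + z *s E r' s' t')) has_field_derivative dD (E r s t) w) (at 0)"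
      using D_has_field_derivative[of "E r s t" w] by simp
    then have dD: "dD (E r s t) w = dD (E r s t) (E r' s' t')"
      by (rule DERIV_unique) (rule D_has_field_derivative)
    define h where "h z = of_real u * ((s + z * s') * (t + z * t')) + of_real v * ((r + z * r')\<^sup>2 + (s + z * s')\<^sup>2 + (t + z * t')\<^sup>2)" for z
    define h' where "h' = of_real u * (s' * t + s * t') + of_real v * (2 * r * r' + 2 * s * s' + 2 * t * t')"
    have "(h has_field_derivative h') (at 0)"
      unfolding h_def h'_def by (auto intro!: derivative_eq_intros simp: algebra_simps)
    moreover have "h 0 = 0" using rst(1) by (simp add: h_def)
    ultimately have "((\<lambda>z. of_real \<kappa> * (h z)\<^sup>2) has_field_derivative 0) (at 0)"
      by (auto intro!: derivative_eq_intros)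
    then have "((\<lambda>z. quartic d (r + z * r') (s + z * s') (t + z * t')) has_field_derivative 0) (at 0)"
      unfolding quartic h_def .
    from DERIV_unique[OF this quartic_has_field_derivative] show ?thesis using dD by simp
  qed
  from lift_sing[OF l this] obtain a b where sing: "sing (E r s t + a *s p + b *s cj p)" by blast
  define x where "x = E r s t + a *s p + b *s cj p"
  have "B p (cj p) x = B p (cj p) (E r s t)" by (simp add: x_def B_linear zero_simps)
  then have off: "off_line x" using l l_neq_0_off_line by metis
  \<comment> \<open>At the nodes both s t and r^2 + s^2 + t^2 vanish, but not at the chosen
    point.\<close>
  have contra: False if "x = m *s (E j s' t' + a' *s p + b' *s cj p)" "s' * t' = 0" "j\<^sup>2 + s'\<^sup>2 + t'\<^sup>2 = 0" for m j s' t' a' b'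
  proof -
    have "E r s t + a *s p + b *s cj p = E (m * j) (m * s') (m * t') + (m * a') *s p + (m * b') *s cj p"
      using that(1) by (simp add: x_def E_def vec_eq_iff algebra_simps)
    from E_unique[OF this] have rst': "r = m * j" "s = m * s'" "t = m * t'" by simp_all
    have "s * t = m\<^sup>2 * (s' * t')" by (simp add: rst' power2_eq_square)
    moreover have "r\<^sup>2 + s\<^sup>2 + t\<^sup>2 = m\<^sup>2 * (j\<^sup>2 + s'\<^sup>2 + t'\<^sup>2)" by (simp add: rst' power2_eq_square algebra_simps)
    ultimately show False using rst(3) that(2,3) by simp
  qed
  obtain f g where Q: "Q = E \<i> 1 0 + f *s p + g *s cj p" using Q_E by blast
  have Q': "cj Q = E (- \<i>) 1 0 + cnj g *s p + cnj f *s cj p"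
    using arg_cong[OF Q, of cj] by (simp add: cj_E cj_add cj_scale add_ac)
  have P0: "P = E \<i> 0 1 + 0 *s p + 0 *s cj p" using P_E by simp
  have P'0: "cj P = E (- \<i>) 0 1 + 0 *s p + 0 *s cj p" using arg_cong[OF P_E, of cj] by (simp add: cj_E)
  obtain m where "x = m *s p \<or> x = m *s cj p \<or> x = m *s P \<or> x = m *s cj P \<or> x = m *s Q \<or> x = m *s cj Q"
    using all_sing sing unfolding x_def by blast
  then show False
  proof (elim disjE)
    assume "x = m *s p"
    then have "x = m *s p + 0 *s cj p" by simp
    with off show False unfolding off_line_def by blast
  next
    assume "x = m *s cj p"
    then have "x = 0 *s p + m *s cj p" by simp
    with off show False unfolding off_line_def by blast
  next
    assume "x = m *s P"
    also note arg_cong[OF P0, of "\<lambda>y. m *s y"]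
    finally show False by (rule contra) simp_all
  next
    assume "x = m *s cj P"
    also note arg_cong[OF P'0, of "\<lambda>y. m *s y"]
    finally show False by (rule contra) simp_all
  next
    assume "x = m *s Q"
    also note arg_cong[OF Q, of "\<lambda>y. m *s y"]
    finally show False by (rule contra) simp_all
  next
    assume "x = m *s cj Q"
    also note arg_cong[OF Q', of "\<lambda>y. m *s y"]
    finally show False by (rule contra) simp_all
  qed
qed

lemma quartic_definite: "0 < d 0" "(d 4)\<^sup>2 < 4 * (d 12 - 2 * d 0) * d 0"
proof -
  obtain r1 s1 t1 r2 s2 t2 :: real where w: "l 0 * r1 + l 1 * s1 + l 2 * t1 = 0" "l 0 * r2 + l 1 * s2 + l 2 * t2 = 0"
    and w_complex: "\<And>(r :: complex) (s :: complex) t :: complex. l 0 * r + l 1 * s + l 2 * t = 0 \<Longrightarrow>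
      \<exists>x y :: complex. r = x * of_real r1 + y * of_real r2 \<and> s = x * of_real s1 + y * of_real s2 \<and>
        t = x * of_real t1 + y * of_real t2"
    by (rule line_kernel[OF lin_nonzero(2), of "l 2"]) (rule that)
  have w_real: "\<exists>x y. r = x * r1 + y * r2 \<and> s = x * s1 + y * s2 \<and> t = x * t1 + y * t2"
    if "l 0 * r + l 1 * s + l 2 * t = 0" for r s t :: real
  proof -
    have "of_real (l 0) * of_real r + of_real (l 1) * of_real s + of_real (l 2) * of_real t = (0 :: complex)"
      using that by (simp flip: of_real_mult of_real_add)
    from w_complex[OF this] obtain x y :: complex where "of_real r = x * of_real r1 + y * of_real r2"
      "of_real s = x * of_real s1 + y * of_real s2" "of_real t = x * of_real t1 + y * of_real t2" by blast
    from this[THEN arg_cong[where f = Re]] show ?thesis by (intro exI[of _ "Re x"] exI[of _ "Re y"]) simp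
  qed
  define W1 where "W1 = E (of_real r1) (of_real s1) (of_real t1)"
  define W2 where "W2 = E (of_real r2) (of_real s2) (of_real t2)"
  define G11 where "G11 = 3 / 2 * B p W1 W1"
  define G12 where "G12 = 3 / 2 * B p W1 W2"
  define G22 where "G22 = 3 / 2 * B p W2 W2"
  have l_W: "B p (cj p) W1 = 0" "B p (cj p) W2 = 0"
  proof -
    have "lin l r1 s1 t1 = 0" "lin l r2 s2 t2 = 0" using w by (simp_all add: lin_def)
    then show "B p (cj p) W1 = 0" "B p (cj p) W2 = 0"
      using l_E[of "of_real r1" "of_real s1" "of_real t1"] l_E[of "of_real r2" "of_real s2" "of_real t2"]
      by (simp_all only: W1_def W2_def lin_of_real) simp_all
  qed
  have G: "G12\<^sup>2 = G11 * G22"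
  proof -
    \<comment> \<open>Modulo \<open>p\<close> and \<open>cj p\<close> the kernel vector is nonzero
      and lies on l = 0, so it is a combination of \<open>W1\<close> and \<open>W2\<close>. It is in
      the kernel of the binary form given by \<open>G11\<close>, \<open>G12\<close>,
      \<open>G22\<close>, whose determinant therefore vanishes.\<close>
    obtain a b r s t where k_eq: "k = a *s p + b *s cj p + E r s t" by (rule frame_span)
    have Bk: "b * B p (cj p) v + B p (E r s t) v = 0" for v
      using k(2)[of v] by (simp add: k_eq B_linear zero_simps)
    have "B p (cj p) (E r s t) = 0"
      using Bk[of "cj p"] B_commute23[of p "E r s t" "cj p"] by (simp add: zero_simps)
    then have "lin l r s t = 0" using l_E[of r s t] by simp
    then obtain x y where xy: "r = x * of_real r1 + y * of_real r2" "s = x * of_real s1 + y * of_real s2"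
        "t = x * of_real t1 + y * of_real t2"
      using w_complex[of r s t] by (auto simp: lin_def)
    have E_xy: "E r s t = x *s W1 + y *s W2"
      by (simp add: xy W1_def W2_def E_def vec_eq_iff algebra_simps)
    have xy0: "(x, y) \<noteq> (0, 0)"
    proof
      assume "(x, y) = (0, 0)"
      then have E0: "E r s t = 0" using E_xy by simp
      obtain v where "B p (cj p) v \<noteq> 0" by (rule l_nonzero)
      then have "b = 0" using Bk[of v] by (simp add: E0 B_zero)
      then show False using k(1)[of a] by (simp add: k_eq E0)
    qed
    have "x * B p W1 W1 + y * B p W1 W2 = 0"
      using Bk[of W1] B_commute23[of p W2 W1] by (simp add: l_W E_xy B_linear)
    then have 1: "x * G11 + y * G12 = 0" unfolding G11_def G12_def by algebra
    have "x * B p W1 W2 + y * B p W2 W2 = 0"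
      using Bk[of W2] by (simp add: l_W E_xy B_linear)
    then have 2: "x * G12 + y * G22 = 0" unfolding G12_def G22_def by algebra
    have "x * (G12\<^sup>2 - G11 * G22) = 0" "y * (G12\<^sup>2 - G11 * G22) = 0"
      using 1 2 by algebra+
    with xy0 show ?thesis by auto
  qed
  \<comment> \<open>Where l = 0 the quartic reduces to |g|^2, and g restricted to this line is the
    binary form with coefficients \<open>G11\<close>, \<open>2 * G12\<close>,
    \<open>G22\<close>.\<close>
  have eq: "binary_norm G11 G12 G22 x y =
      (d 12 - 2 * d 0) * (s * t)\<^sup>2 + d 4 * (s * t) * (r\<^sup>2 + s\<^sup>2 + t\<^sup>2) + d 0 * (r\<^sup>2 + s\<^sup>2 + t\<^sup>2)\<^sup>2"
    if rst: "r = x * r1 + y * r2" "s = x * s1 + y * s2" "t = x * t1 + y * t2" for x y r s t :: real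
  proof -
    define X where "X = E (of_real r) (of_real s) (of_real t)"
    have X: "X = of_real x *s W1 + of_real y *s W2"
      by (simp add: X_def rst W1_def W2_def E_def vec_eq_iff algebra_simps)
    have "G11 * (of_real x)\<^sup>2 + 2 * G12 * of_real x * of_real y + G22 * (of_real y)\<^sup>2 = 3 / 2 * B p X X"
      using B_commute23[of p W2 W1]
      by (simp add: X G11_def G12_def G22_def B_linear power2_eq_square algebra_simps)
    also have "\<dots> = 3 / 2 * B (cv e0) X X + \<i> * (3 / 2 * B (cv e1) X X)"
      by (simp add: B_p algebra_simps)
    also have "\<dots> = of_real (quad (quad_coeffs e0) r s t) + \<i> * of_real (quad (quad_coeffs e1) r s t)"
      unfolding X_def B_E2 quad_of_real ..
    finally have "binary_norm G11 G12 G22 x y =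
        (quad (quad_coeffs e0) r s t)\<^sup>2 + (quad (quad_coeffs e1) r s t)\<^sup>2"
      by (simp add: binary_norm_def cmod_power2)
    also have "lin l r s t = x * (l 0 * r1 + l 1 * s1 + l 2 * t1) + y * (l 0 * r2 + l 1 * s2 + l 2 * t2)"
      by (simp add: lin_def rst algebra_simps)
    then have "lin l r s t = 0" using w by simp
    then have "(quad (quad_coeffs e0) r s t)\<^sup>2 + (quad (quad_coeffs e1) r s t)\<^sup>2 = quartic d r s t"
      by (simp add: d_def quartic_discriminant)
    finally show ?thesis by (simp add: quartic_eq)
  qed
  note definite = pencil_form_definite[OF lin_nonzero(2) lin_nonzero(1) w w_real G eq not_double_conic]
  show "0 < d 0" by (rule definite(1))
  show "(d 4)\<^sup>2 < 4 * (d 12 - 2 * d 0) * d 0" by (rule definite(2))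
qed

section \<open>Completing the square and applying the norm parametrization\<close>

lemma birational_forms_cubic: "birational_forms (\<lambda>x. B x x x)"
proof -
  \<comment> \<open>Completing the square in C = r^2 + s^2 + t^2 and A = s t gives d_0 (C + \<beta>
    A)^2 + \<delta> A^2.\<close>
  define \<beta> where "\<beta> = d 4 / (2 * d 0)"
  define \<delta> where "\<delta> = (d 12 - 2 * d 0) - (d 4)\<^sup>2 / (4 * d 0)"
  have d0: "d 0 > 0" by (rule quartic_definite)
  have \<delta>: "\<delta> > 0" using quartic_definite d0 by (simp add: \<delta>_def field_simps)
  define q1 :: "real ^ 3 \<Rightarrow> real" where "q1 z = sqrt (d 0) * ((z $ 1)\<^sup>2 + (z $ 2)\<^sup>2 + (z $ 3)\<^sup>2 + \<beta> * (z $ 2 * z $ 3))" for z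
  define q2 :: "real ^ 3 \<Rightarrow> real" where "q2 z = sqrt \<delta> * (z $ 2 * z $ 3)" for z
  have form_q: "form 2 q1" "form 2 q2"
    unfolding q1_def q2_def
    by (intro form_cmult form_add form_power[OF form_coord] form_mult[OF form_coord form_coord]; simp)+
  have norm: "lin l (z $ 1) (z $ 2) (z $ 3) * cub cub_coeffs (z $ 1) (z $ 2) (z $ 3) =
      (quad (quad_coeffs e0) (z $ 1) (z $ 2) (z $ 3))\<^sup>2 + (quad (quad_coeffs e1) (z $ 1) (z $ 2) (z $ 3))\<^sup>2 - (q1 z)\<^sup>2 - (q2 z)\<^sup>2"
    for z :: "real ^ 3"
  proof -
    define A where "A = z $ 2 * z $ 3"
    define C where "C = (z $ 1)\<^sup>2 + (z $ 2)\<^sup>2 + (z $ 3)\<^sup>2"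
    have "(q1 z)\<^sup>2 + (q2 z)\<^sup>2 = d 0 * (C + \<beta> * A)\<^sup>2 + \<delta> * A\<^sup>2"
      using d0 \<delta> by (simp add: q1_def q2_def power_mult_distrib A_def C_def)
    also have "\<dots> = (d 12 - 2 * d 0) * A\<^sup>2 + d 4 * A * C + d 0 * C\<^sup>2"
      using d0 by (simp add: \<beta>_def \<delta>_def field_simps power2_eq_square)
    also have "\<dots> = quartic d (z $ 1) (z $ 2) (z $ 3)"
      by (simp add: quartic_eq A_def C_def)
    finally show ?thesis unfolding d_def quartic_discriminant by simp
  qed
  \<comment> \<open>At both candidates s t = 0 and the sum of squares is 1, so \<open>q1\<close>
    takes the value \<open>sqrt (d 0)\<close>.\<close>
  obtain z0 :: "real ^ 3" where z0: "lin l (z0 $ 1) (z0 $ 2) (z0 $ 3) \<noteq> 0" "q1 z0 \<noteq> 0"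
  proof (cases "l 0 = 0")
    case True
    then have "l 1 \<noteq> 0" using lin_nonzero by simp
    then show ?thesis using that[of "vector [0, 1, 0]"] d0 by (simp add: lin_def q1_def)
  next
    case False
    then show ?thesis using that[of "vector [1, 0, 0]"] d0 by (simp add: lin_def q1_def)
  qed
  define M where "M = columns5 e0 e1 er es et"
  obtain N where N: "M ** N = mat 1"
    unfolding M_def using columns5_invertible[OF frame_independent_real] by blast
  \<comment> \<open>The line through \<open>p\<close> and \<open>cj p\<close> lies on the cubic, so
    no term is cubic in the first two coordinates.\<close>
  have e: "B e0 e0 e0 = 0" "B e0 e0 e1 = 0" "B e1 e1 e0 = 0" "B e1 e1 e1 = 0"
    using e_relations(1)[of e0] e_relations(1)[of e1] e_relations(2)[of e0] e_relations(2)[of e1]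
      B_commute23[of e0 e1 e0] B_left_commute[of e0 e1 e1] by simp_all
  have "B (M *v x) (M *v x) (M *v x) =
      ((x $ 0)\<^sup>2 + (x $ 1)\<^sup>2) * lin l (x $ 2) (x $ 3) (x $ 4) +
      2 * (x $ 0 * quad (quad_coeffs e0) (x $ 2) (x $ 3) (x $ 4) + x $ 1 * quad (quad_coeffs e1) (x $ 2) (x $ 3) (x $ 4)) +
      cub cub_coeffs (x $ 2) (x $ 3) (x $ 4)" for x
  proof -
    define w where "w = x $ 2 *s er + x $ 3 *s es + x $ 4 *s et"
    have lin: "3 * B e0 e0 w = lin l (x $ 2) (x $ 3) (x $ 4)"
      by (simp add: w_def lin_def l_def B_linear algebra_simps)
    have quad: "3 / 2 * B e w w = quad (quad_coeffs e) (x $ 2) (x $ 3) (x $ 4)" for e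
      using B_commute23[of e er es] B_commute23[of e er et] B_commute23[of e es et]
      by (simp add: w_def quad_def quad_coeffs_def B_linear algebra_simps power2_eq_square)
    have cub: "B w w w = cub cub_coeffs (x $ 2) (x $ 3) (x $ 4)"
      by (simp add: w_def cub_def cub_coeffs_def B_linear algebra_simps power2_eq_square power3_eq_cube B_sym)
    have Mx: "M *v x = x $ 0 *s e0 + x $ 1 *s e1 + w" by (simp add: M_def columns5_mult w_def add_ac)
    have r: "B e1 e1 w = B e0 e0 w" "B e0 e1 w = 0" using e_relations by simp_all
    have n: "B e0 w e0 = B e0 e0 w" "B w e0 e0 = B e0 e0 w" "B e1 w e1 = B e1 e1 w" "B w e1 e1 = B e1 e1 w"
      "B e1 e0 w = B e0 e1 w" "B e0 w e1 = B e0 e1 w" "B e1 w e0 = B e0 e1 w" "B w e0 e1 = B e0 e1 w" "B w e1 e0 = B e0 e1 w"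
      "B w e0 w = B e0 w w" "B w w e0 = B e0 w w" "B w e1 w = B e1 w w" "B w w e1 = B e1 w w"
      "B e0 e1 e0 = B e0 e0 e1" "B e1 e0 e0 = B e0 e0 e1" "B e0 e1 e1 = B e1 e1 e0" "B e1 e0 e1 = B e1 e1 e0"
      by (metis B_sym)+
    have "B (M *v x) (M *v x) (M *v x) = ((x $ 0)\<^sup>2 + (x $ 1)\<^sup>2) * (3 * B e0 e0 w) +
        2 * (x $ 0 * (3 / 2 * B e0 w w) + x $ 1 * (3 / 2 * B e1 w w)) + B w w w"
      unfolding Mx by (simp add: B_linear n r e) (simp add: algebra_simps power2_eq_square)
    then show ?thesis unfolding lin quad cub .
  qed
  then have "birational_forms (\<lambda>x. B (M *v x) (M *v x) (M *v x))"
    using birational_norm[OF form_lin form_quad form_quad form_q form_cub norm z0(1) disjI1[OF z0(2)]] by simp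
  then show ?thesis by (rule birational_forms_linear[OF _ N])
qed

end

section \<open>Conjugate pairs of singular points\<close>

lemma im_scale: "im ((of_real a + \<i> * of_real b) *s x) = a *s im x + b *s re x"
  by (simp add: im_def re_def vec_eq_iff)

lemma cv_zero_combination:
  assumes "y0 *s re p + y1 *s im p + y2 *s re x + y3 *s im x = 0"
  shows "(y2 / 2 - y3 * \<i> / 2) *s x + (y2 / 2 + y3 * \<i> / 2) *s cj x + (y0 / 2 - y1 * \<i> / 2) *s p + (y0 / 2 + y1 * \<i> / 2) *s cj p = 0"
proof -
  have "(y2 / 2 - y3 * \<i> / 2) *s x + (y2 / 2 + y3 * \<i> / 2) *s cj x + (y0 / 2 - y1 * \<i> / 2) *s p + (y0 / 2 + y1 * \<i> / 2) *s cj p =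
      of_real y0 *s cv (re p) + of_real y1 *s cv (im p) + of_real y2 *s cv (re x) + of_real y3 *s cv (im x)"
    unfolding cv_re cv_im by (simp add: vec_eq_iff field_simps)
  also have "\<dots> = cv (y0 *s re p + y1 *s im p + y2 *s re x + y3 *s im x)"
    by (simp add: cv_add cv_scale)
  finally show ?thesis unfolding assms by simp
qed

text \<open>The six real and imaginary parts of \<open>p\<close>, \<open>P\<close>, \<open>Q\<close> are linearly dependent, so after rescaling
  \<open>P\<close> and \<open>Q\<close> their imaginary parts agree modulo \<open>p\<close>: this is the real point in which the projections
  from the line of the real lines \<open>P (cj P)\<close> and \<open>Q (cj Q)\<close> meet.\<close>

lemma rescale_conjugate_pairs:
  assumes "cubic_line c p (cj p)"
    and P: "real_cubic.sing c P" "tri c p (cj p) P \<noteq> 0" "cubic_line.off_line p (cj p) (cj P)" "\<And>a. cj P \<noteq> a *s P"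
    and Q: "real_cubic.sing c Q" "tri c p (cj p) Q \<noteq> 0" "cubic_line.off_line p (cj p) (cj Q)" "\<And>a. cj Q \<noteq> a *s Q"
  obtains u v c0 c1 where "u \<noteq> 0" "v \<noteq> 0" "im (v *s Q) = im (u *s P) + c0 *s re p + c1 *s im p"
proof -
  interpret cubic_line c p "cj p" by fact
  have ind: "y2 = 0 \<and> y3 = 0 \<and> y0 = 0 \<and> y1 = 0"
    if X: "sing X" "B p (cj p) X \<noteq> 0" "off_line (cj X)" "\<And>a. cj X \<noteq> a *s X"
      and 0: "y0 *s re p + y1 *s im p + y2 *s re X + y3 *s im X = 0" for X y0 y1 y2 y3
  proof -
    from pair_independent[OF X(1,2) sing_cj[OF X(1)] X(3,4) cv_zero_combination[OF 0]]
    have "complex_of_real y2 / 2 - y3 * \<i> / 2 = 0" "complex_of_real y0 / 2 - y1 * \<i> / 2 = 0" by blast+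
    then show ?thesis by (simp add: complex_eq_iff)
  qed
  \<comment> \<open>Six vectors in \<real>^5: either the first five are dependent, or they span
    \<open>im Q\<close>.\<close>
  obtain y0 y1 y2 y3 y4 y5 :: real where
    rel: "y0 *s re p + y1 *s im p + y2 *s re P + y3 *s im P + y4 *s re Q + y5 *s im Q = 0"
    and nontrivial: "\<not> (y0 = 0 \<and> y1 = 0 \<and> y2 = 0 \<and> y3 = 0 \<and> y4 = 0 \<and> y5 = 0)"
  proof (cases "\<forall>x0 x1 x2 x3 x4. x0 *s re p + x1 *s im p + x2 *s re P + x3 *s im P + x4 *s re Q = 0 \<longrightarrow>
      x0 = 0 \<and> x1 = 0 \<and> x2 = 0 \<and> x3 = 0 \<and> x4 = 0")
    case True
    obtain x0 x1 x2 x3 x4 where "im Q = x0 *s re p + x1 *s im p + x2 *s re P + x3 *s im P + x4 *s re Q"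
      using span5[of "re p" "im p" "re P" "im P" "re Q" "im Q"] True by blast
    then have "x0 *s re p + x1 *s im p + x2 *s re P + x3 *s im P + x4 *s re Q + (- 1) *s im Q = 0"
      by (simp add: vec_eq_iff)
    from that[OF this] show ?thesis by simp
  next
    case False
    then obtain x0 x1 x2 x3 x4 where "x0 *s re p + x1 *s im p + x2 *s re P + x3 *s im P + x4 *s re Q + 0 *s im Q = 0"
      "\<not> (x0 = 0 \<and> x1 = 0 \<and> x2 = 0 \<and> x3 = 0 \<and> x4 = 0)" by auto
    with that show ?thesis by blast
  qed
  \<comment> \<open>Without \<open>P\<close> the relation would involve only \<open>p\<close>,
    \<open>Q\<close> and their conjugates, which are independent.\<close>
  have P0: "\<not> (y2 = 0 \<and> y3 = 0)"
  proof
    assume 0: "y2 = 0 \<and> y3 = 0"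
    then have "y0 *s re p + y1 *s im p + y4 *s re Q + y5 *s im Q = 0" using rel by simp
    from ind[OF Q(1-4) this] 0 nontrivial show False by simp
  qed
  have Q0: "\<not> (y4 = 0 \<and> y5 = 0)"
  proof
    assume 0: "y4 = 0 \<and> y5 = 0"
    then have "y0 *s re p + y1 *s im p + y2 *s re P + y3 *s im P = 0" using rel by simp
    from ind[OF P(1-4) this] 0 nontrivial show False by simp
  qed
  show ?thesis
  proof (rule that)
    \<comment> \<open>The imaginary part of (y3 + i y2) P is y3 im P + y2 re P, the contribution of
      \<open>P\<close> to the relation; the signs for \<open>Q\<close> move its contribution to the
      other side.\<close>
    show "of_real y3 + \<i> * of_real y2 \<noteq> 0" using P0 by (auto simp: complex_eq_iff)
    show "of_real (- y5) + \<i> * of_real (- y4) \<noteq> 0" using Q0 by (auto simp: complex_eq_iff)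
    show "im ((of_real (- y5) + \<i> * of_real (- y4)) *s Q) =
        im ((of_real y3 + \<i> * of_real y2) *s P) + y0 *s re p + y1 *s im p"
    proof (rule vec_eq_iff[THEN iffD2], rule allI)
      fix i
      show "im ((of_real (- y5) + \<i> * of_real (- y4)) *s Q) $ i =
          (im ((of_real y3 + \<i> * of_real y2) *s P) + y0 *s re p + y1 *s im p) $ i"
        using arg_cong[OF rel, of "\<lambda>v. v $ i"]
        unfolding im_scale vector_add_component vector_smult_component zero_index by linarith
    qed
  qed
qed

lemma proj_point_neq:
  assumes "proj_point x \<noteq> proj_point y" "x \<noteq> 0"
  shows "x \<noteq> a *s y"
  using assms proj_point_scale[of a y] by (cases "a = 0") auto

lemma proj_point_cj: "proj_point (cj x) = proj_point (cj y) \<longleftrightarrow> proj_point x = proj_point y"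
proof -
  have "proj_point (cj x) = proj_point (cj y)" if "proj_point x = proj_point y" for x y :: "complex ^ 'n"
    using proj_point_eq_iff[OF that] by (metis cj_scale complex_cnj_zero_iff proj_point_scale)
  from this[of x y] this[of "cj x" "cj y"] show ?thesis by auto
qed

context finitely_singular_cubic
begin

text \<open>If the Hessian at the real node were zero, the cubic would be a cone with this vertex,
  and the line joining the vertex to the second singular point \<open>y\<close> would consist of
  singular points.\<close>

lemma birational_forms_real_node:
  assumes x: "sing x" "proj_point (cj x) = proj_point x" and y: "sing y" "proj_point y \<noteq> proj_point x"
  shows "birational_forms (\<lambda>x. B x x x)"
proof -
  obtain a where a: "cj x = a *s x" using proj_point_eq_iff[OF x(2)] by blast
  obtain i where i: "x $ i \<noteq> 0" using x(1) by (auto simp: sing_def vec_eq_iff)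
  \<comment> \<open>Dividing by a nonzero coordinate makes the representative real, as the factor
    relating it to its conjugate becomes 1.\<close>
  define z where "z = (1 / x $ i) *s x"
  have z: "sing z" unfolding z_def by (rule sing_scale[OF x(1)]) (use i in simp)
  have cnj_x: "cnj (x $ j) = a * x $ j" for j using arg_cong[OF a, of "\<lambda>v. v $ j"] by (simp add: cj_def)
  have "a \<noteq> 0" using cnj_x[of i] i by auto
  then have "cj z = z" unfolding z_def cj_scale a using i cnj_x[of i] by (simp add: vec_eq_iff)
  then have z_cv: "z = cv (re z)" using cv_re[of z] by (simp add: vec_eq_iff)
  define p where "p = re z"
  have p: "p \<noteq> 0" using z z_cv by (auto simp: sing_def p_def)
  have zv: "B z (cv v) (cv w) = of_real (B p v w)" for v w
    by (subst z_cv) (simp add: tri_cv p_def)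
  have Bp: "B p p v = 0" for v
  proof -
    have "of_real (B p p v) = B z z (cv v)" using zv[of p v] z_cv by (simp add: p_def)
    then show ?thesis using z by (simp add: sing_def)
  qed
  have "\<exists>v. B p v v \<noteq> 0"
  proof (rule ccontr)
    assume "\<not> ?thesis"
    then have 0: "B p v v = 0" for v by blast
    have polar: "B p v w = 0" for v w
      using 0[of "v + w"] 0[of v] 0[of w] B_commute23[of p w v] by (simp add: B_linear)
    have zvw: "B z v w = 0" for v w
      by (subst re_im[of v], subst re_im[of w]) (simp add: B_linear zv polar)
    have zs: "B v z w = 0" for v w using zvw[of v w] B_commute12[of v z w] by simp
    have yz: "y \<noteq> b *s z" for b
    proof -
      have "proj_point z = proj_point x" unfolding z_def by (rule proj_point_scale) (use i in simp)
      then show ?thesis using y by (intro proj_point_neq) (auto simp: sing_def)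
    qed
    have "sing (y + s *s z)" for s
      unfolding sing_def
    proof (intro conjI allI notI)
      assume "y + s *s z = 0"
      then have "y = (- s) *s z" by (simp add: eq_neg_iff_add_eq_0)
      with yz show False by blast
    next
      show "B (y + s *s z) (y + s *s z) w = 0" for w
        using y(1) by (simp add: B_linear zvw zs sing_def)
    qed
    then obtain s s' k where s: "s \<noteq> s'" "y + s *s z = k *s (y + s' *s z)"
      using sing_familyE[OF infinite_UNIV_char_0, of "\<lambda>s. y + s *s z"] by metis
    then have eq: "(1 - k) *s y = (k * s' - s) *s z" by (simp add: vec_eq_iff algebra_simps)
    show False
    proof (cases "k = 1")
      case True
      then have "z = 0" using eq s(1) by (simp add: vec_eq_iff)
      with z show False by (simp add: sing_def)
    next
      case False
      then have "y = (1 / (1 - k)) *s ((k * s' - s) *s z)" using eq by (intro smult_cancel) simp_all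
      then have "y = (1 / (1 - k) * (k * s' - s)) *s z" by (simp only: vector_smult_assoc)
      with yz show False by blast
    qed
  qed
  then obtain v where "B p v v \<noteq> 0" ..
  from birational_node[OF real_cubic_axioms refl p Bp this] show ?thesis .
qed

text \<open>Conjugation carries Hessian kernels along, so by \<open>deg\<close> and
  \<open>nondeg\<close> it preserves \<open>S\<close> and \<open>T\<close>. As it fixes no singular
  point, \<open>S\<close> is one conjugate pair and \<open>T\<close> consists of two.\<close>

lemma birational_forms_no_real_node:
  assumes no_real: "\<And>x. sing x \<Longrightarrow> proj_point (cj x) \<noteq> proj_point x"
    and sing: "{proj_point x | x. sing x} = S \<union> T" "S \<inter> T = {}" "card S = 2" "card T = 4"
    and deg: "\<And>x. sing x \<Longrightarrow> proj_point x \<in> S \<Longrightarrow> \<exists>k. (\<forall>a. k \<noteq> a *s x) \<and> (\<forall>v. B x k v = 0)"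
    and nondeg: "\<And>x k. sing x \<Longrightarrow> proj_point x \<in> T \<Longrightarrow> (\<And>v. B x k v = 0) \<Longrightarrow> \<exists>a. k = a *s x"
  shows "birational_forms (\<lambda>x. B x x x)"
proof -
  have mem: "sing x \<Longrightarrow> proj_point x \<in> S \<or> proj_point x \<in> T" for x using sing(1) by blast
  have ex: "\<exists>x. sing x \<and> X = proj_point x" if "X \<in> S \<or> X \<in> T" for X
  proof -
    have "X \<in> {proj_point x | x. sing x}" unfolding sing(1) using that by blast
    then show ?thesis by blast
  qed
  have "S \<noteq> {}" using sing(3) by auto
  then obtain p where p: "sing p" "proj_point p \<in> S" using ex by blast
  obtain k where k: "\<And>a. k \<noteq> a *s p" "\<And>v. B p k v = 0" using deg[OF p] by blast
  have cp: "proj_point (cj p) \<in> S"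
  proof (rule ccontr)
    assume "\<not> ?thesis"
    then have T: "proj_point (cj p) \<in> T" using mem[OF sing_cj[OF p(1)]] by blast
    have "B (cj p) (cj k) v = 0" for v using tri_cj[of c p k "cj v"] k(2) by simp
    from nondeg[OF sing_cj[OF p(1)] T this] obtain a where "cj k = a *s cj p" by blast
    then have "k = cnj a *s p" by (metis cj_cj cj_scale)
    with k(1) show False by blast
  qed
  have S: "S = {proj_point p, proj_point (cj p)}"
  proof (rule card_subset_eq[symmetric])
    show "finite S" using sing(3) by (simp add: card_ge_0_finite)
    show "card {proj_point p, proj_point (cj p)} = card S" using no_real[OF p(1)] sing(3) by simp
  qed (use p cp in auto)
  have cj_T: "proj_point (cj x) \<in> T" if x: "sing x" "proj_point x \<in> T" for x
  proof (rule ccontr)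
    assume "\<not> ?thesis"
    then have "proj_point (cj x) = proj_point p \<or> proj_point (cj x) = proj_point (cj p)"
      using mem[OF sing_cj[OF x(1)]] S by blast
    then have "proj_point x = proj_point (cj p) \<or> proj_point x = proj_point p"
      using proj_point_cj[of "cj x" p] proj_point_cj[of x p] by auto
    then show False using S x(2) sing(2) by auto
  qed
  have "T \<noteq> {}" using sing(4) by auto
  then obtain P where P: "sing P" "proj_point P \<in> T" using ex by blast
  have "\<not> T \<subseteq> {proj_point P, proj_point (cj P)}"
  proof
    assume "T \<subseteq> {proj_point P, proj_point (cj P)}"
    then have "card T \<le> card {proj_point P, proj_point (cj P)}" by (intro card_mono) auto
    also have "\<dots> \<le> 2" by (simp add: card_insert_if)
    finally show False using sing(4) by simp
  qed
  then obtain X where X: "X \<in> T" "X \<noteq> proj_point P" "X \<noteq> proj_point (cj P)" by blast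
  then obtain Q where Q: "sing Q" "proj_point Q \<in> T" "proj_point Q \<noteq> proj_point P" "proj_point Q \<noteq> proj_point (cj P)"
    using ex by blast
  have Q': "proj_point (cj Q) \<noteq> proj_point P" "proj_point (cj Q) \<noteq> proj_point (cj P)"
    using Q(3,4) proj_point_cj[of "cj Q" P] proj_point_cj[of Q P] by auto
  have T: "T = {proj_point P, proj_point (cj P), proj_point Q, proj_point (cj Q)}"
  proof (rule card_subset_eq[symmetric])
    show "finite T" using sing(4) by (simp add: card_ge_0_finite)
    have "card {proj_point P, proj_point (cj P), proj_point Q, proj_point (cj Q)} = 4"
      using no_real[OF P(1)] no_real[OF Q(1)] Q(3,4) Q' by (auto simp: card_insert_if)
    then show "card {proj_point P, proj_point (cj P), proj_point Q, proj_point (cj Q)} = card T" using sing(4) by simp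
  qed (use P Q cj_T in auto)
  have line: "cubic_line c p (cj p)"
  proof (unfold_locales)
    fix a b assume 0: "a *s p + b *s cj p = 0"
    have p0: "p \<noteq> 0" using p(1) by (simp add: sing_def)
    have b: "b = 0"
    proof (rule ccontr)
      assume n: "b \<noteq> 0"
      have eq: "cj p = (- a / b) *s p"
        using smult_solve[OF n, of a p 0 0 0 0 0 0 "cj p"] 0 by simp
      have "cj p \<noteq> 0" using sing_cj[OF p(1)] by (simp add: sing_def)
      from proj_point_neq[OF no_real[OF p(1)] this] eq show False by blast
    qed
    then show "a = 0 \<and> b = 0" using 0 p0 by simp
  qed (use p sing_cj in auto)
  interpret L: cubic_line c p "cj p" by (rule line)
  have k': "cj k \<noteq> a *s cj p" "B (cj p) (cj k) v = 0" for a v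
    using k(1)[of "cnj a"] cj_eq_iff[of k "cnj a *s p"] tri_cj[of c p k "cj v"] k(2) by (auto simp: cj_scale)
  have off: "L.off_line x" if x: "sing x" "proj_point x \<in> T" for x
  proof (rule L.sing_off_line[OF x(1)])
    have "x \<noteq> 0" using x(1) by (simp add: sing_def)
    moreover have "proj_point x \<noteq> proj_point p" "proj_point x \<noteq> proj_point (cj p)" using S x(2) sing(2) by auto
    ultimately show "x \<noteq> a *s p" "x \<noteq> a *s cj p" for a using proj_point_neq by blast+
  qed
  have l: "B p (cj p) x \<noteq> 0" if x: "sing x" "proj_point x \<in> T" for x
    using L.l_nonzero_off_line[OF k k' x(1) off[OF x]] .
  have neq0: "sing x \<Longrightarrow> x \<noteq> 0" for x by (simp add: sing_def)
  obtain u v c0 c1 where uv: "u \<noteq> 0" "v \<noteq> 0" "im (v *s Q) = im (u *s P) + c0 *s re p + c1 *s im p"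
    by (rule rescale_conjugate_pairs[OF line P(1) l[OF P] off[OF sing_cj[OF P(1)] cj_T[OF P]]
          proj_point_neq[OF no_real[OF P(1)] neq0[OF sing_cj[OF P(1)]]]
          Q(1) l[OF Q(1,2)] off[OF sing_cj[OF Q(1)] cj_T[OF Q(1,2)]]
          proj_point_neq[OF no_real[OF Q(1)] neq0[OF sing_cj[OF Q(1)]]]])
  have pp: "proj_point (u *s P) = proj_point P" "proj_point (v *s Q) = proj_point Q"
    "proj_point (cj (u *s P)) = proj_point (cj P)" "proj_point (cj (v *s Q)) = proj_point (cj Q)"
    using uv by (simp_all add: proj_point_scale cj_scale)
  have sing': "sing (u *s P)" "sing (v *s Q)" using sing_scale P(1) Q(1) uv by auto
  have sing'': "sing (cj (u *s P))" "sing (cj (v *s Q))" using sing_cj sing' by auto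
  have "conjugate_frame c p (u *s P) (v *s Q) k c0 c1"
  proof (unfold_locales)
    show "k \<noteq> a *s p" "B p k w = 0" for a w using k by auto
    show "sing (u *s P)" "sing (v *s Q)" by fact+
    show "L.off_line (u *s P)" "L.off_line (v *s Q)" using off sing' P(2) Q(2) pp by auto
    show "cj (u *s P) \<noteq> a *s (u *s P)" for a
      by (rule proj_point_neq[OF _ neq0[OF sing''(1)]]) (unfold pp, rule no_real[OF P(1)])
    show "v *s Q \<noteq> a *s (u *s P)" for a
      by (rule proj_point_neq[OF _ neq0[OF sing'(2)]]) (unfold pp, rule Q(3))
    show "v *s Q \<noteq> a *s cj (u *s P)" for a
      by (rule proj_point_neq[OF _ neq0[OF sing'(2)]]) (unfold pp, rule Q(4))
    show "cj (v *s Q) \<noteq> a *s (v *s Q)" for a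
      by (rule proj_point_neq[OF _ neq0[OF sing''(2)]]) (unfold pp, rule no_real[OF Q(1)])
    show "im (v *s Q) = im (u *s P) + c0 *s re p + c1 *s im p" by fact
  next
    fix x assume x: "sing x"
    then have "proj_point x \<in> {proj_point p, proj_point (cj p), proj_point (u *s P), proj_point (cj (u *s P)),
        proj_point (v *s Q), proj_point (cj (v *s Q))}"
      using mem[OF x] unfolding S T pp by blast
    then show "\<exists>a. x = a *s p \<or> x = a *s cj p \<or> x = a *s (u *s P) \<or> x = a *s cj (u *s P) \<or> x = a *s (v *s Q) \<or> x = a *s cj (v *s Q)"
      using proj_point_eq_iff[of x] by (elim insertE emptyE) metis+
  qed
  then interpret C: conjugate_frame c p "u *s P" "v *s Q" k c0 c1 .
  show ?thesis by (rule C.birational_forms_cubic)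
qed

end

theorem proposition5p7:
  fixes F :: "(5, real) mpoly"
  assumes "F \<noteq> 0" and "homogeneous 3 F"
    and "singularities_2An_4A1 2 (complexify F) \<or> singularities_2An_4A1 3 (complexify F)"
  shows "rational_threefold F"
proof -
  \<comment> \<open>Both types are covered by n >= 2, where the last term of the local equation has
    order at least three.\<close>
  obtain n where n: "n \<ge> 2" "singularities_2An_4A1 n (complexify F)" using assms(3) that[of 2] that[of 3] by auto
  obtain S T where ST: "singular_locus (complexify F) = S \<union> T" "S \<inter> T = {}" "card S = 2" "card T = 4"
    and A: "\<And>P. P \<in> S \<Longrightarrow> A_point n (complexify F) P" "\<And>P. P \<in> T \<Longrightarrow> A_point 1 (complexify F) P"
    using n(2) unfolding singularities_2An_4A1_def by blast
  obtain c where c: "\<And>i j k. c i j k = c j i k" "\<And>i j k. c i j k = c i k j"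
    and F: "\<And>x. eval F x = tri c x x x" "\<And>x. eval (complexify F) x = tri c x x x"
    using cubic_tri[OF assms(2)] by blast
  interpret real_cubic c by unfold_locales (use c in auto)
  have sing: "{proj_point x | x. sing x} = S \<union> T" using singular_locus_eq[OF F(2)] ST(1) by simp
  interpret finitely_singular_cubic c
    by unfold_locales (simp add: sing card_ge_0_finite ST)
  have "birational_forms (\<lambda>x. tri c x x x)"
  proof (cases "\<exists>x. sing x \<and> proj_point (cj x) = proj_point x")
    case True
    then obtain x where x: "sing x" "proj_point (cj x) = proj_point x" by blast
    have "\<not> S \<union> T \<subseteq> {proj_point x}"
    proof
      assume "S \<union> T \<subseteq> {proj_point x}"
      then have "card T \<le> card {proj_point x}" by (intro card_mono) auto
      then show False using ST(4) by simp
    qed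
    then obtain y where "sing y" "proj_point y \<noteq> proj_point x" unfolding sing[symmetric] by blast
    then show ?thesis by (rule birational_forms_real_node[OF x])
  next
    case False
    show ?thesis
    proof (rule birational_forms_no_real_node[OF _ sing ST(2-4)])
      show "proj_point (cj x) \<noteq> proj_point x" if "sing x" for x using False that by blast
      show "\<exists>k. (\<forall>a. k \<noteq> a *s x) \<and> (\<forall>v. B x k v = 0)" if "sing x" "proj_point x \<in> S" for x
        using A_point_degenerate[OF A(1)[OF that(2)] F(2) that(1) n(1)] by metis
      show "\<exists>a. k = a *s x" if "sing x" "proj_point x \<in> T" "\<And>v. B x k v = 0" for x k
        using A_point_nondegenerate[OF A(2)[OF that(2)] F(2) that(1,3)] by metis
    qed
  qed
  moreover have "eval F = (\<lambda>x. tri c x x x)" by (rule ext) (rule F(1))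
  ultimately have "birational F (0 :: (4, real) mpoly)"
    by (intro birational_if_forms) simp
  moreover have "irreducible F"
    by (rule irreducible_cubic[OF finitely_singular_cubic_axioms assms(2,1) F(2)])
  ultimately show ?thesis by (simp add: rational_threefold_def)
qed

end
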